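(* For all $\lambda\ge0$ and $a\in\mathcal E$, the function $\gamma\mapsto M(\lambda,\gamma,a)$ is (real-)analytic on $(0,1)$. For all $\gamma\in(0,1)$ and $a\in\mathcal E$, the function $\lambda\mapsto M(\lambda,\gamma,a)$ is (real-)analytic on $(0,\infty)$.
   Context: Marked random connection model (MRCM): let $d\ge1$ be an integer, $\mathcal E$ a Polish space with its Borel $\sigma$-algebra and a probability measure $\mathcal P$. Put $\mathbb X=\mathbb R^d\times\mathcal E$ and $\nu=\mathrm{Leb}\otimes\mathcal P$. The adjacency function $\varphi:\mathbb X^2\to[0,1]$ is measurable, symmetric ($\varphi(x,y)=\varphi(y,x)$), and depends only on the spatial displacement and the marks: $\varphi((\bar x,a),(\bar y,b))=\varphi(\bar x-\bar y;a,b)$. For intensity $\lambda\ge0$, the vertex set $\eta$ is a Poisson point process on $\mathbb X$ with intensity measure $\lambda\nu$; given $\eta$, each pair $\{x,y\}$ of distinct points of $\eta$ forms an edge independently with probability $\varphi(x,y)$. The resulting random graph is $\xi$, with law $\mathbb P_\lambda$. For $x\in\mathbb X$, $\xi^{x}$ is the graph obtained from $\xi$ by adding the vertex $x$ and, independently of everything else, connecting it to every other vertex with probability given by $\varphi$. Write $o_a=(\bar 0,a)$ for $a\in\mathcal E$. Magnetization: for $\gamma\in(0,1)$, attach to every vertex (including added ones) an independent uniform $(0,1)$ label, independent of everything else, and let $\mathbb P_{\lambda,\gamma}$ be the resulting law. A vertex is a ghost vertex if its label is at most $\gamma$; $\mathcal G$ is the set of ghost vertices. $M(\lambda,\gamma,a)=\mathbb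 P_{\lambda,\gamma}(o_a\leftrightarrow\mathcal G\text{ in }\xi^{o_a})$ is the probability that the cluster of $o_a$ in $\xi^{o_a}$ (including $o_a$ itself) contains a ghost vertex. *)

theory Defs
  imports "HOL-Probability.Probability" "HOL-Library.Extended_Nat"
begin

text \<open>Real analyticity of a function on an open set of reals: at every point the function is
  locally given by a power series of positive radius of convergence.\<close>

definition real_analytic_on :: "(real \<Rightarrow> real) \<Rightarrow> real set \<Rightarrow> bool" where
  "real_analytic_on f S \<longleftrightarrow> (\<forall>x\<in>S. \<exists>F. (\<lambda>h. f (x + h)) has_fps_expansion F)"


section \<open>Poisson point processes\<close>

text \<open>A point process is given by an enumeration of its points: on \<open>\<omega>\<close> the points are
  \<open>X i \<omega>\<close> for \<open>i < \<kappa> \<omega>\<close>, where the total number \<open>\<kappa> \<omega>\<close> of points may be infinite. The values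
  \<open>X i \<omega>\<close> with \<open>i \<ge> \<kappa> \<omega>\<close> are irrelevant.\<close>

definition point_count ::
    "('w \<Rightarrow> enat) \<Rightarrow> (nat \<Rightarrow> 'w \<Rightarrow> 'x) \<Rightarrow> 'x set \<Rightarrow> 'w \<Rightarrow> ennreal" where
  "point_count \<kappa> X B \<omega> = emeasure (count_space UNIV) {i. enat i < \<kappa> \<omega> \<and> X i \<omega> \<in> B}"

text \<open>The Poisson distribution with mean \<open>m \<in> [0,\<infinity>]\<close>, with the usual convention that mean
  \<open>\<infinity>\<close> stands for the point mass at \<open>\<infinity>\<close>.\<close>

definition poisson_distributed :: "'w measure \<Rightarrow> ('w \<Rightarrow> ennreal) \<Rightarrow> ennreal \<Rightarrow> bool" where
  "poisson_distributed \<Omega> N m \<longleftrightarrow>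
     (if m = \<infinity> then (AE \<omega> in \<Omega>. N \<omega> = \<infinity>)
      else (\<forall>n. measure \<Omega> {\<omega> \<in> space \<Omega>. N \<omega> = of_nat n} =
                  exp (- enn2real m) * enn2real m ^ n / fact n))"

definition poisson_process ::
    "'w measure \<Rightarrow> ('w \<Rightarrow> enat) \<Rightarrow> (nat \<Rightarrow> 'w \<Rightarrow> 'x) \<Rightarrow> 'x measure \<Rightarrow> bool" where
  "poisson_process \<Omega> \<kappa> X \<mu> \<longleftrightarrow>
     prob_space \<Omega> \<and>
     \<kappa> \<in> \<Omega> \<rightarrow>\<^sub>M count_space UNIV \<and>
     (\<forall>i. X i \<in> \<Omega> \<rightarrow>\<^sub>M \<mu>) \<and>
     (\<forall>B\<in>sets \<mu>. poisson_distributed \<Omega> (point_count \<kappa> X B) (emeasure \<mu> B)) \<and>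
     (\<forall>(B :: nat \<Rightarrow> 'x set) n.
        disjoint_family_on B {..<n} \<longrightarrow> (\<forall>j<n. B j \<in> sets \<mu>) \<longrightarrow>
        prob_space.indep_vars \<Omega> (\<lambda>_. borel) (\<lambda>j. point_count \<kappa> X (B j)) {..<n})"


section \<open>The marked random connection model\<close>

definition site_measure :: "'e measure \<Rightarrow> ((real ^ 'd) \<times> 'e) measure" where
  "site_measure P = lborel \<Otimes>\<^sub>M P"

definition adjacency_function ::
    "'e measure \<Rightarrow> ((real ^ 'd) \<times> 'e \<Rightarrow> (real ^ 'd) \<times> 'e \<Rightarrow> real) \<Rightarrow> bool" where
  "adjacency_function P \<phi> \<longleftrightarrow>
     (\<lambda>(x, y). \<phi> x y) \<in> borel_measurable (site_measure P \<Otimes>\<^sub>M site_measure P) \<and>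
     (\<forall>x y. 0 \<le> \<phi> x y \<and> \<phi> x y \<le> 1) \<and>
     (\<forall>x y. \<phi> x y = \<phi> y x) \<and>
     (\<exists>\<psi>. \<forall>x a y b. \<phi> (x, a) (y, b) = \<psi> (x - y) a b)"

text \<open>The vertices of the augmented graph \<open>\<xi>\<^sup>x\<close> are coded by \<open>nat option\<close>: the code \<open>None\<close> is the
  added vertex \<open>x\<close>, and \<open>Some i\<close> is the \<open>i\<close>-th point of the Poisson process. (As Lebesgue measure
  has no atoms, the points of the process are almost surely pairwise distinct.)\<close>

definition vertices :: "('w \<Rightarrow> enat) \<Rightarrow> 'w \<Rightarrow> nat option set" where
  "vertices \<kappa> \<omega> = insert None (Some ` {i. enat i < \<kappa> \<omega>})"

definition site :: "'x \<Rightarrow> (nat \<Rightarrow> 'w \<Rightarrow> 'x) \<Rightarrow> 'w \<Rightarrow> nat option \<Rightarrow> 'x" where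
  "site x X \<omega> v = (case v of None \<Rightarrow> x | Some i \<Rightarrow> X i \<omega>)"

text \<open>Every unordered pair of codes carries an independent uniform variable, and the pair is an
  edge iff this variable is at most the value of \<open>\<phi>\<close>; so, given the points, the edges are
  independent with probabilities given by \<open>\<phi>\<close>. Every code carries an independent uniform label.\<close>

definition uniform01 :: "real measure" where
  "uniform01 = uniform_measure lborel {0<..<1}"

definition pair_space :: "(nat option set \<Rightarrow> real) measure" where
  "pair_space = (\<Pi>\<^sub>M e \<in> {{v, w} | v w. v \<noteq> w}. uniform01)"

definition label_space :: "(nat option \<Rightarrow> real) measure" where
  "label_space = (\<Pi>\<^sub>M v \<in> UNIV. uniform01)"

definition mrcm_space ::
    "'w measure \<Rightarrow> ('w \<times> (nat option set \<Rightarrow> real) \<times> (nat option \<Rightarrow> real)) measure" where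
  "mrcm_space \<Omega> = \<Omega> \<Otimes>\<^sub>M (pair_space \<Otimes>\<^sub>M label_space)"

definition adjacent ::
    "('x \<Rightarrow> 'x \<Rightarrow> real) \<Rightarrow> ('w \<Rightarrow> enat) \<Rightarrow> (nat \<Rightarrow> 'w \<Rightarrow> 'x) \<Rightarrow> 'x \<Rightarrow>
      'w \<Rightarrow> (nat option set \<Rightarrow> real) \<Rightarrow> nat option \<Rightarrow> nat option \<Rightarrow> bool" where
  "adjacent \<phi> \<kappa> X x \<omega> u v w \<longleftrightarrow>
     v \<in> vertices \<kappa> \<omega> \<and> w \<in> vertices \<kappa> \<omega> \<and> v \<noteq> w \<and>
     u {v, w} \<le> \<phi> (site x X \<omega> v) (site x X \<omega> w)"

definition cluster ::
    "('x \<Rightarrow> 'x \<Rightarrow> real) \<Rightarrow> ('w \<Rightarrow> enat) \<Rightarrow> (nat \<Rightarrow> 'w \<Rightarrow> 'x) \<Rightarrow> 'x \<Rightarrow>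
      'w \<Rightarrow> (nat option set \<Rightarrow> real) \<Rightarrow> nat option set" where
  "cluster \<phi> \<kappa> X x \<omega> u = {w. (adjacent \<phi> \<kappa> X x \<omega> u)\<^sup>*\<^sup>* None w}"

definition magnetization ::
    "((real ^ 'd) \<times> 'e \<Rightarrow> (real ^ 'd) \<times> 'e \<Rightarrow> real) \<Rightarrow>
      'w measure \<Rightarrow> ('w \<Rightarrow> enat) \<Rightarrow> (nat \<Rightarrow> 'w \<Rightarrow> (real ^ 'd) \<times> 'e) \<Rightarrow>
      real \<Rightarrow> 'e \<Rightarrow> real" where
  "magnetization \<phi> \<Omega> \<kappa> X \<gamma> a =
     measure (mrcm_space \<Omega>)
       {(\<omega>, u, l) \<in> space (mrcm_space \<Omega>). \<exists>w \<in> cluster \<phi> \<kappa> X (0, a) \<omega> u. l w \<le> \<gamma>}"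

end

theory Submission
  imports Defs "HOL-Complex_Analysis.Complex_Analysis"
begin

text \<open>In a window of finite volume \<open>V\<close>, the cluster of the origin has \<open>n\<close> further vertices with
  probability \<open>a\<^sub>n(t) = t\<^sup>n \<integral> exp (- t G\<^sub>n) d\<rho>\<^sub>n\<close>, where \<open>\<rho>\<^sub>n\<close> is a finite measure on the configurations of
  these vertices and \<open>0 \<le> G\<^sub>n \<le> V\<close> is the volume of the points attached to one of them. The probability of
  no ghost in the cluster is \<open>\<Sum>n. (1 - \<gamma>)\<^sup>n\<^sup>+\<^sup>1 a\<^sub>n(t)\<close>. For complex \<open>z\<close> with \<open>Re z = s > 0\<close> one has
  \<open>\<bar>a\<^sub>n(z)\<bar> \<le> (\<bar>z\<bar> / s)\<^sup>n a\<^sub>n(s) \<le> (\<bar>z\<bar> / s)\<^sup>n\<close>, so that the series is bounded, uniformly in the window, on each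
  cone \<open>(1 - \<gamma>) \<bar>z\<bar> < q Re z\<close> with \<open>q < 1\<close>; as a function of \<open>\<gamma>\<close> it is bounded by \<open>1\<close> on the disc
  \<open>\<bar>1 - \<gamma>\<bar> < 1\<close>. When the windows exhaust the space the real values converge to those of the infinite
  model, and Montel's theorem yields a holomorphic extension of the limit.\<close>

section \<open>Holomorphic extensions of real limits\<close>

text \<open>Two features of the model shape the proof. The models at different intensities live on
  unrelated probability spaces, so nothing can be compared pathwise in \<open>t\<close>: the
  dependence on \<open>t\<close> must be isolated in explicit factors, with
  \<open>\<rho>\<^sub>n\<close> and \<open>G\<^sub>n\<close> built from the unscaled measure. And
  the Poisson process is known only through the joint laws of its counts, while its enumeration may
  list the points in an order that depends on their positions; integrals over positions have to be
  recovered from counts of disjoint sets. A finite window is what makes the formula available. It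
  holds finitely many points almost surely; the points outside the cluster contribute an exponential
  series, which meets the void probability of the window and leaves only the attached volume in the
  exponent. The bounds must forget the volume of the window. They do, since \<open>G\<^sub>n\<close>
  \<ge> 0 gives |exp (- z G)| = exp (- G Re z), and this brings back the real quantity at Re z, a
  probability. Convergence along the windows is known at real points only; any subsequential limit
  from Montel's theorem takes the right values there, and the real values are all that is
  wanted.\<close>

lemma real_analytic_on_holomorphic_extension:
  assumes U: "open U" and g: "g holomorphic_on U" and S: "\<And>t. t \<in> S \<Longrightarrow> complex_of_real t \<in> U"
    and gF: "\<And>t. complex_of_real t \<in> U \<Longrightarrow> g (of_real t) = of_real (F t)"
  shows "real_analytic_on F S"
  unfolding real_analytic_on_def
proof
  fix x assume "x \<in> S"
  then obtain r where r: "r > 0" "ball (complex_of_real x) r \<subseteq> U"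
    using S U open_contains_ball by meson
  \<comment> \<open>For real \<open>h\<close> the factor \<open>h ^ n\<close> passes through
    \<open>Re\<close>, and \<open>g\<close> takes the real value \<open>F (x + h)\<close> there.
    Taking real parts thus yields a real series without first showing that the derivatives of
    \<open>g\<close> at real points are real.\<close>
  define a where "a n = Re ((deriv ^^ n) g (of_real x) / fact n)" for n
  have sums: "(\<lambda>n. a n * h ^ n) sums F (x + h)" if h: "\<bar>h\<bar> < r" for h
  proof -
    have *: "complex_of_real (x + h) \<in> ball (of_real x) r"
      using h by (simp add: dist_norm)
    have "(\<lambda>n. (deriv ^^ n) g (of_real x) / fact n * (of_real (x + h) - of_real x) ^ n)
        sums g (of_real (x + h))"
      by (rule holomorphic_power_series[OF holomorphic_on_subset[OF g r(2)] *])
    then have "(\<lambda>n. Re ((deriv ^^ n) g (of_real x) / fact n * (of_real (x + h) - of_real x) ^ n))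
        sums Re (g (of_real (x + h)))"
      by (rule sums_Re)
    moreover have "Re (g (of_real (x + h))) = F (x + h)"
      using gF * r(2) by (metis Re_complex_of_real subsetD)
    moreover have "Re ((deriv ^^ n) g (of_real x) / fact n * (of_real (x + h) - of_real x) ^ n) = a n * h ^ n" for n
      unfolding a_def by (simp del: times_divide_eq_left flip: of_real_diff of_real_power)
    ultimately show ?thesis by simp
  qed
  \<comment> \<open>Convergence at one nonzero point bounds the radius of convergence from below;
    \<open>r / 2\<close> is such a point inside the disc.\<close>
  have "ereal (norm (r / 2)) \<le> conv_radius a"
    using sums[of "r / 2"] r(1) by (intro conv_radius_geI) (auto simp: sums_iff)
  then have pos: "fps_conv_radius (Abs_fps a) > 0"
    using r(1) unfolding fps_conv_radius_def fps_nth_Abs_fps by (simp add: less_le_trans[of _ "ereal (r/2)"])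
  have "eventually (\<lambda>h. h \<in> ball 0 r) (nhds (0::real))"
    using r(1) by (intro eventually_nhds_in_open) auto
  then have "eventually (\<lambda>h. eval_fps (Abs_fps a) h = F (x + h)) (nhds 0)"
    by eventually_elim (use sums in \<open>auto simp: eval_fps_def sums_iff\<close>)
  with pos show "\<exists>G. (\<lambda>h. F (x + h)) has_fps_expansion G"
    unfolding has_fps_expansion_def by blast
qed

text \<open>Montel's theorem gives a subsequence that converges on all of \<open>U\<close>; at real
  points its limit can only be \<open>F t\<close>, because the full sequence converges there. The
  bound \<open>B\<close> is inherited by the limit, so the lemma can be applied again to the
  functions that it produces: first to partial sums, then to windows.\<close>

lemma holomorphic_extension_of_pointwise_limit:
  fixes f :: "nat \<Rightarrow> complex \<Rightarrow> complex"
  assumes "open U" and hol: "\<And>m. f m holomorphic_on U"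
    and bd: "\<And>m z. z \<in> U \<Longrightarrow> norm (f m z) \<le> B"
    and lim: "\<And>t. complex_of_real t \<in> U \<Longrightarrow> (\<lambda>m. f m (of_real t)) \<longlonglongrightarrow> of_real (F t)"
  obtains g where "g holomorphic_on U" "\<And>z. z \<in> U \<Longrightarrow> norm (g z) \<le> B"
    "\<And>t. complex_of_real t \<in> U \<Longrightarrow> g (of_real t) = of_real (F t)"
proof -
  obtain g r where g: "g holomorphic_on U" and r: "strict_mono (r :: nat \<Rightarrow> nat)"
    and fg: "\<And>x. x \<in> U \<Longrightarrow> (\<lambda>n. f (r n) x) \<longlonglongrightarrow> g x"
    by (rule Montel[OF \<open>open U\<close>, of "range f" f]) (use hol bd in \<open>blast+\<close>)
  show ?thesis
  proof
    show "norm (g z) \<le> B" if "z \<in> U" for z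
      by (rule LIMSEQ_le_const2[OF tendsto_norm[OF fg[OF that]]]) (use bd that in blast)
    show "g (of_real t) = of_real (F t)" if "complex_of_real t \<in> U" for t
      using LIMSEQ_unique[OF fg[OF that]] LIMSEQ_subseq_LIMSEQ[OF lim[OF that] r]
      by (simp add: o_def)
  qed (fact g)
qed

text \<open>Expand the exponential at 0. With \<open>G\<close> bounded by \<open>V\<close> and a
  finite measure, the terms are dominated by those of the series of exp (|w| V), so sum and integral
  commute, and the result is a power series that converges on the whole plane.\<close>

lemma holomorphic_exp_moment:
  fixes G :: "'a \<Rightarrow> real"
  assumes "finite_measure \<rho>" and [measurable]: "G \<in> borel_measurable \<rho>"
    and G: "\<And>x. 0 \<le> G x" "\<And>x. G x \<le> V"
  shows "(\<lambda>z. \<integral>x. exp (- z * complex_of_real (G x)) \<partial>\<rho>) holomorphic_on UNIV"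
proof -
  interpret finite_measure \<rho> by fact
  have sums: "(\<lambda>n. (\<integral>x. (- complex_of_real (G x)) ^ n / fact n \<partial>\<rho>) * (w - 0) ^ n)
      sums (\<integral>x. exp (- w * complex_of_real (G x)) \<partial>\<rho>)" for w
  proof -
    let ?f = "\<lambda>n x. (- w * complex_of_real (G x)) ^ n /\<^sub>R fact n"
    have le: "norm (?f n x) \<le> (norm w * V) ^ n /\<^sub>R fact n" for n x
      using G by (auto simp: norm_mult norm_power power_mult_distrib divide_simps intro!: mult_left_mono power_mono)
    have int: "integrable \<rho> (?f n)" for n
      by (rule integrable_const_bound[where B="(norm w * V) ^ n /\<^sub>R fact n"]) (use le in auto)
    have "(\<lambda>n. \<integral>x. ?f n x \<partial>\<rho>) sums (\<integral>x. (\<Sum>n. ?f n x) \<partial>\<rho>)"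
    proof (rule sums_integral[OF int])
      show "AE x in \<rho>. summable (\<lambda>n. norm (?f n x))"
        by (intro AE_I2 summable_norm_exp)
      show "summable (\<lambda>n. \<integral>x. norm (?f n x) \<partial>\<rho>)"
      proof (rule summable_comparison_test')
        show "summable (\<lambda>n. (norm w * V) ^ n /\<^sub>R fact n * measure \<rho> (space \<rho>))"
          by (intro summable_mult2 summable_exp_generic)
        fix n show "norm (\<integral>x. norm (?f n x) \<partial>\<rho>) \<le> (norm w * V) ^ n /\<^sub>R fact n * measure \<rho> (space \<rho>)"
          using integral_mono[OF integrable_norm[OF int], of "\<lambda>_. (norm w * V) ^ n /\<^sub>R fact n" n] le
          by (simp add: mult.commute)
      qed
    qed
    moreover have "(\<Sum>n. ?f n x) = exp (- w * complex_of_real (G x))" for x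
      by (simp add: exp_def)
    moreover have "(\<integral>x. ?f n x \<partial>\<rho>) = (\<integral>x. (- complex_of_real (G x)) ^ n / fact n \<partial>\<rho>) * (w - 0) ^ n" for n
    proof -
      have "(\<integral>x. ?f n x \<partial>\<rho>) = (\<integral>x. ((- complex_of_real (G x)) ^ n / fact n) * w ^ n \<partial>\<rho>)"
        by (rule Bochner_Integration.integral_cong) (auto simp: power_mult_distrib scaleR_conv_of_real field_simps power_minus[of "_ * _"] power_minus[of w] power_minus[of "complex_of_real _"])
      then show ?thesis by simp
    qed
    ultimately show ?thesis by simp
  qed
  have "(\<lambda>z. \<integral>x. exp (- z * complex_of_real (G x)) \<partial>\<rho>) holomorphic_on ball 0 r" for r
    by (rule power_series_holomorphic[OF sums])
  then show ?thesis
    by (meson UNIV_I holomorphic_on_def centre_in_ball field_differentiable_at_within holomorphic_on_open open_ball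
        dual_order.strict_trans1 field_differentiable_def linorder_not_le mem_ball_0 open_UNIV gt_ex)
qed

text \<open>The limit is over the partial sums in \<open>n\<close>. The bound \<open>V\<close> makes
  every single term entire, whereas the final bound \<open>1 / (1 - q)\<close> comes from a
  geometric series and depends on \<open>q\<close> alone; this is why it survives the later limit,
  in which \<open>V\<close> tends to infinity.\<close>

lemma holomorphic_exp_moment_series:
  fixes G :: "nat \<Rightarrow> 'a \<Rightarrow> real" and \<rho> :: "nat \<Rightarrow> 'a measure"
  assumes fin: "\<And>n. finite_measure (\<rho> n)" and meas: "\<And>n. G n \<in> borel_measurable (\<rho> n)"
    and G: "\<And>n x. 0 \<le> G n x" "\<And>n x. G n x \<le> V"
    and a_le: "\<And>n s. s > 0 \<Longrightarrow> s ^ n * (\<integral>x. exp (- s * G n x) \<partial>\<rho> n) \<le> 1"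
    and c: "0 \<le> c" "c < q" "q < 1"
  obtains g where "g holomorphic_on {z. c * norm z < q * Re z}"
    "\<And>z. c * norm z < q * Re z \<Longrightarrow> norm (g z) \<le> 1 / (1 - q)"
    "\<And>t. t > 0 \<Longrightarrow> g (of_real t) = of_real (\<Sum>n. c ^ Suc n * (t ^ n * (\<integral>x. exp (- t * G n x) \<partial>\<rho> n)))"
proof -
  let ?U = "{z. c * norm z < q * Re z}"
  let ?a = "\<lambda>n s. s ^ n * (\<integral>x. exp (- s * G n x) \<partial>\<rho> n)"
  let ?A = "\<lambda>n z. z ^ n * (\<integral>x. exp (- z * complex_of_real (G n x)) \<partial>\<rho> n)"
  let ?f = "\<lambda>N z. \<Sum>n<N. of_real (c ^ Suc n) * ?A n z"
  have pos: "Re z > 0" if "z \<in> ?U" for z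
    using that c by (smt (verit) mem_Collect_eq mult_nonneg_nonneg norm_ge_zero zero_less_mult_pos)
  have a_nonneg: "?a n s \<ge> 0" if "s > 0" for n s
    using that by (intro mult_nonneg_nonneg integral_nonneg_AE) auto
  have A_real: "?A n (of_real t) = of_real (?a n t)" for n t
  proof -
    have "exp (- of_real t * complex_of_real (G n x)) = of_real (exp (- t * G n x))" for x
      by (simp flip: exp_of_real)
    then show ?thesis by simp
  qed
  have bound: "norm (?f N z) \<le> 1 / (1 - q)" if z: "z \<in> ?U" for N z
  proof -
    have s: "Re z > 0" by (rule pos[OF z])
    have term_le: "norm (of_real (c ^ Suc n) * ?A n z) \<le> q ^ n" for n
    proof -
      have "norm (\<integral>x. exp (- z * complex_of_real (G n x)) \<partial>\<rho> n)
          \<le> (\<integral>x. norm (exp (- z * complex_of_real (G n x))) \<partial>\<rho> n)"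
        by (rule integral_norm_bound)
      also have "\<dots> = (\<integral>x. exp (- Re z * G n x) \<partial>\<rho> n)"
        by (simp add: norm_exp_eq_Re)
      finally have 1: "norm (?A n z) \<le> norm z ^ n * (\<integral>x. exp (- Re z * G n x) \<partial>\<rho> n)"
        by (simp add: norm_mult norm_power mult_left_mono)
      have "norm (of_real (c ^ Suc n) * ?A n z) = c ^ Suc n * norm (?A n z)"
        using c by (simp add: norm_mult norm_power)
      also have "\<dots> \<le> c ^ Suc n * (norm z ^ n * (\<integral>x. exp (- Re z * G n x) \<partial>\<rho> n))"
        using c 1 by (intro mult_left_mono) auto
      \<comment> \<open>Of the \<open>n + 1\<close> factors \<open>c\<close>, \<open>n\<close> are
        paired with \<open>norm z / Re z\<close>; the cone makes each pair at most \<open>q\<close>,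
        and the spare \<open>c\<close> is at most 1.\<close>
      also have "\<dots> = c * (c * norm z / Re z) ^ n * ?a n (Re z)"
        using s by (simp add: field_simps power_mult_distrib power_divide)
      also have "\<dots> \<le> 1 * q ^ n * 1"
        using c s z a_le[OF s, of n] a_nonneg[OF s, of n]
        by (intro mult_mono power_mono) (auto simp: divide_simps)
      finally show ?thesis by simp
    qed
    have "norm (?f N z) \<le> (\<Sum>n<N. q ^ n)"
      by (rule order_trans[OF norm_sum sum_mono[OF term_le]])
    also have "\<dots> \<le> (\<Sum>n. q ^ n)"
      by (rule sum_le_suminf[OF summable_geometric]) (use c in auto)
    also have "\<dots> = 1 / (1 - q)"
      by (rule suminf_geometric) (use c in auto)
    finally show ?thesis .
  qed
  have lim: "(\<lambda>N. ?f N (of_real t)) \<longlonglongrightarrow> of_real (\<Sum>n. c ^ Suc n * ?a n t)"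
    if t: "complex_of_real t \<in> ?U" for t
  proof -
    have t0: "t > 0" using pos[OF t] by simp
    have "summable (\<lambda>n. c ^ Suc n * ?a n t)"
    proof (rule summable_comparison_test')
      show "summable (\<lambda>n. c ^ n * c)"
        by (rule summable_mult2[OF summable_geometric]) (use c in auto)
      fix n
      have "norm (c ^ Suc n * ?a n t) = c ^ Suc n * ?a n t"
        unfolding real_norm_def using c
        by (intro abs_of_nonneg mult_nonneg_nonneg[OF _ a_nonneg[OF t0]]) auto
      also have "\<dots> \<le> c ^ Suc n * 1"
        using c by (intro mult_left_mono a_le t0) auto
      finally show "norm (c ^ Suc n * ?a n t) \<le> c ^ n * c"
        by (simp add: mult.commute)
    qed
    then have "(\<lambda>N. \<Sum>n<N. c ^ Suc n * ?a n t) \<longlonglongrightarrow> (\<Sum>n. c ^ Suc n * ?a n t)"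
      by (rule summable_LIMSEQ)
    then have "(\<lambda>N. complex_of_real (\<Sum>n<N. c ^ Suc n * ?a n t)) \<longlonglongrightarrow> of_real (\<Sum>n. c ^ Suc n * ?a n t)"
      by (rule tendsto_of_real)
    moreover have "?f N (of_real t) = of_real (\<Sum>n<N. c ^ Suc n * ?a n t)" for N
      by (simp only: A_real of_real_sum of_real_mult)
    ultimately show ?thesis by simp
  qed
  have oU: "open ?U"
    by (intro open_Collect_less continuous_intros)
  have hol: "?f N holomorphic_on ?U" for N
  proof -
    have "(\<lambda>z. \<integral>x. exp (- z * complex_of_real (G n x)) \<partial>\<rho> n) holomorphic_on ?U" for n
      using holomorphic_exp_moment[OF fin meas G] by (rule holomorphic_on_subset) simp
    then show ?thesis by (intro holomorphic_intros)
  qed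
  show ?thesis
  proof (rule holomorphic_extension_of_pointwise_limit[OF oU hol bound lim])
    fix g assume g: "g holomorphic_on ?U" "\<And>z. z \<in> ?U \<Longrightarrow> norm (g z) \<le> 1 / (1 - q)"
      "\<And>t. complex_of_real t \<in> ?U \<Longrightarrow> g (of_real t) = of_real (\<Sum>n. c ^ Suc n * ?a n t)"
    show thesis
    proof (rule that[OF g(1)])
      show "norm (g z) \<le> 1 / (1 - q)" if "c * norm z < q * Re z" for z
        using g(2) that by blast
      show "g (of_real t) = of_real (\<Sum>n. c ^ Suc n * ?a n t)" if "t > 0" for t
        using that c by (intro g(3)) simp
    qed
  qed
qed

text \<open>The variable is \<gamma>, so \<open>ball 1 1\<close> is the open unit disc for 1 -
  \<gamma>. There every partial sum is dominated by a partial sum of the nonnegative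
  coefficients.\<close>

lemma holomorphic_generating_function:
  fixes a :: "nat \<Rightarrow> real"
  assumes a: "\<And>n. 0 \<le> a n" and le: "\<And>N. (\<Sum>n<N. a n) \<le> 1"
  obtains g where "g holomorphic_on ball 1 1" "\<And>z. z \<in> ball 1 1 \<Longrightarrow> norm (g z) \<le> 1"
    "\<And>t. complex_of_real t \<in> ball 1 1 \<Longrightarrow> g (of_real t) = of_real (\<Sum>n. (1 - t) ^ Suc n * a n)"
proof (rule holomorphic_extension_of_pointwise_limit)
  let ?f = "\<lambda>N z. \<Sum>n<N. (1 - z) ^ Suc n * complex_of_real (a n)"
  have small: "norm (1 - z) \<le> 1" if "z \<in> ball 1 1" for z :: complex
    using that by (simp add: dist_norm)
  show "?f N holomorphic_on ball 1 1" for N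
    by (intro holomorphic_intros)
  show "norm (?f N z) \<le> 1" if z: "z \<in> ball 1 1" for N z
  proof -
    have "norm ((1 - z) ^ Suc n * complex_of_real (a n)) \<le> a n" for n
      using mult_right_mono[OF power_le_one[OF norm_ge_zero small[OF z], of "Suc n"] a[of n]] a[of n]
      by (simp add: norm_mult norm_power)
    then have "norm (?f N z) \<le> (\<Sum>n<N. a n)"
      by (intro order_trans[OF norm_sum] sum_mono)
    with le[of N] show ?thesis by simp
  qed
  show "(\<lambda>N. ?f N (of_real t)) \<longlonglongrightarrow> of_real (\<Sum>n. (1 - t) ^ Suc n * a n)"
    if t: "complex_of_real t \<in> ball 1 1" for t
  proof -
    have "summable a" using a le by (intro summableI_nonneg_bounded) auto
    moreover have "norm ((1 - t) ^ Suc n * a n) \<le> a n" for n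
    proof -
      have "\<bar>1 - t\<bar> \<le> 1"
        using small[OF t] by (metis norm_of_real of_real_1 of_real_diff)
      then have "\<bar>1 - t\<bar> ^ Suc n * a n \<le> 1 * a n"
        using a[of n] by (intro mult_right_mono power_le_one) auto
      then show ?thesis using a[of n] by (simp add: abs_mult power_abs)
    qed
    ultimately have "summable (\<lambda>n. (1 - t) ^ Suc n * a n)"
      by (rule summable_comparison_test')
    then have "(\<lambda>N. complex_of_real (\<Sum>n<N. (1 - t) ^ Suc n * a n)) \<longlonglongrightarrow> of_real (\<Sum>n. (1 - t) ^ Suc n * a n)"
      by (intro tendsto_of_real summable_LIMSEQ)
    moreover have "?f N (of_real t) = of_real (\<Sum>n<N. (1 - t) ^ Suc n * a n)" for N
      by (simp only: of_real_sum of_real_mult of_real_power of_real_diff of_real_1)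
    ultimately show ?thesis by simp
  qed
qed auto

text \<open>The analytic core, free of probability: \<open>M m\<close> stands for the magnetization
  in the window \<open>m\<close> and \<open>F\<close> for its limit. The case \<gamma> = 0 is
  included in \<open>sums\<close> on purpose: with \<open>M\<close> \<ge> 0 it shows that the
  \<open>a m n s\<close> sum to at most 1 over \<open>n\<close>, the source of both uniform
  bounds.\<close>

lemma real_analytic_on_exp_moment_limit:
  fixes G :: "nat \<Rightarrow> nat \<Rightarrow> 'a \<Rightarrow> real" and \<rho> :: "nat \<Rightarrow> nat \<Rightarrow> 'a measure"
  defines "a \<equiv> \<lambda>m n s. s ^ n * (\<integral>x. exp (- s * G m n x) \<partial>\<rho> m n)"
  assumes fin: "\<And>m n. finite_measure (\<rho> m n)" and meas: "\<And>m n. G m n \<in> borel_measurable (\<rho> m n)"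
    and G: "\<And>m n x. 0 \<le> G m n x" "\<And>m n x. G m n x \<le> V m"
    and sums: "\<And>m s \<gamma>. 0 \<le> s \<Longrightarrow> 0 \<le> \<gamma> \<Longrightarrow> \<gamma> < 1 \<Longrightarrow>
      (\<lambda>n. (1 - \<gamma>) ^ Suc n * a m n s) sums (1 - M m s \<gamma>)"
    and M: "\<And>m s \<gamma>. 0 \<le> M m s \<gamma>"
    and lim: "\<And>s \<gamma>. 0 \<le> s \<Longrightarrow> 0 < \<gamma> \<Longrightarrow> \<gamma> < 1 \<Longrightarrow> (\<lambda>m. M m s \<gamma>) \<longlonglongrightarrow> F s \<gamma>"
  shows "0 \<le> s \<Longrightarrow> real_analytic_on (F s) {0<..<1}"
    and "\<gamma> \<in> {0<..<1} \<Longrightarrow> real_analytic_on (\<lambda>s. F s \<gamma>) {0<..}"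
proof -
  have a_nonneg: "a m n s \<ge> 0" if "s \<ge> 0" for m n s
    unfolding a_def using that by (intro mult_nonneg_nonneg integral_nonneg_AE) auto
  have partial: "(\<Sum>n<N. a m n s) \<le> 1" if "s \<ge> 0" for N m s
  proof -
    have "(\<lambda>n. a m n s) sums (1 - M m s 0)"
      using sums[OF that, of 0] by simp
    then have "(\<Sum>n<N. a m n s) \<le> 1 - M m s 0"
      using a_nonneg[OF that] by (metis finite_lessThan sum_le_suminf sums_iff)
    with M[of m s 0] show ?thesis by simp
  qed
  {
    assume s: "0 \<le> s"
    define Q where "Q m g \<longleftrightarrow> g holomorphic_on ball 1 1 \<and> (\<forall>z\<in>ball 1 1. norm (g z) \<le> 1) \<and>
       (\<forall>t. complex_of_real t \<in> ball 1 1 \<longrightarrow> g (of_real t) = complex_of_real (\<Sum>n. (1 - t) ^ Suc n * a m n s))" for m g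
    have "\<exists>g. Q m g" for m
    proof (rule holomorphic_generating_function[of "\<lambda>n. a m n s", OF a_nonneg[OF s] partial[OF s]])
      fix g assume "g holomorphic_on ball 1 1" "\<And>z. z \<in> ball 1 1 \<Longrightarrow> norm (g z) \<le> 1"
        "\<And>t. complex_of_real t \<in> ball 1 1 \<Longrightarrow> g (of_real t) = of_real (\<Sum>n. (1 - t) ^ Suc n * a m n s)"
      then have "Q m g" unfolding Q_def by blast
      then show "\<exists>g. Q m g" by blast
    qed
    then obtain g where "\<And>m. Q m (g m)" by metis
    then have g: "\<And>m. g m holomorphic_on ball 1 1" "\<And>m z. z \<in> ball 1 1 \<Longrightarrow> norm (g m z) \<le> 1"
       "\<And>m t. complex_of_real t \<in> ball 1 1 \<Longrightarrow> g m (of_real t) = of_real (\<Sum>n. (1 - t) ^ Suc n * a m n s)"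
      unfolding Q_def by blast+
    \<comment> \<open>The limit is known for 0 < \<gamma> < 1, while \<open>ball 1 1\<close> has
      real points up to 2. This smaller disc meets the real line exactly in the interval
      (0,1).\<close>
    define D where "D = ball (1/2::complex) (1/2)"
    have D: "D \<subseteq> ball 1 1"
    proof
      fix z assume "z \<in> D"
      then have "dist (1/2) z < 1/2" by (simp add: D_def)
      moreover have "dist (1::complex) (1/2) = 1/2" by (simp add: dist_norm)
      ultimately show "z \<in> ball 1 1"
        using dist_triangle[of 1 z "1/2"] by simp
    qed
    have D01: "complex_of_real t \<in> D \<longleftrightarrow> 0 < t \<and> t < 1" for t
    proof -
      have "(1/2::complex) = of_real (1/2)" by simp
      then have "dist (1/2) (complex_of_real t) = \<bar>1/2 - t\<bar>"
        by (metis dist_of_real dist_real_def)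
      then show ?thesis unfolding D_def by (auto simp: abs_if)
    qed
    obtain h where h: "h holomorphic_on D"
      "\<And>t. complex_of_real t \<in> D \<Longrightarrow> h (of_real t) = of_real (1 - F s t)"
    proof (rule holomorphic_extension_of_pointwise_limit[of D g 1 "\<lambda>t. 1 - F s t"])
      show "(\<lambda>m. g m (of_real t)) \<longlonglongrightarrow> complex_of_real (1 - F s t)" if t: "complex_of_real t \<in> D" for t
      proof -
        have t01: "0 < t" "t < 1" using t D01 by auto
        have "g m (of_real t) = of_real (1 - M m s t)" for m
          unfolding g(3)[OF subsetD[OF D t]] sums_unique[OF sums[OF s], symmetric, OF less_imp_le[OF t01(1)] t01(2)] ..
        then show ?thesis
          using lim[OF s t01] by (auto intro!: tendsto_intros)
      qed
      show "open D" by (simp add: D_def)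
      show "g m holomorphic_on D" for m by (rule holomorphic_on_subset[OF g(1) D])
      show "norm (g m z) \<le> 1" if "z \<in> D" for m z by (rule g(2)[OF subsetD[OF D that]])
    qed blast
    show "real_analytic_on (F s) {0<..<1}"
    proof (rule real_analytic_on_holomorphic_extension)
      show "open D" by (simp add: D_def)
      show "(\<lambda>z. 1 - h z) holomorphic_on D" by (intro holomorphic_intros h)
      show "complex_of_real t \<in> D" if "t \<in> {0<..<1}" for t using that D01 by simp
      show "1 - h (of_real t) = of_real (F s t)" if "complex_of_real t \<in> D" for t
        unfolding h(2)[OF that] by simp
    qed
  }
  {
    assume \<gamma>: "\<gamma> \<in> {0<..<1}"
    \<comment> \<open>\<open>q\<close> is the midpoint of \<open>c\<close> and 1:
      \<open>c < q\<close> puts every positive real into the cone, and \<open>q < 1\<close> makes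
      the geometric bound finite.\<close>
    define c q where "c = 1 - \<gamma>" and "q = (1 + c) / 2"
    have c: "0 \<le> c" "c < q" "q < 1" using \<gamma> by (auto simp: c_def q_def)
    define U where "U = {z. c * norm z < q * Re z}"
    have U_pos: "t > 0" if "complex_of_real t \<in> U" for t
      using that c unfolding U_def 
      by (smt (verit) Re_complex_of_real mem_Collect_eq mult_nonneg_nonneg norm_ge_zero zero_less_mult_pos)
    have pos_U: "complex_of_real t \<in> U" if "t > 0" for t
      using that c unfolding U_def by (auto simp: abs_mult)
    have a_le: "a m n t \<le> 1" if "t > 0" for m n t
    proof -
      have "a m n t \<le> (\<Sum>n<Suc n. a m n t)" using a_nonneg[of t m] that by (intro member_le_sum) auto
      with partial[of t m "Suc n"] that show ?thesis by simp
    qed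
    define Q where "Q m g \<longleftrightarrow> g holomorphic_on U \<and> (\<forall>z\<in>U. norm (g z) \<le> 1 / (1 - q)) \<and>
       (\<forall>t>0. g (of_real t) = complex_of_real (\<Sum>n. c ^ Suc n * a m n t))" for m g
    have "\<exists>g. Q m g" for m
    proof (rule holomorphic_exp_moment_series[of "\<rho> m" "G m" "V m" c q, OF fin meas G a_le[unfolded a_def] c])
      fix g assume "g holomorphic_on {z. c * norm z < q * Re z}"
        "\<And>z. c * norm z < q * Re z \<Longrightarrow> norm (g z) \<le> 1 / (1 - q)"
        "\<And>t. t > 0 \<Longrightarrow> g (of_real t) = complex_of_real (\<Sum>n. c ^ Suc n * (t ^ n * (\<integral>x. exp (- t * G m n x) \<partial>\<rho> m n)))"
      then have "Q m g" unfolding Q_def U_def a_def by simp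
      then show "\<exists>g. Q m g" by blast
    qed
    then obtain g where "\<And>m. Q m (g m)" by metis
    then have g: "\<And>m. g m holomorphic_on U" "\<And>m z. z \<in> U \<Longrightarrow> norm (g m z) \<le> 1 / (1 - q)"
       "\<And>m t. t > 0 \<Longrightarrow> g m (of_real t) = of_real (\<Sum>n. c ^ Suc n * a m n t)"
      unfolding Q_def by blast+
    have oU: "open U"
      unfolding U_def by (intro open_Collect_less continuous_intros)
    obtain h where h: "h holomorphic_on U"
      "\<And>t. complex_of_real t \<in> U \<Longrightarrow> h (of_real t) = of_real (1 - F t \<gamma>)"
    proof (rule holomorphic_extension_of_pointwise_limit[of U g "1 / (1 - q)" "\<lambda>t. 1 - F t \<gamma>"])
      show "(\<lambda>m. g m (of_real t)) \<longlonglongrightarrow> complex_of_real (1 - F t \<gamma>)" if t: "complex_of_real t \<in> U" for t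
      proof -
        have "g m (of_real t) = of_real (1 - M m t \<gamma>)" for m
          using sums_unique[OF sums[of t \<gamma> m]] \<gamma> U_pos[OF t] unfolding g(3)[OF U_pos[OF t]] c_def by simp
        then show ?thesis
          using lim[of t \<gamma>] U_pos[OF t] \<gamma> by (auto intro!: tendsto_intros)
      qed
      show "open U" by (fact oU)
      show "g m holomorphic_on U" for m by (rule g(1))
      show "norm (g m z) \<le> 1 / (1 - q)" if "z \<in> U" for m z by (rule g(2)[OF that])
    qed blast
    show "real_analytic_on (\<lambda>s. F s \<gamma>) {0<..}"
    proof (rule real_analytic_on_holomorphic_extension)
      show "(\<lambda>z. 1 - h z) holomorphic_on U" by (intro holomorphic_intros h)
      show "complex_of_real t \<in> U" if "t \<in> {0<..}" for t using that pos_U by simp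
      show "1 - h (of_real t) = of_real (F t \<gamma>)" if "complex_of_real t \<in> U" for t
        unfolding h(2)[OF that] by simp
    qed (fact oU)
  }
qed

section \<open>The Janossy measures of a Poisson process\<close>

definition points :: "('w \<Rightarrow> enat) \<Rightarrow> (nat \<Rightarrow> 'w \<Rightarrow> 'x) \<Rightarrow> 'x set \<Rightarrow> 'w \<Rightarrow> nat set" where
  "points \<kappa> X B \<omega> = {i. enat i < \<kappa> \<omega> \<and> X i \<omega> \<in> B}"

lemma point_count_eq_of_nat_iff:
  "point_count \<kappa> X B \<omega> = of_nat n \<longleftrightarrow> finite (points \<kappa> X B \<omega>) \<and> card (points \<kappa> X B \<omega>) = n"
  unfolding point_count_def points_def[symmetric]
  by (cases "finite (points \<kappa> X B \<omega>)") (simp_all add: emeasure_count_space)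

text \<open>Extensionality fixes the values outside \<open>{..<k}\<close>. Hence the set is
  countable, as Tonelli's theorem with counting measure requires, and each ordering of
  \<open>k\<close> points is counted once.\<close>

definition injections :: "nat \<Rightarrow> (nat \<Rightarrow> nat) set" where
  "injections k = {\<sigma> \<in> {..<k} \<rightarrow>\<^sub>E UNIV. inj_on \<sigma> {..<k}}"

lemma countable_injections: "countable (injections k)"
  unfolding injections_def by (rule countable_subset[of _ "{..<k} \<rightarrow>\<^sub>E UNIV"]) (auto intro!: countable_PiE)

text \<open>Intended for \<open>\<sigma>\<close> in \<open>injections k\<close>, where it says that
  \<open>\<sigma>\<close> lists all points in \<open>B\<close> in some order: an injection into a
  set of the same finite size is onto. In this form the condition is visibly an event, made of one
  count and finitely many memberships.\<close>

definition enumerates ::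
    "('w \<Rightarrow> enat) \<Rightarrow> (nat \<Rightarrow> 'w \<Rightarrow> 'x) \<Rightarrow> 'x set \<Rightarrow> nat \<Rightarrow> 'w \<Rightarrow> (nat \<Rightarrow> nat) \<Rightarrow> bool" where
  "enumerates \<kappa> X B k \<omega> \<sigma> \<longleftrightarrow> point_count \<kappa> X B \<omega> = of_nat k \<and> \<sigma> ` {..<k} \<subseteq> points \<kappa> X B \<omega>"

lemma enumerates_bij_betw:
  assumes "\<sigma> \<in> injections k" "enumerates \<kappa> X B k \<omega> \<sigma>"
  shows "bij_betw \<sigma> {..<k} (points \<kappa> X B \<omega>)"
proof -
  have "finite (points \<kappa> X B \<omega>)" "card (points \<kappa> X B \<omega>) = k" "inj_on \<sigma> {..<k}"
    "\<sigma> ` {..<k} \<subseteq> points \<kappa> X B \<omega>"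
    using assms by (auto simp: enumerates_def point_count_eq_of_nat_iff injections_def)
  then show ?thesis
    using card_subset_eq[of "points \<kappa> X B \<omega>" "\<sigma> ` {..<k}"] by (simp add: bij_betw_def card_image)
qed

text \<open>Disjointness leaves one choice for each place: \<open>i\<close> must be sent to the
  index of the only point in \<open>B i\<close>. So the sum over all orderings is 1 or 0 according
  to an event on counts alone, whatever order the process itself uses. This is the bridge from
  ordered tuples to the counts, whose law is known.\<close>

lemma disjoint_enumerations_singleton:
  fixes \<kappa> :: "'w \<Rightarrow> enat" and \<omega> :: 'w and X :: "nat \<Rightarrow> 'w \<Rightarrow> 'x"
  assumes disj: "disjoint_family_on B {..<k}" and sub: "\<And>i. i < k \<Longrightarrow> B i \<subseteq> \<Lambda>"
  defines "S \<equiv> {\<sigma> \<in> injections k. enumerates \<kappa> X \<Lambda> k \<omega> \<sigma> \<and> (\<forall>i<k. X (\<sigma> i) \<omega> \<in> B i)}"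
  defines "E \<equiv> (\<forall>i<k. point_count \<kappa> X (B i) \<omega> = of_nat 1) \<and> point_count \<kappa> X (\<Lambda> - (\<Union>i<k. B i)) \<omega> = of_nat 0"
  shows "emeasure (count_space (injections k)) S = (if E then 1 else 0)"
proof (cases E)
  case True
  have "\<exists>j. points \<kappa> X (B i) \<omega> = {j}" if "i < k" for i
    using True that unfolding E_def point_count_eq_of_nat_iff by (metis card_1_singletonE)
  then obtain \<tau> where \<tau>: "\<And>i. i < k \<Longrightarrow> points \<kappa> X (B i) \<omega> = {\<tau> i}" by metis
  have rest: "points \<kappa> X (\<Lambda> - (\<Union>i<k. B i)) \<omega> = {}"
    using True unfolding E_def point_count_eq_of_nat_iff by auto
  have pts: "points \<kappa> X \<Lambda> \<omega> = \<tau> ` {..<k}"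
  proof (intro equalityI subsetI)
    fix j assume j: "j \<in> points \<kappa> X \<Lambda> \<omega>"
    then obtain i where "i < k" "j \<in> points \<kappa> X (B i) \<omega>"
      using rest unfolding points_def by blast
    then show "j \<in> \<tau> ` {..<k}" using \<tau> by auto
  next
    fix j assume "j \<in> \<tau> ` {..<k}"
    then obtain i where "i < k" "j \<in> points \<kappa> X (B i) \<omega>" using \<tau> by auto
    then show "j \<in> points \<kappa> X \<Lambda> \<omega>" using sub unfolding points_def by blast
  qed
  have \<tau>B: "X (\<tau> i) \<omega> \<in> B i" if "i < k" for i
    using \<tau>[OF that] unfolding points_def by blast
  have inj: "inj_on \<tau> {..<k}"
    using \<tau>B disj unfolding disjoint_family_on_def inj_on_def by (metis IntI empty_iff lessThan_iff)
  let ?\<sigma> = "restrict \<tau> {..<k}"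
  have "S = {?\<sigma>}"
  proof (intro equalityI subsetI)
    fix \<sigma> assume \<sigma>: "\<sigma> \<in> S"
    have "\<sigma> i = \<tau> i" if "i < k" for i
    proof -
      have "\<sigma> i \<in> points \<kappa> X \<Lambda> \<omega>" "X (\<sigma> i) \<omega> \<in> B i"
        using \<sigma> that unfolding S_def enumerates_def by auto
      then have "\<sigma> i \<in> points \<kappa> X (B i) \<omega>" unfolding points_def by auto
      with \<tau>[OF that] show ?thesis by simp
    qed
    moreover have "\<sigma> i = undefined" if "\<not> i < k" for i
      using \<sigma> that PiE_arb[of \<sigma> "{..<k}" "\<lambda>_. UNIV" i] unfolding S_def injections_def by simp
    ultimately show "\<sigma> \<in> {?\<sigma>}"
      by (simp add: fun_eq_iff)
  next
    fix \<sigma> assume "\<sigma> \<in> {?\<sigma>}"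
    moreover have "point_count \<kappa> X \<Lambda> \<omega> = of_nat k"
      unfolding point_count_eq_of_nat_iff pts using inj by (simp add: card_image)
    ultimately show "\<sigma> \<in> S"
      using inj \<tau>B unfolding S_def injections_def enumerates_def pts by (auto simp: inj_on_def)
  qed
  then have "S \<subseteq> injections k" "S = {?\<sigma>}" unfolding S_def by auto
  then show ?thesis using True by (simp add: emeasure_count_space_finite)
next
  case False
  have "S = {}"
  proof (rule ccontr)
    assume "S \<noteq> {}"
    then obtain \<sigma> where \<sigma>: "\<sigma> \<in> injections k" "enumerates \<kappa> X \<Lambda> k \<omega> \<sigma>" "\<And>i. i < k \<Longrightarrow> X (\<sigma> i) \<omega> \<in> B i"
      unfolding S_def by auto
    have pts: "points \<kappa> X \<Lambda> \<omega> = \<sigma> ` {..<k}"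
      using enumerates_bij_betw[OF \<sigma>(1,2)] by (simp add: bij_betw_def)
    have "points \<kappa> X (B i) \<omega> = {\<sigma> i}" if "i < k" for i
    proof (intro equalityI subsetI)
      fix j assume j: "j \<in> points \<kappa> X (B i) \<omega>"
      then have "j \<in> points \<kappa> X \<Lambda> \<omega>" using sub[OF that] unfolding points_def by blast
      then obtain i' where i': "i' < k" "j = \<sigma> i'" unfolding pts by auto
      moreover have "X j \<omega> \<in> B i" using j unfolding points_def by blast
      ultimately have "i' = i"
        using \<sigma>(3)[of i'] disj that unfolding disjoint_family_on_def by auto
      with i' show "j \<in> {\<sigma> i}" by simp
    next
      fix j assume "j \<in> {\<sigma> i}"
      then have "j \<in> points \<kappa> X \<Lambda> \<omega>" "X j \<omega> \<in> B i"
        using \<sigma>(3)[OF that] that unfolding pts by auto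
      then show "j \<in> points \<kappa> X (B i) \<omega>" unfolding points_def by blast
    qed
    moreover have "points \<kappa> X (\<Lambda> - (\<Union>i<k. B i)) \<omega> = {}"
    proof (rule ccontr)
      assume "points \<kappa> X (\<Lambda> - (\<Union>i<k. B i)) \<omega> \<noteq> {}"
      then obtain j where j: "j \<in> points \<kappa> X \<Lambda> \<omega>" "X j \<omega> \<notin> (\<Union>i<k. B i)"
        unfolding points_def by blast
      then show False using \<sigma>(3) unfolding pts by auto
    qed
    ultimately have E unfolding E_def point_count_eq_of_nat_iff by simp
    with False show False by simp
  qed
  with False show ?thesis by simp
qed

lemma poisson_process_prob_space: "poisson_process \<Omega> \<kappa> X \<mu> \<Longrightarrow> prob_space \<Omega>"
  by (simp add: poisson_process_def)

lemma poisson_process_measurable: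
  assumes "poisson_process \<Omega> \<kappa> X \<mu>"
  shows "\<kappa> \<in> \<Omega> \<rightarrow>\<^sub>M count_space UNIV" "X i \<in> \<Omega> \<rightarrow>\<^sub>M \<mu>"
  using assms by (auto simp: poisson_process_def)

text \<open>In \<open>poisson_process\<close> the measurability of the counts is hidden in the
  independence clause; it is read off from a family with the single member \<open>B\<close>.\<close>

lemma poisson_process_count_measurable:
  assumes "poisson_process \<Omega> \<kappa> X \<mu>" "B \<in> sets \<mu>"
  shows "point_count \<kappa> X B \<in> borel_measurable \<Omega>"
proof -
  interpret prob_space \<Omega> by (rule poisson_process_prob_space[OF assms(1)])
  have "indep_vars (\<lambda>_. borel) (\<lambda>j. point_count \<kappa> X ((\<lambda>_. B) j)) {..<(1::nat)}"
    using assms unfolding poisson_process_def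
    by (elim conjE allE[of _ "\<lambda>_. B"] allE[of _ 1]) (auto simp: disjoint_family_on_def)
  then show ?thesis unfolding indep_vars_def by auto
qed

lemma poisson_process_count_prob:
  assumes "poisson_process \<Omega> \<kappa> X \<mu>" "B \<in> sets \<mu>" "emeasure \<mu> B < \<infinity>"
  shows "measure \<Omega> {\<omega> \<in> space \<Omega>. point_count \<kappa> X B \<omega> = of_nat n}
    = exp (- measure \<mu> B) * measure \<mu> B ^ n / fact n"
  using assms unfolding poisson_process_def poisson_distributed_def measure_def by auto

text \<open>The Poisson weights of a finite mean sum to 1, so no mass is left for an infinite
  count.\<close>

lemma poisson_process_AE_finite:
  assumes P: "poisson_process \<Omega> \<kappa> X \<mu>" and B: "B \<in> sets \<mu>" "emeasure \<mu> B < \<infinity>"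
  shows "AE \<omega> in \<Omega>. \<exists>n. point_count \<kappa> X B \<omega> = of_nat n"
proof -
  interpret prob_space \<Omega> by (rule poisson_process_prob_space[OF P])
  note [measurable] = poisson_process_count_measurable[OF P B(1)]
  let ?A = "\<lambda>n. {\<omega> \<in> space \<Omega>. point_count \<kappa> X B \<omega> = of_nat n}"
  have "(\<lambda>n. prob (?A n)) sums prob (\<Union>n. ?A n)"
    by (intro finite_measure_UNION) (auto simp: disjoint_family_on_def)
  moreover have "(\<lambda>n. prob (?A n)) sums 1"
  proof -
    have "(\<lambda>n. exp (- measure \<mu> B) * (measure \<mu> B ^ n /\<^sub>R fact n)) sums (exp (- measure \<mu> B) * exp (measure \<mu> B))"
      by (intro sums_mult exp_converges)
    then show ?thesis
      by (simp add: poisson_process_count_prob[OF P B] flip: exp_add) (simp add: field_simps)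
  qed
  ultimately have "prob (\<Union>n. ?A n) = 1" by (rule sums_unique2)
  moreover have "(\<Union>n. ?A n) = {\<omega> \<in> space \<Omega>. \<exists>n. point_count \<kappa> X B \<omega> = of_nat n}" by auto
  ultimately show ?thesis
    by (subst prob_Collect_eq_1[symmetric]) auto
qed

text \<open>The rest of \<open>\<Lambda>\<close> is appended as one more set, with prescribed count
  0. The \<open>k + 1\<close> sets partition \<open>\<Lambda>\<close>, so their exponential factors
  multiply to \<open>exp (- measure \<mu> \<Lambda>)\<close>, and each prescribed count 1
  contributes the mass of its set.\<close>

lemma poisson_process_disjoint_prob:
  fixes k :: nat
  assumes P: "poisson_process \<Omega> \<kappa> X \<mu>" and \<Lambda>: "\<Lambda> \<in> sets \<mu>" "emeasure \<mu> \<Lambda> < \<infinity>"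
    and disj: "disjoint_family_on B {..<k}" and B: "\<And>i. i < k \<Longrightarrow> B i \<in> sets \<mu>" "\<And>i. i < k \<Longrightarrow> B i \<subseteq> \<Lambda>"
  shows "emeasure \<Omega> {\<omega> \<in> space \<Omega>. (\<forall>i<k. point_count \<kappa> X (B i) \<omega> = of_nat 1) \<and>
      point_count \<kappa> X (\<Lambda> - (\<Union>i<k. B i)) \<omega> = of_nat 0}
    = ennreal (exp (- measure \<mu> \<Lambda>)) * (\<Prod>i<k. emeasure \<mu> (B i))"
proof -
  interpret prob_space \<Omega> by (rule poisson_process_prob_space[OF P])
  define R where "R = \<Lambda> - (\<Union>i<k. B i)"
  define B' where "B' = B(k := R)"
  define n where "n i = (if i < k then 1 else 0 :: nat)" for i
  have R: "R \<in> sets \<mu>" unfolding R_def using \<Lambda>(1) B(1) by (intro sets.Diff sets.finite_UN) auto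
  have B': "B' j \<in> sets \<mu>" if "j < Suc k" for j
    using B(1) R that by (auto simp: B'_def less_Suc_eq)
  have sub: "B' j \<subseteq> \<Lambda>" if "j < Suc k" for j
    using B(2) that by (auto simp: B'_def R_def less_Suc_eq)
  have fin: "emeasure \<mu> (B' j) < \<infinity>" if "j < Suc k" for j
    by (rule le_less_trans[OF emeasure_mono[OF sub[OF that] \<Lambda>(1)] \<Lambda>(2)])
  have disj': "disjoint_family_on B' {..<Suc k}"
    using disj unfolding disjoint_family_on_def B'_def R_def by (auto simp: less_Suc_eq) blast+
  have ind: "indep_vars (\<lambda>_. borel) (\<lambda>j. point_count \<kappa> X (B' j)) {..<Suc k}"
    using P disj' B' unfolding poisson_process_def by blast
  let ?E = "\<lambda>j. point_count \<kappa> X (B' j) -` {of_nat (n j)} \<inter> space \<Omega>"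
  have "prob (\<Inter>j\<in>{..<Suc k}. ?E j) = (\<Prod>j<Suc k. prob (?E j))"
    by (rule indep_varsD[OF ind]) auto
  also have "\<dots> = (\<Prod>j<Suc k. exp (- measure \<mu> (B' j)) * measure \<mu> (B' j) ^ n j)"
  proof (rule prod.cong[OF refl])
    fix j assume "j \<in> {..<Suc k}"
    then have j: "j < Suc k" by simp
    have "?E j = {\<omega> \<in> space \<Omega>. point_count \<kappa> X (B' j) \<omega> = of_nat (n j)}" by auto
    then show "prob (?E j) = exp (- measure \<mu> (B' j)) * measure \<mu> (B' j) ^ n j"
      using poisson_process_count_prob[OF P B'[OF j] fin[OF j], of "n j"] by (simp add: n_def)
  qed
  also have "\<dots> = exp (- (\<Sum>j<Suc k. measure \<mu> (B' j))) * (\<Prod>j<k. measure \<mu> (B j))"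
    unfolding prod.distrib by (simp add: n_def B'_def exp_sum[symmetric] sum_negf flip: exp_add)
  also have "(\<Sum>j<Suc k. measure \<mu> (B' j)) = measure \<mu> (\<Union>j<Suc k. B' j)"
    by (intro measure_finite_Union[symmetric]) (use B' fin disj' in \<open>auto simp: less_top[symmetric]\<close>)
  also have "(\<Union>j<Suc k. B' j) = \<Lambda>"
  proof (rule equalityI)
    show "(\<Union>j<Suc k. B' j) \<subseteq> \<Lambda>" using sub by blast
    show "\<Lambda> \<subseteq> (\<Union>j<Suc k. B' j)" by (auto simp: B'_def R_def less_Suc_eq)
  qed
  finally have eq: "prob (\<Inter>j\<in>{..<Suc k}. ?E j) = exp (- measure \<mu> \<Lambda>) * (\<Prod>j<k. measure \<mu> (B j))" .
  have "{\<omega> \<in> space \<Omega>. (\<forall>i<k. point_count \<kappa> X (B i) \<omega> = of_nat 1) \<and>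
      point_count \<kappa> X (\<Lambda> - (\<Union>i<k. B i)) \<omega> = of_nat 0} = (\<Inter>j\<in>{..<Suc k}. ?E j)"
    by (auto simp: R_def[symmetric] B'_def n_def less_Suc_eq split: if_splits)
  moreover have "ennreal (measure \<mu> (B j)) = emeasure \<mu> (B j)" if "j < k" for j
    using fin[of j] that by (intro emeasure_eq_ennreal_measure[symmetric]) (auto simp: B'_def)
  ultimately have ev: "{\<omega> \<in> space \<Omega>. (\<forall>i<k. point_count \<kappa> X (B i) \<omega> = of_nat 1) \<and>
      point_count \<kappa> X (\<Lambda> - (\<Union>i<k. B i)) \<omega> = of_nat 0} = (\<Inter>j\<in>{..<Suc k}. ?E j)"
    and fin': "\<And>j. j < k \<Longrightarrow> ennreal (measure \<mu> (B j)) = emeasure \<mu> (B j)"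
    by blast+
  have "ennreal (\<Prod>j<k. measure \<mu> (B j)) = (\<Prod>j<k. ennreal (measure \<mu> (B j)))"
    by (rule prod_ennreal[symmetric]) simp
  also have "\<dots> = (\<Prod>j<k. emeasure \<mu> (B j))"
    by (rule prod.cong) (auto simp: fin')
  finally show ?thesis
    unfolding ev emeasure_eq_measure eq by (subst ennreal_mult) (auto intro!: prod_nonneg)
qed

section \<open>Counting the enumerations that list a given subset first\<close>

lemma card_injections_onto_fact:
  assumes "finite A" "finite S" "card A = card S"
  shows "card {f \<in> A \<rightarrow>\<^sub>E S. inj_on f A} = fact (card S)"
proof -
  have "prod ((-) (card S)) {0..<card S} = fact (card S)"
    by (simp add: fact_prod_rev)
  then show ?thesis
    using card_inj_on_subset_funcset[of A S A] assms by simp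
qed

text \<open>The restriction to \<open>{..<n}\<close> is an arbitrary bijection onto
  \<open>T\<close>, the restriction to \<open>{n..<k}\<close> an arbitrary bijection onto
  \<open>S - T\<close>, and the two can be glued freely.\<close>

lemma card_injections_with_initial_image:
  assumes S: "finite S" "card S = k" and T: "T \<subseteq> S" "card T = n"
  shows "card {\<sigma> \<in> injections k. \<sigma> ` {..<k} \<subseteq> S \<and> \<sigma> ` {..<n} = T} = fact n * fact (k - n)"
proof -
  have n: "n \<le> k" using card_mono[OF S(1) T(1)] S T by simp
  have finT: "finite T" using S T finite_subset by blast
  define L where "L = {\<sigma> \<in> injections k. \<sigma> ` {..<k} \<subseteq> S \<and> \<sigma> ` {..<n} = T}"
  define F where "F = {f \<in> {..<n} \<rightarrow>\<^sub>E T. inj_on f {..<n}}"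
  define G where "G = {g \<in> {n..<k} \<rightarrow>\<^sub>E S - T. inj_on g {n..<k}}"
  have "bij_betw (\<lambda>\<sigma>. (restrict \<sigma> {..<n}, restrict \<sigma> {n..<k})) L (F \<times> G)"
  proof (rule bij_betw_byWitness[where f'="\<lambda>(f, g) i. if i < n then f i else g i"])
    show "\<forall>\<sigma>\<in>L. (case (restrict \<sigma> {..<n}, restrict \<sigma> {n..<k}) of (f, g) \<Rightarrow> \<lambda>i. if i < n then f i else g i) = \<sigma>"
    proof
      fix \<sigma> assume "\<sigma> \<in> L"
      then have "\<sigma> i = undefined" if "\<not> i < k" for i
        using that PiE_arb[of \<sigma> "{..<k}" "\<lambda>_. UNIV" i] unfolding L_def injections_def by simp
      then have "(if i < n then restrict \<sigma> {..<n} i else restrict \<sigma> {n..<k} i) = \<sigma> i" for i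
        by simp
      then show "(case (restrict \<sigma> {..<n}, restrict \<sigma> {n..<k}) of (f, g) \<Rightarrow> \<lambda>i. if i < n then f i else g i) = \<sigma>"
        by simp
    qed
    show "\<forall>p\<in>F \<times> G. (restrict (case p of (f, g) \<Rightarrow> \<lambda>i. if i < n then f i else g i) {..<n},
        restrict (case p of (f, g) \<Rightarrow> \<lambda>i. if i < n then f i else g i) {n..<k}) = p"
    proof clarify
      fix f g assume "f \<in> F" "g \<in> G"
      then have "f i = undefined" if "\<not> i < n" for i
        using that PiE_arb[of f "{..<n}" "\<lambda>_. T" i] unfolding F_def by simp
      moreover have "g i = undefined" if "\<not> (n \<le> i \<and> i < k)" for i
        using that \<open>g \<in> G\<close> PiE_arb[of g "{n..<k}" "\<lambda>_. S - T" i] unfolding G_def by simp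
      ultimately show "restrict (\<lambda>i. if i < n then f i else g i) {..<n} = f \<and>
          restrict (\<lambda>i. if i < n then f i else g i) {n..<k} = g"
        unfolding restrict_def fun_eq_iff by simp
    qed
    show "(\<lambda>\<sigma>. (restrict \<sigma> {..<n}, restrict \<sigma> {n..<k})) ` L \<subseteq> F \<times> G"
    proof clarify
      fix \<sigma> assume "\<sigma> \<in> L"
      then have \<sigma>: "inj_on \<sigma> {..<k}" "\<sigma> ` {..<k} \<subseteq> S" "\<sigma> ` {..<n} = T"
        unfolding L_def injections_def by auto
      have "\<sigma> i \<notin> T" if "i \<in> {n..<k}" for i
      proof
        assume "\<sigma> i \<in> T"
        then obtain j where "j < n" "\<sigma> i = \<sigma> j" using \<sigma>(3) by blast
        then show False using inj_onD[OF \<sigma>(1), of i j] that n by simp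
      qed
      then show "restrict \<sigma> {..<n} \<in> F \<and> restrict \<sigma> {n..<k} \<in> G"
        using \<sigma> n unfolding F_def G_def by (auto simp: inj_on_def image_subset_iff)
    qed
    show "(\<lambda>(f, g) i. if i < n then f i else g i) ` (F \<times> G) \<subseteq> L"
    proof clarify
      fix f g assume "f \<in> F" "g \<in> G"
      then have f: "f \<in> {..<n} \<rightarrow>\<^sub>E T" "inj_on f {..<n}" and g: "g \<in> {n..<k} \<rightarrow>\<^sub>E S - T" "inj_on g {n..<k}"
        unfolding F_def G_def by auto
      have fT: "f ` {..<n} = T"
        using f T finT by (intro card_subset_eq) (auto simp: card_image)
      have f_in: "f i \<in> T" if "i < n" for i using PiE_mem[OF f(1)] that by simp
      have g_in: "g i \<in> S - T" if "\<not> i < n" "i < k" for i using PiE_mem[OF g(1)] that by simp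
      let ?h = "\<lambda>i. if i < n then f i else g i"
      have "inj_on ?h {..<k}"
        unfolding inj_on_def
      proof (intro ballI impI)
        fix i j assume ij: "i \<in> {..<k}" "j \<in> {..<k}" "?h i = ?h j"
        consider "i < n" "j < n" | "i < n" "\<not> j < n" | "\<not> i < n" "j < n" | "\<not> i < n" "\<not> j < n" by blast
        then show "i = j"
        proof cases
          case 1 then show ?thesis using ij inj_onD[OF f(2), of i j] by simp
        next
          case 2 then show ?thesis using f_in[of i] g_in[of j] ij by auto
        next
          case 3 then show ?thesis using f_in[of j] g_in[of i] ij by auto
        next
          case 4 then show ?thesis using ij inj_onD[OF g(2), of i j] by simp
        qed
      qed
      moreover have "?h \<in> {..<k} \<rightarrow>\<^sub>E UNIV" using n PiE_arb[OF g(1)] by (auto simp: PiE_iff extensional_def)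
      moreover have "?h ` {..<k} \<subseteq> S" using f_in g_in T(1) by auto
      moreover have "?h ` {..<n} = T" using fT by auto
      ultimately show "?h \<in> L" unfolding L_def injections_def by blast
    qed
  qed
  then have "card L = card F * card G"
    by (simp add: bij_betw_same_card card_cartesian_product)
  also have "card F = fact n"
    unfolding F_def using card_injections_onto_fact[of "{..<n}" T] T finT by simp
  also have "card G = fact (k - n)"
    unfolding G_def using card_injections_onto_fact[of "{n..<k}" "S - T"] S T finT by (simp add: card_Diff_subset)
  finally show ?thesis unfolding L_def .
qed

lemma finite_injections_into:
  assumes "finite S"
  shows "finite {\<sigma> \<in> injections k. \<sigma> ` {..<k} \<subseteq> S}"
proof (rule finite_subset)
  show "{\<sigma> \<in> injections k. \<sigma> ` {..<k} \<subseteq> S} \<subseteq> {..<k} \<rightarrow>\<^sub>E S"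
  proof clarify
    fix \<sigma> assume "\<sigma> \<in> injections k" "\<sigma> ` {..<k} \<subseteq> S"
    then show "\<sigma> \<in> {..<k} \<rightarrow>\<^sub>E S" unfolding injections_def PiE_iff by blast
  qed
qed (use assms in \<open>simp add: finite_PiE\<close>)

section \<open>Measures on tuples, determined off the diagonals\<close>

lemma PiM_diagonal_null:
  fixes f :: "'x \<Rightarrow> 'b::{second_countable_topology, metric_space}"
  assumes "finite_measure \<nu>" and f[measurable]: "f \<in> borel_measurable \<nu>"
    and null: "\<And>c. emeasure \<nu> {x \<in> space \<nu>. f x = c} = 0"
    and ij: "i \<in> I" "j \<in> I" "i \<noteq> j" and I: "finite I"
  shows "emeasure (Pi\<^sub>M I (\<lambda>_. \<nu>)) {x \<in> space (Pi\<^sub>M I (\<lambda>_. \<nu>)). f (x i) = f (x j)} = 0"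
proof -
  interpret finite_measure \<nu> by fact
  interpret product_sigma_finite "\<lambda>_. \<nu>" ..
  define J where "J = I - {i}"
  have J: "I = insert i J" "i \<notin> J" "finite J" "j \<in> J" using ij I by (auto simp: J_def)
  have [measurable]: "{x \<in> space (Pi\<^sub>M (insert i J) (\<lambda>_. \<nu>)). f (x i) = f (x j)} \<in> sets (Pi\<^sub>M (insert i J) (\<lambda>_. \<nu>))"
  proof -
    have [measurable]: "(\<lambda>x. x i) \<in> Pi\<^sub>M (insert i J) (\<lambda>_. \<nu>) \<rightarrow>\<^sub>M \<nu>" "(\<lambda>x. x j) \<in> Pi\<^sub>M (insert i J) (\<lambda>_. \<nu>) \<rightarrow>\<^sub>M \<nu>"
      using J by (auto intro: measurable_component_singleton)
    show ?thesis by measurable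
  qed
  have "emeasure (Pi\<^sub>M (insert i J) (\<lambda>_. \<nu>)) {x \<in> space (Pi\<^sub>M (insert i J) (\<lambda>_. \<nu>)). f (x i) = f (x j)}
    = (\<integral>\<^sup>+x. indicator {x \<in> space (Pi\<^sub>M (insert i J) (\<lambda>_. \<nu>)). f (x i) = f (x j)} x \<partial>Pi\<^sub>M (insert i J) (\<lambda>_. \<nu>))"
    by simp
  \<comment> \<open>Fubini with the coordinate \<open>i\<close> innermost: once the other
    coordinates are fixed, the diagonal becomes a level set of \<open>f\<close>, which is
    null.\<close>
  also have "\<dots> = (\<integral>\<^sup>+x. \<integral>\<^sup>+y. indicator {x \<in> space (Pi\<^sub>M (insert i J) (\<lambda>_. \<nu>)). f (x i) = f (x j)} (x(i := y)) \<partial>\<nu> \<partial>Pi\<^sub>M J (\<lambda>_. \<nu>))"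
    by (rule product_nn_integral_insert) (use J in auto)
  also have "\<dots> = (\<integral>\<^sup>+x. 0 \<partial>Pi\<^sub>M J (\<lambda>_. \<nu>))"
  proof (rule nn_integral_cong)
    fix x assume x: "x \<in> space (Pi\<^sub>M J (\<lambda>_. \<nu>))"
    have "(\<integral>\<^sup>+y. indicator {x \<in> space (Pi\<^sub>M (insert i J) (\<lambda>_. \<nu>)). f (x i) = f (x j)} (x(i := y)) \<partial>\<nu>)
        = (\<integral>\<^sup>+y. indicator {y \<in> space \<nu>. f y = f (x j)} y \<partial>\<nu>)"
      using J x ij by (intro nn_integral_cong) (auto split: split_indicator simp: space_PiM PiE_iff extensional_def)
    also have "\<dots> = 0" by (simp add: null)
    finally show "(\<integral>\<^sup>+y. indicator {x \<in> space (Pi\<^sub>M (insert i J) (\<lambda>_. \<nu>)). f (x i) = f (x j)} (x(i := y)) \<partial>\<nu>) = 0" .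
  qed
  finally show ?thesis using J(1) by simp
qed

text \<open>With a countable base, the boxes obtained here form a countable family; this is what
  makes the off-diagonal tuples a countable union of rectangles with disjoint sides.\<close>

lemma disjoint_basis_neighbourhoods:
  fixes y :: "nat \<Rightarrow> 'b::metric_space"
  assumes B: "topological_basis \<B>" and inj: "inj_on y {..<k}"
  obtains u where "u \<in> {..<k} \<rightarrow>\<^sub>E \<B>" "disjoint_family_on u {..<k}" "\<And>i. i < k \<Longrightarrow> y i \<in> u i"
proof -
  \<comment> \<open>The inserted 1 keeps the minimum meaningful when there are no pairs, that is for
    k \<le> 1. Balls of radius \<open>d / 2\<close> about the points are disjoint.\<close>
  define d where "d = Min (insert 1 {dist (y i) (y j) | i j. i < k \<and> j < k \<and> i \<noteq> j})"
  have "{dist (y i) (y j) | i j. i < k \<and> j < k \<and> i \<noteq> j} \<subseteq> (\<lambda>(i, j). dist (y i) (y j)) ` ({..<k} \<times> {..<k})"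
    by auto
  then have fin: "finite {dist (y i) (y j) | i j. i < k \<and> j < k \<and> i \<noteq> j}"
    by (rule finite_subset) auto
  have d: "d > 0" unfolding d_def using fin inj by (auto simp: inj_on_def)
  have d_le: "d \<le> dist (y i) (y j)" if "i < k" "j < k" "i \<noteq> j" for i j
    unfolding d_def using fin that by (intro Min_le) auto
  have "\<exists>u\<in>\<B>. y i \<in> u \<and> u \<subseteq> ball (y i) (d / 2)" for i
    using topological_basisE[OF B, of "ball (y i) (d / 2)" "y i"] d by (metis centre_in_ball half_gt_zero open_ball)
  then obtain u where u: "\<And>i. u i \<in> \<B>" "\<And>i. y i \<in> u i" "\<And>i. u i \<subseteq> ball (y i) (d / 2)"
    by metis
  have "disjoint_family_on (restrict u {..<k}) {..<k}"
    unfolding disjoint_family_on_def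
  proof (intro ballI impI)
    fix i j assume ij: "i \<in> {..<k}" "j \<in> {..<k}" "i \<noteq> j"
    have False if "z \<in> u i" "z \<in> u j" for z
    proof -
      have "dist (y i) z < d / 2" "dist (y j) z < d / 2"
        using subsetD[OF u(3) that(1)] subsetD[OF u(3) that(2)] by (simp_all only: mem_ball)
      then show False
        using d_le[of i j] ij dist_triangle2[of "y i" "y j" z] by auto
    qed
    then show "restrict u {..<k} i \<inter> restrict u {..<k} j = {}" using ij by auto
  qed
  then show ?thesis
    by (intro that[of "restrict u {..<k}"]) (use u in auto)
qed

text \<open>Disjoint rectangles form a \<open>\<pi>\<close>-system that generates the product \<open>\<sigma>\<close>-algebra off the diagonal only. The
  diagonal is a null set of the product measure, and equality of the total masses makes it one for \<open>Q\<close>.\<close>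

lemma measure_eqI_disjoint_rectangles:
  fixes f :: "'x \<Rightarrow> 'b::{second_countable_topology, metric_space}"
  assumes \<nu>: "finite_measure \<nu>" and f[measurable]: "f \<in> borel_measurable \<nu>"
    and null: "\<And>c. emeasure \<nu> {x \<in> space \<nu>. f x = c} = 0"
    and sets_Q: "sets Q = sets (Pi\<^sub>M {..<k} (\<lambda>_. \<nu>))"
    and rect: "\<And>B. (\<And>i. i < k \<Longrightarrow> B i \<in> sets \<nu>) \<Longrightarrow> disjoint_family_on B {..<k} \<Longrightarrow>
      emeasure Q (Pi\<^sub>E {..<k} B) = e * (\<Prod>i<k. emeasure \<nu> (B i))"
    and total: "emeasure Q (space Q) = e * emeasure \<nu> (space \<nu>) ^ k" and e: "e < \<infinity>"
  shows "Q = scale_measure e (Pi\<^sub>M {..<k} (\<lambda>_. \<nu>))"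
proof -
  interpret finite_measure \<nu> by fact
  interpret product_sigma_finite "\<lambda>_. \<nu>" ..
  let ?P = "Pi\<^sub>M {..<k} (\<lambda>_. \<nu>)"
  define R where "R = scale_measure e ?P"
  have sets_R: "sets R = sets ?P" by (simp add: R_def)
  have R_rect: "emeasure R (Pi\<^sub>E {..<k} B) = e * (\<Prod>i<k. emeasure \<nu> (B i))"
    if "\<And>i. i < k \<Longrightarrow> B i \<in> sets \<nu>" for B
    unfolding R_def using that by (subst emeasure_scale_measure, subst emeasure_PiM) auto
  have space_Q: "space Q = space ?P" by (rule sets_eq_imp_space_eq[OF sets_Q])
  have space_R: "space R = space ?P" by (rule sets_eq_imp_space_eq[OF sets_R])
  have R_total: "emeasure R (space ?P) = emeasure Q (space ?P)"
    using R_rect[of "\<lambda>_. space \<nu>"] total by (simp add: space_PiM[symmetric] space_Q)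
  have fin: "emeasure Q (space ?P) < \<infinity>"
    using total e emeasure_finite[of "space \<nu>"]
    by (simp add: space_Q ennreal_mult_eq_top_iff power_eq_top_ennreal less_top[symmetric])
  \<comment> \<open>Intersecting with a rectangle whose sides are disjoint keeps all sides disjoint.
    After restriction to such a rectangle, \<open>rect\<close> therefore applies to every rectangle,
    and these form an intersection-stable generator of the whole \<sigma>-algebra.\<close>
  have on_rect: "emeasure Q (A \<inter> Pi\<^sub>E {..<k} U) = emeasure R (A \<inter> Pi\<^sub>E {..<k} U)"
    if U: "\<And>i. i < k \<Longrightarrow> U i \<in> sets \<nu>" "disjoint_family_on U {..<k}" and A: "A \<in> sets ?P" for A U
  proof -
    let ?U = "Pi\<^sub>E {..<k} U"
    have U': "?U \<in> sets ?P" using U by (intro sets_PiM_I_finite) auto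
    have "density Q (indicator ?U) = density R (indicator ?U)"
    proof (rule measure_eqI_PiM_finite[where I="{..<k}" and M="\<lambda>_. \<nu>" and A="\<lambda>_. space ?P"])
      fix B :: "nat \<Rightarrow> 'x set" assume B: "\<And>i. i \<in> {..<k} \<Longrightarrow> B i \<in> sets \<nu>"
      have B': "Pi\<^sub>E {..<k} B \<in> sets ?P" using B by (intro sets_PiM_I_finite) auto
      have int: "?U \<inter> Pi\<^sub>E {..<k} B = Pi\<^sub>E {..<k} (\<lambda>i. U i \<inter> B i)" by (auto simp: PiE_iff)
      have "disjoint_family_on (\<lambda>i. U i \<inter> B i) {..<k}"
        using U(2) by (auto simp: disjoint_family_on_def)
      then show "emeasure (density Q (indicator ?U)) (Pi\<^sub>E {..<k} B) = emeasure (density R (indicator ?U)) (Pi\<^sub>E {..<k} B)"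
        using U B U' B' by (simp add: emeasure_restricted sets_Q sets_R int rect R_rect)
    next
      show "range (\<lambda>_::nat. space ?P) \<subseteq> prod_algebra {..<k} (\<lambda>_. \<nu>)"
        using prod_algebraI_finite[of "{..<k}" "\<lambda>_. space \<nu>" "\<lambda>_. \<nu>"] by (auto simp: space_PiM)
      have "emeasure (density Q (indicator ?U)) (space ?P) \<le> emeasure Q (space ?P)"
        unfolding emeasure_restricted[OF U'[folded sets_Q] sets.top[of ?P, folded sets_Q]]
        by (rule emeasure_mono) (simp_all add: sets_Q)
      then show "emeasure (density Q (indicator ?U)) (space ?P) \<noteq> \<infinity>"
        using fin by (auto simp: top_unique)
    qed (auto simp: sets_Q sets_R)
    then have "emeasure (density Q (indicator ?U)) A = emeasure (density R (indicator ?U)) A" by simp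
    then show ?thesis
      using U' A by (simp add: emeasure_restricted sets_Q sets_R Int_commute)
  qed
  obtain \<B> :: "'b set set" where \<B>: "countable \<B>" "topological_basis \<B>"
    using ex_countable_basis by auto
  \<comment> \<open>The rectangles come from preimages under \<open>f\<close> of disjoint basic open
    sets. There are countably many, and their union \<open>D\<close> turns out to be the set of
    tuples on which \<open>f\<close> takes pairwise distinct values.\<close>
  define \<U> where "\<U> = {u \<in> {..<k} \<rightarrow>\<^sub>E \<B>. disjoint_family_on u {..<k}}"
  have "countable \<U>"
    unfolding \<U>_def by (rule countable_subset[of _ "{..<k} \<rightarrow>\<^sub>E \<B>"]) (auto intro!: countable_PiE \<B>)
  define W where "W u i = f -` u i \<inter> space \<nu>" for u :: "nat \<Rightarrow> 'b set" and i :: nat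
  have W: "W u i \<in> sets \<nu>" if "u \<in> \<U>" "i < k" for u i
  proof -
    have "open (u i)" using that \<B>(2) topological_basis_open by (auto simp: \<U>_def)
    then show ?thesis unfolding W_def by measurable
  qed
  have Wdisj: "disjoint_family_on (W u) {..<k}" if "u \<in> \<U>" for u
    using that unfolding \<U>_def W_def disjoint_family_on_def by blast
  define D where "D = (\<Union>u\<in>\<U>. Pi\<^sub>E {..<k} (W u))"
  have D_eq: "D = {x \<in> space ?P. inj_on (\<lambda>i. f (x i)) {..<k}}"
  proof (intro equalityI subsetI)
    fix x assume "x \<in> D"
    then obtain u where u: "u \<in> \<U>" "x \<in> Pi\<^sub>E {..<k} (W u)" unfolding D_def by auto
    have "inj_on (\<lambda>i. f (x i)) {..<k}"
    proof (rule inj_onI, rule ccontr)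
      fix i j assume ij: "i \<in> {..<k}" "j \<in> {..<k}" "f (x i) = f (x j)" "i \<noteq> j"
      then have "f (x i) \<in> u i" "f (x j) \<in> u j"
        using PiE_mem[OF u(2), of i] PiE_mem[OF u(2), of j] unfolding W_def by simp_all
      with ij have "f (x i) \<in> u i \<inter> u j" by simp
      then show False using u(1) ij unfolding \<U>_def disjoint_family_on_def by auto
    qed
    moreover have "x \<in> space ?P" using u(2) unfolding W_def by (auto simp: space_PiM PiE_iff)
    ultimately show "x \<in> {x \<in> space ?P. inj_on (\<lambda>i. f (x i)) {..<k}}" by simp
  next
    fix x assume x: "x \<in> {x \<in> space ?P. inj_on (\<lambda>i. f (x i)) {..<k}}"
    then obtain u where "u \<in> {..<k} \<rightarrow>\<^sub>E \<B>" "disjoint_family_on u {..<k}" "\<And>i. i < k \<Longrightarrow> f (x i) \<in> u i"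
      using disjoint_basis_neighbourhoods[OF \<B>(2)] by (metis (no_types, lifting) mem_Collect_eq)
    then show "x \<in> D"
      using x unfolding D_def \<U>_def W_def by (auto simp: space_PiM PiE_iff)
  qed
  have rect_sets: "Pi\<^sub>E {..<k} (W u) \<in> sets ?P" if "u \<in> \<U>" for u
    using W[OF that] by (intro sets_PiM_I_finite) auto
  have D_sets: "D \<in> sets ?P"
    unfolding D_def by (intro sets.countable_UN'[OF \<open>countable \<U>\<close>]) (use rect_sets in auto)
  have on_D: "emeasure Q (A \<inter> D) = emeasure R (A \<inter> D)" if A: "A \<in> sets ?P" for A
  proof (cases "\<U> = {}")
    case True then show ?thesis by (simp add: D_def)
  next
    case False
    \<comment> \<open>The rectangles overlap. Made disjoint, each piece is no longer a rectangle but
      still lies inside one, which is all that \<open>on_rect\<close> asks for.\<close>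
    define V where "V n = Pi\<^sub>E {..<k} (W (from_nat_into \<U> n))" for n
    have V: "V n \<in> sets ?P" for n
      unfolding V_def using from_nat_into[OF False] by (intro rect_sets)
    have dV: "disjointed V n \<in> sets ?P" for n
      using sets.range_disjointed_sets[of V ?P] V by auto
    have D_V: "D = (\<Union>n. disjointed V n)"
    proof -
      have "(\<Union>n. V n) = (\<Union>u\<in>range (from_nat_into \<U>). Pi\<^sub>E {..<k} (W u))"
        unfolding V_def by blast
      then show ?thesis
        unfolding UN_disjointed_eq D_def range_from_nat_into[OF False \<open>countable \<U>\<close>] by simp
    qed
    have disj: "disjoint_family (\<lambda>n. A \<inter> disjointed V n)"
      using disjoint_family_disjointed[of V] unfolding disjoint_family_on_def by blast
    have "emeasure Q (A \<inter> disjointed V n) = emeasure R (A \<inter> disjointed V n)" for n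
    proof -
      have "A \<inter> disjointed V n = (A \<inter> disjointed V n) \<inter> V n"
        using disjointed_subset[of V n] by auto
      then show ?thesis
        using on_rect[of "W (from_nat_into \<U> n)" "A \<inter> disjointed V n"] W Wdisj from_nat_into[OF False] A dV[of n]
        unfolding V_def by auto
    qed
    then have "(\<Sum>n. emeasure Q (A \<inter> disjointed V n)) = (\<Sum>n. emeasure R (A \<inter> disjointed V n))" by simp
    then have "emeasure Q (\<Union>n. A \<inter> disjointed V n) = emeasure R (\<Union>n. A \<inter> disjointed V n)"
      using A dV disj by (subst (asm) (1 2) suminf_emeasure) (auto simp: sets_Q sets_R)
    then show ?thesis by (simp add: D_V)
  qed
  have "emeasure ?P (space ?P - D) = 0"
  proof -
    let ?N = "\<lambda>(i, j). {x \<in> space ?P. f (x i) = f (x j)}"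
    let ?I = "{(i, j). i < k \<and> j < k \<and> i \<noteq> j}"
    have "countable ?I" by (rule countable_subset[of _ "UNIV"]) auto
    moreover have "?N p \<in> null_sets ?P" if "p \<in> ?I" for p
    proof -
      from that obtain i j where p: "p = (i, j)" "i < k" "j < k" "i \<noteq> j" by blast
      then have [measurable]: "(\<lambda>x. x i) \<in> ?P \<rightarrow>\<^sub>M \<nu>" "(\<lambda>x. x j) \<in> ?P \<rightarrow>\<^sub>M \<nu>"
        by (auto intro: measurable_component_singleton)
      have "{x \<in> space ?P. f (x i) = f (x j)} \<in> sets ?P" by measurable
      then show ?thesis
        using PiM_diagonal_null[OF \<nu> f null, of i "{..<k}" j] p by (auto simp: null_sets_def)
    qed
    ultimately have "(\<Union>p\<in>?I. ?N p) \<in> null_sets ?P" by (rule null_sets_UN')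
    moreover have "space ?P - D \<subseteq> (\<Union>p\<in>?I. ?N p)"
      unfolding D_eq inj_on_def by auto
    ultimately show ?thesis
      using null_sets_subset[of _ ?P "space ?P - D"] D_sets by (auto intro: null_setsD1)
  qed
  then have R_off: "emeasure R (space ?P - D) = 0" by (simp add: R_def)
  have Q_off: "emeasure Q (space ?P - D) = 0"
  proof -
    have D_sub: "D \<subseteq> space ?P" using sets.sets_into_space[OF D_sets] .
    have eqD: "emeasure Q D = emeasure R D"
      using on_D[OF sets.top] D_sub by (simp add: Int_absorb1)
    have "emeasure Q D \<le> emeasure Q (space ?P)"
      by (rule emeasure_mono[OF D_sub]) (simp add: sets_Q)
    then have finD: "emeasure Q D \<noteq> \<infinity>" using fin by (auto simp: top_unique)
    have "emeasure Q (space ?P - D) = emeasure Q (space ?P) - emeasure Q D"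
      using finD D_sets D_sub by (intro emeasure_Diff) (auto simp: sets_Q)
    also have "\<dots> = emeasure R (space ?P) - emeasure R D"
      by (simp add: R_total eqD)
    also have "\<dots> = emeasure R (space ?P - D)"
      using finD eqD D_sets D_sub by (intro emeasure_Diff[symmetric]) (auto simp: sets_R)
    finally show ?thesis using R_off by simp
  qed
  have "Q = R"
  proof (rule measure_eqI)
    show "sets Q = sets R" by (simp add: sets_Q sets_R)
    fix A assume "A \<in> sets Q"
    then have A: "A \<in> sets ?P" by (simp add: sets_Q)
    then have sub: "A - D \<subseteq> space ?P - D" using sets.sets_into_space by blast
    have "emeasure Q (A - D) \<le> emeasure Q (space ?P - D)" "emeasure R (A - D) \<le> emeasure R (space ?P - D)"
      by (rule emeasure_mono[OF sub]; use D_sets in \<open>simp add: sets_Q sets_R sets.compl_sets\<close>)+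
    then have 0: "emeasure Q (A - D) = 0" "emeasure R (A - D) = 0"
      using Q_off R_off by auto
    have "emeasure M A = emeasure M (A \<inter> D) + emeasure M (A - D)" if "sets M = sets ?P" for M
      using A D_sets that by (subst plus_emeasure) (auto intro!: arg_cong[where f="emeasure M"])
    from this[OF sets_Q] this[OF sets_R] show "emeasure Q A = emeasure R A"
      by (simp add: 0 on_D[OF A])
  qed
  then show ?thesis by (simp add: R_def)
qed

lemma enumerates_measurable:
  assumes P: "poisson_process \<Omega> \<kappa> X \<mu>" and \<Lambda>: "\<Lambda> \<in> sets \<mu>"
  shows "{\<omega> \<in> space \<Omega>. enumerates \<kappa> X \<Lambda> k \<omega> \<sigma>} \<in> sets \<Omega>"
proof -
  note [measurable] = poisson_process_measurable[OF P] poisson_process_count_measurable[OF P \<Lambda>] \<Lambda>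
  have "{\<omega> \<in> space \<Omega>. enumerates \<kappa> X \<Lambda> k \<omega> \<sigma>} =
    {\<omega> \<in> space \<Omega>. point_count \<kappa> X \<Lambda> \<omega> = of_nat k \<and> (\<forall>i\<in>{..<k}. enat (\<sigma> i) < \<kappa> \<omega> \<and> X (\<sigma> i) \<omega> \<in> \<Lambda>)}"
    by (auto simp: enumerates_def points_def)
  also have "\<dots> \<in> sets \<Omega>" by measurable
  finally show ?thesis .
qed

text \<open>Tonelli moves the sum over enumerations inside the expectation, where
  \<open>disjoint_enumerations_singleton\<close> turns it into the indicator of an event on
  counts.\<close>

lemma nn_integral_enumerations_disjoint:
  assumes P: "poisson_process \<Omega> \<kappa> X \<mu>" and \<Lambda>: "\<Lambda> \<in> sets \<mu>" "emeasure \<mu> \<Lambda> < \<infinity>"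
    and B: "\<And>i. i < k \<Longrightarrow> B i \<in> sets \<mu>" and disj: "disjoint_family_on B {..<k}"
  shows "(\<integral>\<^sup>+\<sigma>. emeasure \<Omega> {\<omega> \<in> space \<Omega>. enumerates \<kappa> X \<Lambda> k \<omega> \<sigma> \<and> (\<forall>i<k. X (\<sigma> i) \<omega> \<in> B i)} \<partial>count_space (injections k))
    = ennreal (exp (- measure \<mu> \<Lambda>)) * (\<Prod>i<k. emeasure \<mu> (\<Lambda> \<inter> B i))"
proof -
  note [measurable] = poisson_process_measurable[OF P] \<Lambda>(1) enumerates_measurable[OF P \<Lambda>(1)]
  let ?S = "\<lambda>\<sigma>. {\<omega> \<in> space \<Omega>. enumerates \<kappa> X \<Lambda> k \<omega> \<sigma> \<and> (\<forall>i<k. X (\<sigma> i) \<omega> \<in> B i)}"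
  let ?C = "\<lambda>i. \<Lambda> \<inter> B i"
  let ?E = "{\<omega> \<in> space \<Omega>. (\<forall>i<k. point_count \<kappa> X (?C i) \<omega> = of_nat 1) \<and>
      point_count \<kappa> X (\<Lambda> - (\<Union>i<k. ?C i)) \<omega> = of_nat 0}"
  have C: "\<And>i. i < k \<Longrightarrow> ?C i \<in> sets \<mu>" "disjoint_family_on ?C {..<k}"
    using B \<Lambda>(1) disj by (auto simp: disjoint_family_on_def)
  have S: "?S \<sigma> \<in> sets \<Omega>" for \<sigma>
  proof -
    have "?S \<sigma> = {\<omega> \<in> space \<Omega>. enumerates \<kappa> X \<Lambda> k \<omega> \<sigma>} \<inter> {\<omega> \<in> space \<Omega>. \<forall>i\<in>{..<k}. X (\<sigma> i) \<omega> \<in> B i}"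
      by auto
    also have "\<dots> \<in> sets \<Omega>"
      using B by (intro sets.Int) (measurable, auto)
    finally show ?thesis .
  qed
  have E: "?E \<in> sets \<Omega>"
  proof -
    have [measurable]: "point_count \<kappa> X (?C i) \<in> borel_measurable \<Omega>" if "i < k" for i
      by (rule poisson_process_count_measurable[OF P C(1)[OF that]])
    have [measurable]: "point_count \<kappa> X (\<Lambda> - (\<Union>i<k. ?C i)) \<in> borel_measurable \<Omega>"
      by (rule poisson_process_count_measurable[OF P]) (use C \<Lambda> in \<open>intro sets.Diff sets.finite_UN; auto\<close>)
    have "?E = {\<omega> \<in> space \<Omega>. (\<forall>i\<in>{..<k}. point_count \<kappa> X (?C i) \<omega> = of_nat 1)} \<inter>
      {\<omega> \<in> space \<Omega>. point_count \<kappa> X (\<Lambda> - (\<Union>i<k. ?C i)) \<omega> = of_nat 0}" by auto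
    also have "\<dots> \<in> sets \<Omega>"
      by (intro sets.Int sets.sets_Collect_finite_All) measurable
    finally show ?thesis .
  qed
  have "(\<integral>\<^sup>+\<sigma>. emeasure \<Omega> (?S \<sigma>) \<partial>count_space (injections k))
      = (\<integral>\<^sup>+\<sigma>. (\<integral>\<^sup>+\<omega>. indicator (?S \<sigma>) \<omega> \<partial>\<Omega>) \<partial>count_space (injections k))"
    by (simp only: nn_integral_indicator[OF S])
  also have "\<dots> = (\<integral>\<^sup>+\<omega>. (\<integral>\<^sup>+\<sigma>. indicator (?S \<sigma>) \<omega> \<partial>count_space (injections k)) \<partial>\<Omega>)"
    by (rule nn_integral_count_space_nn_integral[symmetric, OF countable_injections borel_measurable_indicator[OF S]])
  also have "\<dots> = (\<integral>\<^sup>+\<omega>. indicator ?E \<omega> \<partial>\<Omega>)"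
  proof (rule nn_integral_cong)
    fix \<omega> assume \<omega>: "\<omega> \<in> space \<Omega>"
    let ?T = "{\<sigma> \<in> injections k. enumerates \<kappa> X \<Lambda> k \<omega> \<sigma> \<and> (\<forall>i<k. X (\<sigma> i) \<omega> \<in> ?C i)}"
    have "(\<integral>\<^sup>+\<sigma>. indicator (?S \<sigma>) \<omega> \<partial>count_space (injections k))
        = (\<integral>\<^sup>+\<sigma>. indicator ?T \<sigma> \<partial>count_space (injections k))"
      using \<omega> by (intro nn_integral_cong) (auto simp: enumerates_def points_def split: split_indicator)
    also have "\<dots> = emeasure (count_space (injections k)) ?T"
      by (rule nn_integral_indicator) auto
    also have "\<dots> = indicator ?E \<omega>"
      using \<omega> disjoint_enumerations_singleton[OF C(2), of \<Lambda> \<kappa> X \<omega>] by (simp add: indicator_def)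
    finally show "(\<integral>\<^sup>+\<sigma>. indicator (?S \<sigma>) \<omega> \<partial>count_space (injections k)) = indicator ?E \<omega>" .
  qed
  also have "\<dots> = emeasure \<Omega> ?E" by (rule nn_integral_indicator[OF E])
  also have "\<dots> = ennreal (exp (- measure \<mu> \<Lambda>)) * (\<Prod>i<k. emeasure \<mu> (?C i))"
    by (rule poisson_process_disjoint_prob[OF P \<Lambda> C(2,1)]) auto
  finally show ?thesis .
qed

text \<open>When \<open>\<Lambda>\<close> holds \<open>k\<close> points there are exactly
  \<open>fact k\<close> enumerations, and this number cancels the factorial in the Poisson weight.
  Without disjointness the total agrees with the product formula; it is this agreement that later
  excludes mass on the diagonals.\<close>

lemma nn_integral_enumerations_total:
  assumes P: "poisson_process \<Omega> \<kappa> X \<mu>" and \<Lambda>: "\<Lambda> \<in> sets \<mu>" "emeasure \<mu> \<Lambda> < \<infinity>"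
  shows "(\<integral>\<^sup>+\<sigma>. emeasure \<Omega> {\<omega> \<in> space \<Omega>. enumerates \<kappa> X \<Lambda> k \<omega> \<sigma>} \<partial>count_space (injections k))
    = ennreal (exp (- measure \<mu> \<Lambda>)) * emeasure \<mu> \<Lambda> ^ k"
proof -
  interpret prob_space \<Omega> by (rule poisson_process_prob_space[OF P])
  note S = enumerates_measurable[OF P \<Lambda>(1)]
  note [measurable] = poisson_process_count_measurable[OF P \<Lambda>(1)]
  let ?S = "\<lambda>\<sigma>. {\<omega> \<in> space \<Omega>. enumerates \<kappa> X \<Lambda> k \<omega> \<sigma>}"
  let ?E = "{\<omega> \<in> space \<Omega>. point_count \<kappa> X \<Lambda> \<omega> = of_nat k}"
  have "(\<integral>\<^sup>+\<sigma>. emeasure \<Omega> (?S \<sigma>) \<partial>count_space (injections k))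
      = (\<integral>\<^sup>+\<sigma>. (\<integral>\<^sup>+\<omega>. indicator (?S \<sigma>) \<omega> \<partial>\<Omega>) \<partial>count_space (injections k))"
    by (simp only: nn_integral_indicator[OF S])
  also have "\<dots> = (\<integral>\<^sup>+\<omega>. (\<integral>\<^sup>+\<sigma>. indicator (?S \<sigma>) \<omega> \<partial>count_space (injections k)) \<partial>\<Omega>)"
    by (rule nn_integral_count_space_nn_integral[symmetric, OF countable_injections borel_measurable_indicator[OF S]])
  also have "\<dots> = (\<integral>\<^sup>+\<omega>. of_nat (fact k) * indicator ?E \<omega> \<partial>\<Omega>)"
  proof (rule nn_integral_cong)
    fix \<omega> assume \<omega>: "\<omega> \<in> space \<Omega>"
    let ?T = "{\<sigma> \<in> injections k. enumerates \<kappa> X \<Lambda> k \<omega> \<sigma>}"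
    have "(\<integral>\<^sup>+\<sigma>. indicator (?S \<sigma>) \<omega> \<partial>count_space (injections k))
        = (\<integral>\<^sup>+\<sigma>. indicator ?T \<sigma> \<partial>count_space (injections k))"
      using \<omega> by (intro nn_integral_cong) (auto split: split_indicator)
    also have "\<dots> = emeasure (count_space (injections k)) ?T"
      by (rule nn_integral_indicator) auto
    also have "\<dots> = of_nat (fact k) * indicator ?E \<omega>"
    proof (cases "\<omega> \<in> ?E")
      case True
      then have pts: "finite (points \<kappa> X \<Lambda> \<omega>)" "card (points \<kappa> X \<Lambda> \<omega>) = k"
        by (auto simp: point_count_eq_of_nat_iff)
      have T: "?T = {\<sigma> \<in> injections k. \<sigma> ` {..<k} \<subseteq> points \<kappa> X \<Lambda> \<omega>}"
        using True by (auto simp: enumerates_def)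
      then have "card ?T = fact k" "finite ?T"
        using card_injections_with_initial_image[OF pts, of "{}" 0] finite_injections_into[OF pts(1), of k] by simp_all
      then show ?thesis
        using True by (subst emeasure_count_space) auto
    next
      case False
      with \<omega> have T: "?T = {}" by (auto simp: enumerates_def)
      show ?thesis unfolding T using False by simp
    qed
    finally show "(\<integral>\<^sup>+\<sigma>. indicator (?S \<sigma>) \<omega> \<partial>count_space (injections k)) = of_nat (fact k) * indicator ?E \<omega>" .
  qed
  also have "\<dots> = of_nat (fact k) * emeasure \<Omega> ?E"
    by (subst nn_integral_cmult) auto
  also have "\<dots> = ennreal (fact k * (exp (- measure \<mu> \<Lambda>) * measure \<mu> \<Lambda> ^ k / fact k))"
  proof -
    have "of_nat (fact k) = ennreal (fact k)"
      by (simp only: ennreal_of_nat_eq_real_of_nat of_nat_fact)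
    then show ?thesis
      unfolding emeasure_eq_measure poisson_process_count_prob[OF P \<Lambda>]
      by (simp only:) (rule ennreal_mult[symmetric]; simp)
  qed
  also have "\<dots> = ennreal (exp (- measure \<mu> \<Lambda>)) * ennreal (measure \<mu> \<Lambda>) ^ k"
    by (simp add: ennreal_mult ennreal_power)
  also have "ennreal (measure \<mu> \<Lambda>) = emeasure \<mu> \<Lambda>"
    using \<Lambda>(2) by (intro emeasure_eq_ennreal_measure[symmetric]) auto
  finally show ?thesis .
qed

text \<open>The process may list its points in an order that depends on their positions. Summing over all
  enumerations of the points in \<open>\<Lambda>\<close> removes this dependence without any symmetrization.\<close>

lemma janossy_formula:
  fixes f :: "'x \<Rightarrow> 'b::{second_countable_topology, metric_space}"
  assumes P: "poisson_process \<Omega> \<kappa> X \<mu>" and \<Lambda>: "\<Lambda> \<in> sets \<mu>" "emeasure \<mu> \<Lambda> < \<infinity>"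
    and f[measurable]: "f \<in> borel_measurable \<mu>" and null: "\<And>c. emeasure \<mu> {x \<in> space \<mu>. f x = c} = 0"
    and g[measurable]: "g \<in> borel_measurable (Pi\<^sub>M {..<k} (\<lambda>_. \<mu>))"
  shows "(\<integral>\<^sup>+\<sigma>. (\<integral>\<^sup>+\<omega>. indicator {\<omega>. enumerates \<kappa> X \<Lambda> k \<omega> \<sigma>} \<omega> * g (\<lambda>i\<in>{..<k}. X (\<sigma> i) \<omega>) \<partial>\<Omega>)
      \<partial>count_space (injections k))
    = ennreal (exp (- measure \<mu> \<Lambda>)) * (\<integral>\<^sup>+x. g x \<partial>Pi\<^sub>M {..<k} (\<lambda>_. density \<mu> (indicator \<Lambda>)))"
proof -
  interpret prob_space \<Omega> by (rule poisson_process_prob_space[OF P])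
  note [measurable] = poisson_process_measurable[OF P] \<Lambda>(1) enumerates_measurable[OF P \<Lambda>(1)]
  define \<nu> where "\<nu> = density \<mu> (indicator \<Lambda>)"
  have sets_\<nu>[measurable_cong]: "sets \<nu> = sets \<mu>" by (simp add: \<nu>_def)
  have space_\<nu>: "space \<nu> = space \<mu>" by (simp add: \<nu>_def)
  have \<nu>_eq: "emeasure \<nu> A = emeasure \<mu> (\<Lambda> \<inter> A)" if "A \<in> sets \<mu>" for A
    unfolding \<nu>_def by (rule emeasure_restricted[OF \<Lambda>(1) that])
  have \<nu>_space: "emeasure \<nu> (space \<nu>) = emeasure \<mu> \<Lambda>"
    using \<nu>_eq[OF sets.top] sets.sets_into_space[OF \<Lambda>(1)] by (simp add: space_\<nu> Int_absorb2)
  have fin: "finite_measure \<nu>"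
    using \<Lambda>(2) \<nu>_space by (intro finite_measureI) auto
  have sets_P: "sets (Pi\<^sub>M {..<k} (\<lambda>_. \<nu>)) = sets (Pi\<^sub>M {..<k} (\<lambda>_. \<mu>))"
    by (intro sets_PiM_cong) (simp_all add: sets_\<nu>)
  let ?C = "count_space (injections k)"
  interpret C: sigma_finite_measure ?C
    by (rule sigma_finite_measure_count_space_countable[OF countable_injections])
  interpret C: pair_sigma_finite ?C \<Omega> ..
  define S where "S = {p \<in> space (?C \<Otimes>\<^sub>M \<Omega>). case p of (\<sigma>, \<omega>) \<Rightarrow> enumerates \<kappa> X \<Lambda> k \<omega> \<sigma>}"
  define T where "T = (\<lambda>(\<sigma>, \<omega>). \<lambda>i\<in>{..<k}. X (\<sigma> i) \<omega>)"
  have T[measurable]: "T \<in> ?C \<Otimes>\<^sub>M \<Omega> \<rightarrow>\<^sub>M Pi\<^sub>M {..<k} (\<lambda>_. \<nu>)"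
  proof (rule measurable_pair_measure_countable1[OF countable_injections])
    have "(\<lambda>\<omega>. \<lambda>i\<in>{..<k}. X (\<sigma> i) \<omega>) \<in> \<Omega> \<rightarrow>\<^sub>M Pi\<^sub>M {..<k} (\<lambda>_. \<nu>)" for \<sigma>
      by measurable
    then show "(\<lambda>\<omega>. T (\<sigma>, \<omega>)) \<in> \<Omega> \<rightarrow>\<^sub>M Pi\<^sub>M {..<k} (\<lambda>_. \<nu>)" for \<sigma>
      by (simp add: T_def)
  qed
  have S[measurable]: "S \<in> sets (?C \<Otimes>\<^sub>M \<Omega>)"
  proof -
    have "Measurable.pred (?C \<Otimes>\<^sub>M \<Omega>) (\<lambda>(\<sigma>, \<omega>). enumerates \<kappa> X \<Lambda> k \<omega> \<sigma>)"
      by (rule measurable_pair_measure_countable1[OF countable_injections])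
        (use enumerates_measurable[OF P \<Lambda>(1)] in \<open>auto simp: pred_def\<close>)
    then show ?thesis unfolding S_def pred_def by simp
  qed
  \<comment> \<open>\<open>Q\<close> collects the ordered listings: a configuration with
    \<open>k\<close> points in \<open>\<Lambda>\<close> contributes one tuple for each of its
    \<open>fact k\<close> orderings. It is identified by the two quantities just computed, its
    values on rectangles with disjoint sides and its total mass.\<close>
  define Q where "Q = distr (density (?C \<Otimes>\<^sub>M \<Omega>) (indicator S)) (Pi\<^sub>M {..<k} (\<lambda>_. \<nu>)) T"
  have Q_nn: "(\<integral>\<^sup>+x. h x \<partial>Q) =
      (\<integral>\<^sup>+\<sigma>. (\<integral>\<^sup>+\<omega>. indicator {\<omega>. enumerates \<kappa> X \<Lambda> k \<omega> \<sigma>} \<omega> * h (\<lambda>i\<in>{..<k}. X (\<sigma> i) \<omega>) \<partial>\<Omega>) \<partial>?C)"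
    if h: "h \<in> borel_measurable (Pi\<^sub>M {..<k} (\<lambda>_. \<nu>))" for h
  proof -
    note [measurable] = h
    have "(\<integral>\<^sup>+x. h x \<partial>Q) = (\<integral>\<^sup>+p. indicator S p * h (T p) \<partial>(?C \<Otimes>\<^sub>M \<Omega>))"
      unfolding Q_def by (subst nn_integral_distr, simp, simp, subst nn_integral_density) auto
    also have "\<dots> = (\<integral>\<^sup>+\<sigma>. (\<integral>\<^sup>+\<omega>. indicator S (\<sigma>, \<omega>) * h (T (\<sigma>, \<omega>)) \<partial>\<Omega>) \<partial>?C)"
      by (rule nn_integral_fst[symmetric]) simp
    also have "\<dots> = (\<integral>\<^sup>+\<sigma>. (\<integral>\<^sup>+\<omega>. indicator {\<omega>. enumerates \<kappa> X \<Lambda> k \<omega> \<sigma>} \<omega> * h (\<lambda>i\<in>{..<k}. X (\<sigma> i) \<omega>) \<partial>\<Omega>) \<partial>?C)"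
      by (intro nn_integral_cong) (auto simp: S_def T_def space_pair_measure split: split_indicator)
    finally show ?thesis .
  qed
  have sets_Q: "sets Q = sets (Pi\<^sub>M {..<k} (\<lambda>_. \<nu>))" by (simp add: Q_def)
  have "Q = scale_measure (ennreal (exp (- measure \<mu> \<Lambda>))) (Pi\<^sub>M {..<k} (\<lambda>_. \<nu>))"
  proof (rule measure_eqI_disjoint_rectangles[where f=f])
    show "finite_measure \<nu>" by (rule fin)
    show "f \<in> borel_measurable \<nu>" by measurable
    show "emeasure \<nu> {x \<in> space \<nu>. f x = c} = 0" for c
    proof -
      have *: "{x \<in> space \<mu>. f x = c} \<in> sets \<mu>" by measurable
      have "emeasure \<mu> (\<Lambda> \<inter> {x \<in> space \<mu>. f x = c}) \<le> emeasure \<mu> {x \<in> space \<mu>. f x = c}"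
        by (rule emeasure_mono[OF Int_lower2 *])
      then show ?thesis unfolding space_\<nu> \<nu>_eq[OF *] null by simp
    qed
    show "sets Q = sets (Pi\<^sub>M {..<k} (\<lambda>_. \<nu>))" by (fact sets_Q)
    show "ennreal (exp (- measure \<mu> \<Lambda>)) < \<infinity>" by simp
  next
    fix B :: "nat \<Rightarrow> 'x set" assume B: "\<And>i. i < k \<Longrightarrow> B i \<in> sets \<nu>" "disjoint_family_on B {..<k}"
    have B': "Pi\<^sub>E {..<k} B \<in> sets (Pi\<^sub>M {..<k} (\<lambda>_. \<nu>))"
      using B(1) by (intro sets_PiM_I_finite) auto
    have "emeasure Q (Pi\<^sub>E {..<k} B) = (\<integral>\<^sup>+x. indicator (Pi\<^sub>E {..<k} B) x \<partial>Q)"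
      using B' by (simp add: sets_Q)
    also have "\<dots> = (\<integral>\<^sup>+\<sigma>. (\<integral>\<^sup>+\<omega>. indicator {\<omega>. enumerates \<kappa> X \<Lambda> k \<omega> \<sigma>} \<omega> *
        indicator (Pi\<^sub>E {..<k} B) (\<lambda>i\<in>{..<k}. X (\<sigma> i) \<omega>) \<partial>\<Omega>) \<partial>?C)"
      using B' by (intro Q_nn) simp
    also have "\<dots> = (\<integral>\<^sup>+\<sigma>. emeasure \<Omega> {\<omega> \<in> space \<Omega>. enumerates \<kappa> X \<Lambda> k \<omega> \<sigma> \<and> (\<forall>i<k. X (\<sigma> i) \<omega> \<in> B i)} \<partial>?C)"
    proof (rule nn_integral_cong)
      fix \<sigma>
      have pe: "(\<lambda>i\<in>{..<k}. X (\<sigma> i) \<omega>) \<in> Pi\<^sub>E {..<k} B \<longleftrightarrow> (\<forall>i<k. X (\<sigma> i) \<omega> \<in> B i)" for \<omega>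
        unfolding restrict_PiE_iff by blast
      have m: "{\<omega> \<in> space \<Omega>. enumerates \<kappa> X \<Lambda> k \<omega> \<sigma> \<and> (\<forall>i<k. X (\<sigma> i) \<omega> \<in> B i)} \<in> sets \<Omega>"
      proof -
        have "{\<omega> \<in> space \<Omega>. enumerates \<kappa> X \<Lambda> k \<omega> \<sigma> \<and> (\<forall>i<k. X (\<sigma> i) \<omega> \<in> B i)} =
          {\<omega> \<in> space \<Omega>. enumerates \<kappa> X \<Lambda> k \<omega> \<sigma>} \<inter> ((\<lambda>\<omega>. \<lambda>i\<in>{..<k}. X (\<sigma> i) \<omega>) -` Pi\<^sub>E {..<k} B \<inter> space \<Omega>)"
          unfolding vimage_def pe by blast
        also have "\<dots> \<in> sets \<Omega>"
          by (intro sets.Int enumerates_measurable[OF P \<Lambda>(1)] measurable_sets[OF _ B']) measurable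
        finally show ?thesis .
      qed
      have "(\<integral>\<^sup>+\<omega>. indicator {\<omega>. enumerates \<kappa> X \<Lambda> k \<omega> \<sigma>} \<omega> *
          indicator (Pi\<^sub>E {..<k} B) (\<lambda>i\<in>{..<k}. X (\<sigma> i) \<omega>) \<partial>\<Omega>)
        = (\<integral>\<^sup>+\<omega>. indicator {\<omega> \<in> space \<Omega>. enumerates \<kappa> X \<Lambda> k \<omega> \<sigma> \<and> (\<forall>i<k. X (\<sigma> i) \<omega> \<in> B i)} \<omega> \<partial>\<Omega>)"
        unfolding indicator_def pe mem_Collect_eq by (intro nn_integral_cong) simp
      also have "\<dots> = emeasure \<Omega> {\<omega> \<in> space \<Omega>. enumerates \<kappa> X \<Lambda> k \<omega> \<sigma> \<and> (\<forall>i<k. X (\<sigma> i) \<omega> \<in> B i)}"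
        by (rule nn_integral_indicator[OF m])
      finally show "(\<integral>\<^sup>+\<omega>. indicator {\<omega>. enumerates \<kappa> X \<Lambda> k \<omega> \<sigma>} \<omega> *
          indicator (Pi\<^sub>E {..<k} B) (\<lambda>i\<in>{..<k}. X (\<sigma> i) \<omega>) \<partial>\<Omega>) = \<dots>" .
    qed
    also have "\<dots> = ennreal (exp (- measure \<mu> \<Lambda>)) * (\<Prod>i<k. emeasure \<mu> (\<Lambda> \<inter> B i))"
      using B by (intro nn_integral_enumerations_disjoint[OF P \<Lambda>]) (auto simp: sets_\<nu>)
    also have "(\<Prod>i<k. emeasure \<mu> (\<Lambda> \<inter> B i)) = (\<Prod>i<k. emeasure \<nu> (B i))"
      using B(1) by (intro prod.cong) (auto simp: sets_\<nu> \<nu>_eq)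
    finally show "emeasure Q (Pi\<^sub>E {..<k} B) = ennreal (exp (- measure \<mu> \<Lambda>)) * (\<Prod>i<k. emeasure \<nu> (B i))" .
  next
    have "emeasure Q (space Q) = (\<integral>\<^sup>+x. 1 \<partial>Q)" by simp
    also have "\<dots> = (\<integral>\<^sup>+\<sigma>. (\<integral>\<^sup>+\<omega>. indicator {\<omega>. enumerates \<kappa> X \<Lambda> k \<omega> \<sigma>} \<omega> * 1 \<partial>\<Omega>) \<partial>?C)"
      by (rule Q_nn) simp
    also have "\<dots> = (\<integral>\<^sup>+\<sigma>. emeasure \<Omega> {\<omega> \<in> space \<Omega>. enumerates \<kappa> X \<Lambda> k \<omega> \<sigma>} \<partial>?C)"
    proof (rule nn_integral_cong)
      fix \<sigma>
      have "(\<integral>\<^sup>+\<omega>. indicator {\<omega>. enumerates \<kappa> X \<Lambda> k \<omega> \<sigma>} \<omega> * 1 \<partial>\<Omega>)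
        = (\<integral>\<^sup>+\<omega>. indicator {\<omega> \<in> space \<Omega>. enumerates \<kappa> X \<Lambda> k \<omega> \<sigma>} \<omega> \<partial>\<Omega>)"
        by (intro nn_integral_cong) (auto split: split_indicator)
      then show "(\<integral>\<^sup>+\<omega>. indicator {\<omega>. enumerates \<kappa> X \<Lambda> k \<omega> \<sigma>} \<omega> * 1 \<partial>\<Omega>)
        = emeasure \<Omega> {\<omega> \<in> space \<Omega>. enumerates \<kappa> X \<Lambda> k \<omega> \<sigma>}"
        using enumerates_measurable[OF P \<Lambda>(1)] by simp
    qed
    finally show "emeasure Q (space Q) = ennreal (exp (- measure \<mu> \<Lambda>)) * emeasure \<nu> (space \<nu>) ^ k"
      unfolding nn_integral_enumerations_total[OF P \<Lambda>] \<nu>_space .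
  qed
  moreover have "g \<in> borel_measurable (Pi\<^sub>M {..<k} (\<lambda>_. \<nu>))"
    using g by (simp add: measurable_cong_sets[OF sets_P refl])
  ultimately show ?thesis
    using Q_nn[of g] by (simp add: nn_integral_scale_measure \<nu>_def)
qed

section \<open>Connected components\<close>

text \<open>The vertex set, the vertex type and the sites are left free, so that the full graph, the
  graph in a window, a subgraph on fewer vertices and a relabelled graph are all instances.\<close>

definition edge :: "('x \<Rightarrow> 'x \<Rightarrow> real) \<Rightarrow> ('v \<Rightarrow> 'x) \<Rightarrow> 'v set \<Rightarrow> ('v set \<Rightarrow> real) \<Rightarrow> 'v \<Rightarrow> 'v \<Rightarrow> bool" where
  "edge \<phi> s V u v w \<longleftrightarrow> v \<in> V \<and> w \<in> V \<and> v \<noteq> w \<and> u {v, w} \<le> \<phi> (s v) (s w)"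

definition component ::
    "('x \<Rightarrow> 'x \<Rightarrow> real) \<Rightarrow> ('v \<Rightarrow> 'x) \<Rightarrow> 'v set \<Rightarrow> ('v set \<Rightarrow> real) \<Rightarrow> 'v \<Rightarrow> 'v set" where
  "component \<phi> s V u r = {w. (edge \<phi> s V u)\<^sup>*\<^sup>* r w}"

lemma cluster_eq_component:
  "cluster \<phi> \<kappa> X x \<omega> u = component \<phi> (site x X \<omega>) (vertices \<kappa> \<omega>) u None"
proof -
  have "adjacent \<phi> \<kappa> X x \<omega> u = edge \<phi> (site x X \<omega>) (vertices \<kappa> \<omega>) u"
    by (intro ext) (simp add: adjacent_def edge_def)
  then show ?thesis unfolding cluster_def component_def by simp
qed

lemma root_in_component: "r \<in> component \<phi> s V u r"
  by (simp add: component_def)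

lemma component_subset: "r \<in> V \<Longrightarrow> component \<phi> s V u r \<subseteq> V"
proof
  fix w assume r: "r \<in> V" and "w \<in> component \<phi> s V u r"
  then have "(edge \<phi> s V u)\<^sup>*\<^sup>* r w" by (simp add: component_def)
  then show "w \<in> V" by (induction) (use r in \<open>auto simp: edge_def\<close>)
qed

lemma component_step:
  "v \<in> component \<phi> s V u r \<Longrightarrow> edge \<phi> s V u v w \<Longrightarrow> w \<in> component \<phi> s V u r"
  unfolding component_def by (simp add: rtranclp.rtrancl_into_rtrancl)

lemma component_induct:
  assumes "w \<in> component \<phi> s V u r" "P r"
    and "\<And>v w. v \<in> component \<phi> s V u r \<Longrightarrow> P v \<Longrightarrow> edge \<phi> s V u v w \<Longrightarrow> P w"
  shows "P w"
proof -
  have "(edge \<phi> s V u)\<^sup>*\<^sup>* r w" using assms(1) by (simp add: component_def)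
  then show ?thesis
  proof induction
    case base show ?case by (rule assms(2))
  next
    case (step y z)
    then show ?case using assms(3)[of y z] by (simp add: component_def)
  qed
qed

lemma component_mono:
  assumes "V \<subseteq> W"
  shows "component \<phi> s V u r \<subseteq> component \<phi> s W u r"
proof
  fix w assume "w \<in> component \<phi> s V u r"
  then show "w \<in> component \<phi> s W u r"
  proof (rule component_induct)
    fix v w assume v: "v \<in> component \<phi> s W u r" and "edge \<phi> s V u v w"
    then have "edge \<phi> s W u v w" using assms unfolding edge_def by blast
    then show "w \<in> component \<phi> s W u r" by (rule component_step[OF v])
  qed (rule root_in_component)
qed

text \<open>A path has finitely many vertices, so it already lies in one member of the increasing
  sequence.\<close>

lemma component_UN_incseq:
  assumes "incseq V"
  shows "component \<phi> s (\<Union>m. V m) u r = (\<Union>m. component \<phi> s (V m) u r)"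
proof (intro equalityI subsetI)
  fix w assume "w \<in> component \<phi> s (\<Union>m. V m) u r"
  then show "w \<in> (\<Union>m. component \<phi> s (V m) u r)"
  proof (rule component_induct)
    fix v w assume "v \<in> (\<Union>m. component \<phi> s (V m) u r)" "edge \<phi> s (\<Union>m. V m) u v w"
    then obtain l i j where l: "v \<in> component \<phi> s (V l) u r" "v \<in> V i" "w \<in> V j" "v \<noteq> w" "u {v, w} \<le> \<phi> (s v) (s w)"
      by (auto simp: edge_def)
    define m where "m = max l (max i j)"
    have "V l \<subseteq> V m" "V i \<subseteq> V m" "V j \<subseteq> V m"
      by (rule incseqD[OF assms]; simp add: m_def)+
    then have "v \<in> component \<phi> s (V m) u r" "edge \<phi> s (V m) u v w"
      using l component_mono[of "V l" "V m" \<phi> s u r] by (auto simp: edge_def)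
    then show "w \<in> (\<Union>m. component \<phi> s (V m) u r)"
      using component_step[of v \<phi> s "V m" u r w] by blast
  qed (rule UN_I[of 0], simp, rule root_in_component)
next
  fix w assume "w \<in> (\<Union>m. component \<phi> s (V m) u r)"
  then obtain m where "w \<in> component \<phi> s (V m) u r" by blast
  then show "w \<in> component \<phi> s (\<Union>m. V m) u r"
    using component_mono[of "V m" "\<Union>m. V m" \<phi> s u r] by blast
qed

lemma component_cong:
  assumes "\<And>v. v \<in> V \<Longrightarrow> s v = s' v" "\<And>v w. v \<in> V \<Longrightarrow> w \<in> V \<Longrightarrow> v \<noteq> w \<Longrightarrow> u {v, w} = u' {v, w}"
  shows "component \<phi> s V u r = component \<phi> s' V u' r"
proof -
  have "edge \<phi> s V u = edge \<phi> s' V u'"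
    unfolding edge_def by (intro ext) (metis assms)
  then show ?thesis by (simp add: component_def)
qed

text \<open>The event that the component equals \<open>W\<close> splits into a condition on the
  pairs inside \<open>W\<close> and one on the pairs that leave \<open>W\<close>. They involve
  different edge variables, so for fixed sites they are independent; this is the source of the
  product in \<open>reach_factor\<close>.\<close>

lemma component_restrict_iff:
  assumes W: "W \<subseteq> V" "r \<in> W"
  shows "component \<phi> s V u r = W \<longleftrightarrow>
    component \<phi> s W u r = W \<and> (\<forall>v\<in>W. \<forall>w\<in>V - W. \<not> u {v, w} \<le> \<phi> (s v) (s w))"
proof
  assume eq: "component \<phi> s V u r = W"
  have no: "\<not> u {v, w} \<le> \<phi> (s v) (s w)" if "v \<in> W" "w \<in> V - W" for v w
  proof
    assume "u {v, w} \<le> \<phi> (s v) (s w)"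
    then have "edge \<phi> s V u v w" using that W by (auto simp: edge_def)
    then have "w \<in> W" using component_step[of v \<phi> s V u r w] eq that by simp
    then show False using that by simp
  qed
  have "W \<subseteq> component \<phi> s W u r"
  proof
    fix w assume "w \<in> W"
    then have "w \<in> component \<phi> s V u r" by (simp add: eq)
    then show "w \<in> component \<phi> s W u r"
    proof (rule component_induct)
      fix v w assume v: "v \<in> component \<phi> s V u r" "v \<in> component \<phi> s W u r" and e: "edge \<phi> s V u v w"
      then have "w \<in> W" using component_step[OF v(1) e] eq by simp
      then have "edge \<phi> s W u v w" using e v eq by (auto simp: edge_def)
      then show "w \<in> component \<phi> s W u r" by (rule component_step[OF v(2)])
    qed (rule root_in_component)
  qed
  then show "component \<phi> s W u r = W \<and> (\<forall>v\<in>W. \<forall>w\<in>V - W. \<not> u {v, w} \<le> \<phi> (s v) (s w))"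
    using component_subset[OF W(2)] no by blast
next
  assume A: "component \<phi> s W u r = W \<and> (\<forall>v\<in>W. \<forall>w\<in>V - W. \<not> u {v, w} \<le> \<phi> (s v) (s w))"
  have "component \<phi> s V u r \<subseteq> W"
  proof
    fix w assume "w \<in> component \<phi> s V u r"
    then show "w \<in> W"
      by (rule component_induct) (use A W in \<open>auto simp: edge_def\<close>)
  qed
  then show "component \<phi> s V u r = W"
    using A component_mono[OF W(1), of \<phi> s u r] by blast
qed

text \<open>An injective renaming of the vertices is a graph isomorphism. It is used to carry the
  points that an enumeration lists back to the standard indices \<open>{..<k}\<close>.\<close>

lemma component_relabel:
  assumes h: "inj_on h V" and r: "r \<in> V"
  shows "component \<phi> s (h ` V) u (h r) = h ` component \<phi> (s \<circ> h) V (\<lambda>e. u (h ` e)) r"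
proof (intro equalityI subsetI)
  fix w assume "w \<in> component \<phi> s (h ` V) u (h r)"
  then show "w \<in> h ` component \<phi> (s \<circ> h) V (\<lambda>e. u (h ` e)) r"
  proof (rule component_induct)
    fix v w assume "v \<in> h ` component \<phi> (s \<circ> h) V (\<lambda>e. u (h ` e)) r" and e: "edge \<phi> s (h ` V) u v w"
    then obtain v' w' where vw: "v = h v'" "v' \<in> component \<phi> (s \<circ> h) V (\<lambda>e. u (h ` e)) r" "w = h w'" "w' \<in> V"
      by (auto simp: edge_def)
    moreover have "v' \<in> V" using vw(2) component_subset[OF r] by blast
    ultimately have "edge \<phi> (s \<circ> h) V (\<lambda>e. u (h ` e)) v' w'"
      using e by (auto simp: edge_def)
    then show "w \<in> h ` component \<phi> (s \<circ> h) V (\<lambda>e. u (h ` e)) r"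
      unfolding vw(3) by (intro imageI component_step[OF vw(2)])
  qed (intro imageI root_in_component)
next
  fix w assume "w \<in> h ` component \<phi> (s \<circ> h) V (\<lambda>e. u (h ` e)) r"
  then obtain w' where w': "w' \<in> component \<phi> (s \<circ> h) V (\<lambda>e. u (h ` e)) r" "w = h w'" by blast
  from w'(1) have "h w' \<in> component \<phi> s (h ` V) u (h r)"
  proof (rule component_induct)
    fix v w assume v: "h v \<in> component \<phi> s (h ` V) u (h r)" and e: "edge \<phi> (s \<circ> h) V (\<lambda>e. u (h ` e)) v w"
    have "edge \<phi> s (h ` V) u (h v) (h w)"
      using e inj_onD[OF h, of v w] by (auto simp: edge_def)
    then show "h w \<in> component \<phi> s (h ` V) u (h r)" by (rule component_step[OF v])
  qed (rule root_in_component)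
  with w' show "w \<in> component \<phi> s (h ` V) u (h r)" by simp
qed

text \<open>Reachability is a countable union over path lengths, and each further step a countable
  union over the intermediate vertex. The fixed set \<open>V0\<close> contains the random vertex
  set; sites and edge variables have to be measurable only there, the latter only at pairs of
  distinct vertices, the only coordinates that the edge space has.\<close>

lemma component_measurable:
  fixes V :: "'a \<Rightarrow> 'v::countable set"
  assumes \<phi>: "(\<lambda>(x, y). \<phi> x y) \<in> borel_measurable (N \<Otimes>\<^sub>M N)"
    and V: "\<And>z. z \<in> space M \<Longrightarrow> V z \<subseteq> V0" "\<And>v. v \<in> V0 \<Longrightarrow> {z \<in> space M. v \<in> V z} \<in> sets M"
    and s: "\<And>v. v \<in> V0 \<Longrightarrow> (\<lambda>z. s z v) \<in> M \<rightarrow>\<^sub>M N"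
    and u: "\<And>v w. v \<in> V0 \<Longrightarrow> w \<in> V0 \<Longrightarrow> v \<noteq> w \<Longrightarrow> (\<lambda>z. u z {v, w}) \<in> borel_measurable M"
  shows "{z \<in> space M. w \<in> component \<phi> (s z) (V z) (u z) r} \<in> sets M"
proof -
  have e: "{z \<in> space M. edge \<phi> (s z) (V z) (u z) v w} \<in> sets M" for v w
  proof (cases "v \<in> V0 \<and> w \<in> V0 \<and> v \<noteq> w")
    case True
    then have m: "(\<lambda>z. s z v) \<in> M \<rightarrow>\<^sub>M N" "(\<lambda>z. s z w) \<in> M \<rightarrow>\<^sub>M N" "(\<lambda>z. u z {v, w}) \<in> borel_measurable M"
      using s u by blast+
    have "(\<lambda>z. (\<lambda>(x, y). \<phi> x y) (s z v, s z w)) \<in> borel_measurable M"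
      by (rule measurable_compose[OF measurable_Pair[OF m(1,2)] \<phi>])
    then have "{z \<in> space M. u z {v, w} \<le> \<phi> (s z v) (s z w)} \<in> sets M"
      using m(3) by simp
    moreover have "{z \<in> space M. edge \<phi> (s z) (V z) (u z) v w} =
        {z \<in> space M. v \<in> V z} \<inter> {z \<in> space M. w \<in> V z} \<inter> {z \<in> space M. u z {v, w} \<le> \<phi> (s z v) (s z w)}"
      using True by (auto simp: edge_def)
    ultimately show ?thesis using V(2) True by auto
  next
    case False
    then have "{z \<in> space M. edge \<phi> (s z) (V z) (u z) v w} = {}"
      using V(1) by (auto simp: edge_def)
    then show ?thesis by (metis sets.empty_sets)
  qed
  have "{z \<in> space M. (edge \<phi> (s z) (V z) (u z) ^^ n) r w} \<in> sets M" for n w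
  proof (induction n arbitrary: w)
    case 0
    show ?case by (cases "r = w") auto
  next
    case (Suc n)
    have "{z \<in> space M. (edge \<phi> (s z) (V z) (u z) ^^ Suc n) r w} =
      (\<Union>v. {z \<in> space M. (edge \<phi> (s z) (V z) (u z) ^^ n) r v} \<inter> {z \<in> space M. edge \<phi> (s z) (V z) (u z) v w})"
      by (auto simp: relcompp_apply)
    also have "\<dots> \<in> sets M"
      using Suc e by (intro sets.countable_UN') auto
    finally show ?case .
  qed
  then have "(\<Union>n. {z \<in> space M. (edge \<phi> (s z) (V z) (u z) ^^ n) r w}) \<in> sets M"
    by (intro sets.countable_UN') auto
  also have "(\<Union>n. {z \<in> space M. (edge \<phi> (s z) (V z) (u z) ^^ n) r w}) =
      {z \<in> space M. w \<in> component \<phi> (s z) (V z) (u z) r}"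
    unfolding component_def by (auto simp: rtranclp_power)
  finally show ?thesis .
qed

lemma component_eq_measurable:
  fixes V :: "'a \<Rightarrow> 'v::countable set"
  assumes \<phi>: "(\<lambda>(x, y). \<phi> x y) \<in> borel_measurable (N \<Otimes>\<^sub>M N)"
    and V: "\<And>z. z \<in> space M \<Longrightarrow> V z \<subseteq> V0" "\<And>v. v \<in> V0 \<Longrightarrow> {z \<in> space M. v \<in> V z} \<in> sets M"
    and s: "\<And>v. v \<in> V0 \<Longrightarrow> (\<lambda>z. s z v) \<in> M \<rightarrow>\<^sub>M N"
    and u: "\<And>v w. v \<in> V0 \<Longrightarrow> w \<in> V0 \<Longrightarrow> v \<noteq> w \<Longrightarrow> (\<lambda>z. u z {v, w}) \<in> borel_measurable M"
  shows "{z \<in> space M. component \<phi> (s z) (V z) (u z) r = W} \<in> sets M"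
proof -
  have m: "{z \<in> space M. w \<in> component \<phi> (s z) (V z) (u z) r} \<in> sets M" for w
    by (rule component_measurable[of \<phi> N M V V0 s u]) (use assms in auto)
  have "{z \<in> space M. component \<phi> (s z) (V z) (u z) r = W} =
    {z \<in> space M. \<forall>w. w \<in> component \<phi> (s z) (V z) (u z) r \<longleftrightarrow> w \<in> W}" by auto
  also have "\<dots> \<in> sets M"
  proof (rule sets.sets_Collect_countable_All)
    show "{z \<in> space M. w \<in> component \<phi> (s z) (V z) (u z) r \<longleftrightarrow> w \<in> W} \<in> sets M" for w
    proof (cases "w \<in> W")
      case True then show ?thesis using m[of w] by simp
    next
      case False
      have "{z \<in> space M. w \<notin> component \<phi> (s z) (V z) (u z) r} =
        space M - {z \<in> space M. w \<in> component \<phi> (s z) (V z) (u z) r}" by auto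
      then show ?thesis using m[of w] False by simp
    qed
  qed
  finally show ?thesis .
qed

section \<open>Edge probabilities for finitely many fixed sites\<close>

lemma prob_space_uniform01: "prob_space uniform01"
  unfolding uniform01_def by (rule prob_space_uniform_measure) auto

lemma sets_uniform01[measurable_cong, simp]: "sets uniform01 = sets borel"
  by (simp add: uniform01_def)

lemma space_uniform01[simp]: "space uniform01 = UNIV"
  by (simp add: uniform01_def)

lemma emeasure_uniform01_greaterThan:
  assumes "0 \<le> p" "p \<le> 1"
  shows "emeasure uniform01 {p<..} = ennreal (1 - p)"
proof -
  have "{0<..<1} \<inter> {p<..} = {p<..<1}" using assms by auto
  then show ?thesis
    unfolding uniform01_def using assms by (subst emeasure_uniform_measure) (auto simp: divide_ennreal_def)
qed

definition vset :: "nat \<Rightarrow> nat option set" where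
  "vset n = insert None (Some ` {..<n})"

lemma vset_simps[simp]: "None \<in> vset n" "Some i \<in> vset n \<longleftrightarrow> i < n" "finite (vset n)" "card (vset n) = Suc n"
  by (auto simp: vset_def card_image)

lemma vset_mono: "n \<le> k \<Longrightarrow> vset n \<subseteq> vset k"
  by (auto simp: vset_def)

definition vpairs :: "nat \<Rightarrow> nat option set set" where
  "vpairs n = {{v, w} | v w. v \<in> vset n \<and> w \<in> vset n \<and> v \<noteq> w}"

lemma finite_vpairs[simp]: "finite (vpairs n)"
  by (rule finite_subset[of _ "Pow (vset n)"]) (auto simp: vpairs_def)

lemma vpairs_subset: "e \<in> vpairs n \<Longrightarrow> e \<subseteq> vset n"
  unfolding vpairs_def by blast

lemma vpairsI: "v \<in> vset n \<Longrightarrow> w \<in> vset n \<Longrightarrow> v \<noteq> w \<Longrightarrow> {v, w} \<in> vpairs n"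
  unfolding vpairs_def by blast

definition rooted :: "'x \<Rightarrow> (nat \<Rightarrow> 'x) \<Rightarrow> nat option \<Rightarrow> 'x" where
  "rooted x0 x v = (case v of None \<Rightarrow> x0 | Some i \<Rightarrow> x i)"

lemma rooted_simps[simp]: "rooted x0 x None = x0" "rooted x0 x (Some i) = x i"
  by (simp_all add: rooted_def)

text \<open>Only the finitely many edge variables among the root and \<open>k\<close> points are
  kept, so that the edge space is a finite product that can be split and integrated by Fubini. The
  first \<open>n\<close> points play the cluster and the remaining ones the rest of the
  window.\<close>

definition reach :: "('x \<Rightarrow> 'x \<Rightarrow> real) \<Rightarrow> 'x \<Rightarrow> nat \<Rightarrow> nat \<Rightarrow> (nat \<Rightarrow> 'x) \<Rightarrow> ennreal" where
  "reach \<phi> x0 k n x = emeasure (Pi\<^sub>M (vpairs k) (\<lambda>_. uniform01))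
     {u \<in> space (Pi\<^sub>M (vpairs k) (\<lambda>_. uniform01)). component \<phi> (rooted x0 x) (vset k) u None = vset n}"

lemma product_prob_space_uniform01: "product_prob_space (\<lambda>_. uniform01)"
  by (intro product_prob_spaceI prob_space_uniform01)

lemma component_event_sets:
  assumes \<phi>: "(\<lambda>(x, y). \<phi> x y) \<in> borel_measurable (N \<Otimes>\<^sub>M N)" and N: "space N = UNIV"
    and pairs: "\<And>v w. v \<in> V \<Longrightarrow> w \<in> V \<Longrightarrow> v \<noteq> w \<Longrightarrow> {v, w} \<in> E"
  shows "{u \<in> space (Pi\<^sub>M E (\<lambda>_. uniform01)). component \<phi> s V u (r :: 'v :: countable) = W} \<in> sets (Pi\<^sub>M E (\<lambda>_. uniform01))"
proof (rule component_eq_measurable[where ?V0.0=V and N=N])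
  show "(\<lambda>z. s v) \<in> Pi\<^sub>M E (\<lambda>_. uniform01) \<rightarrow>\<^sub>M N" for v
    by (rule measurable_const) (simp add: N)
  show "(\<lambda>u. u {v, w}) \<in> borel_measurable (Pi\<^sub>M E (\<lambda>_. uniform01))" if "v \<in> V" "w \<in> V" "v \<noteq> w" for v w
    using measurable_component_singleton[OF pairs[OF that], of "\<lambda>_. uniform01"]
    by (simp add: measurable_cong_sets[OF refl sets_uniform01])
qed (use \<phi> in auto)

text \<open>Reindexing independent uniform variables along an injection gives independent uniform
  variables again. So the indices under which the process lists its points are irrelevant once the
  positions are given, and the edge probability becomes a function of the positions alone.\<close>

lemma reach_relabel:
  assumes \<phi>: "(\<lambda>(x, y). \<phi> x y) \<in> borel_measurable (N \<Otimes>\<^sub>M N)" "space N = UNIV"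
    and \<sigma>: "inj_on \<sigma> {..<k}" and n: "n \<le> k"
    and s: "s None = x0" "\<And>i. i < k \<Longrightarrow> s (Some (\<sigma> i)) = x i"
  shows "emeasure pair_space {u \<in> space pair_space.
      component \<phi> s (insert None (Some ` \<sigma> ` {..<k})) u None = insert None (Some ` \<sigma> ` {..<n})}
    = reach \<phi> x0 k n x"
proof -
  interpret K: product_prob_space "\<lambda>_. uniform01" by (rule product_prob_space_uniform01)
  let ?h = "map_option \<sigma>"
  let ?K = "{{v, w} | v w. v \<noteq> w} :: nat option set set"
  let ?P = "Pi\<^sub>M (vpairs k) (\<lambda>_. uniform01)"
  let ?t = "\<lambda>u. \<lambda>e\<in>vpairs k. u (?h ` e)"
  have h_inj: "inj_on ?h (vset k)"
  proof (rule inj_onI)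
    fix v w assume "v \<in> vset k" "w \<in> vset k" "?h v = ?h w"
    then show "v = w"
      using inj_onD[OF \<sigma>] by (cases v; cases w) auto
  qed
  have h_vset: "?h ` vset m = insert None (Some ` \<sigma> ` {..<m})" for m
    unfolding vset_def by (auto simp: image_iff)
  have f_inj: "inj_on ((`) ?h) (vpairs k)"
  proof (rule inj_onI)
    fix e e' assume "e \<in> vpairs k" "e' \<in> vpairs k" "?h ` e = ?h ` e'"
    then show "e = e'"
      using inj_on_image_eq_iff[OF h_inj vpairs_subset vpairs_subset] by blast
  qed
  have f_maps: "(`) ?h \<in> vpairs k \<rightarrow> ?K"
  proof
    fix e assume "e \<in> vpairs k"
    then obtain v w where vw: "e = {v, w}" "v \<in> vset k" "w \<in> vset k" "v \<noteq> w" unfolding vpairs_def by blast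
    then have "?h ` e = {?h v, ?h w}" "?h v \<noteq> ?h w" using inj_onD[OF h_inj, of v w] by auto
    then show "?h ` e \<in> ?K" by blast
  qed
  have distr: "distr pair_space ?P ?t = ?P"
    unfolding pair_space_def by (rule distr_PiM_reindex[OF prob_space_uniform01 f_inj f_maps])
  have t[measurable]: "?t \<in> pair_space \<rightarrow>\<^sub>M ?P"
    unfolding pair_space_def
    by (rule measurable_restrict, rule measurable_component_singleton) (use f_maps in auto)
  let ?A = "{u \<in> space ?P. component \<phi> (rooted x0 x) (vset k) u None = vset n}"
  have A: "?A \<in> sets ?P"
    by (rule component_event_sets[OF \<phi> vpairsI])
  have "reach \<phi> x0 k n x = emeasure (distr pair_space ?P ?t) ?A"
    unfolding reach_def distr ..
  also have "\<dots> = emeasure pair_space (?t -` ?A \<inter> space pair_space)"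
    by (rule emeasure_distr[OF t A])
  also have "?t -` ?A \<inter> space pair_space = {u \<in> space pair_space.
      component \<phi> s (insert None (Some ` \<sigma> ` {..<k})) u None = insert None (Some ` \<sigma> ` {..<n})}"
  proof -
    have "component \<phi> (rooted x0 x) (vset k) (?t u) None = vset n \<longleftrightarrow>
      component \<phi> s (insert None (Some ` \<sigma> ` {..<k})) u None = insert None (Some ` \<sigma> ` {..<n})" for u
    proof -
      have "component \<phi> (rooted x0 x) (vset k) (?t u) None = component \<phi> (s \<circ> ?h) (vset k) (\<lambda>e. u (?h ` e)) None"
        by (rule component_cong) (auto simp: s vpairsI vset_def)
      moreover have "component \<phi> s (?h ` vset k) u (?h None) = ?h ` component \<phi> (s \<circ> ?h) (vset k) (\<lambda>e. u (?h ` e)) None"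
        by (rule component_relabel[OF h_inj]) simp
      moreover have "component \<phi> (s \<circ> ?h) (vset k) (\<lambda>e. u (?h ` e)) None \<subseteq> vset k"
        by (rule component_subset) simp
      ultimately show ?thesis
        using inj_on_image_eq_iff[OF h_inj _ vset_mono[OF n]] unfolding h_vset by simp
    qed
    moreover have "?t u \<in> space ?P" if "u \<in> space pair_space" for u
      using measurable_space[OF t that] .
    ultimately show ?thesis by auto
  qed
  finally show ?thesis ..
qed

text \<open>The variables of pairs inside \<open>vset n\<close> decide whether the first
  \<open>n\<close> points and the root form one component. Those of pairs between
  \<open>vset n\<close> and an outside point must all fail, which gives the product. Pairs of two
  outside points are unconstrained and contribute the factor 1.\<close>

lemma reach_factor:
  assumes \<phi>: "(\<lambda>(x, y). \<phi> x y) \<in> borel_measurable (N \<Otimes>\<^sub>M N)" "space N = UNIV"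
    and bounds: "\<And>x y. 0 \<le> \<phi> x y" "\<And>x y. \<phi> x y \<le> 1" and n: "n \<le> k"
  shows "reach \<phi> x0 k n x =
    reach \<phi> x0 n n x * (\<Prod>j\<in>{n..<k}. \<Prod>v\<in>vset n. ennreal (1 - \<phi> (rooted x0 x v) (x j)))"
proof -
  interpret K: product_prob_space "\<lambda>_. uniform01" by (rule product_prob_space_uniform01)
  let ?I = "vpairs n" and ?J = "vpairs k - vpairs n"
  let ?M = "\<lambda>E. Pi\<^sub>M E (\<lambda>_::nat option set. uniform01)"
  have IJ: "?I \<union> ?J = vpairs k"
    using vset_mono[OF n] unfolding vpairs_def by blast
  \<comment> \<open>\<open>B e\<close> is the constraint on the variable of the pair
    \<open>e\<close>: a ray above the value of \<open>\<phi>\<close> if \<open>e\<close> joins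
    \<open>vset n\<close> to an outside point, everything otherwise. The outer event thereby becomes
    the rectangle \<open>Pi\<^sub>E ?J B\<close>.\<close>
  define B where "B e = {y. \<forall>v\<in>vset n. \<forall>j\<in>{n..<k}. e = {v, Some j} \<longrightarrow> \<phi> (rooted x0 x v) (x j) < y}" for e
  have J: "{v, Some j} \<in> ?J" if "v \<in> vset n" "j \<in> {n..<k}" for v j
  proof -
    have "{v, Some j} \<in> vpairs k" by (rule vpairsI) (use that vset_mono[OF n] in auto)
    moreover have "{v, Some j} \<notin> vpairs n"
    proof
      assume "{v, Some j} \<in> vpairs n"
      then have "{v, Some j} \<subseteq> vset n" by (rule vpairs_subset)
      with that show False by simp
    qed
    ultimately show ?thesis by simp
  qed
  \<comment> \<open>One end lies in \<open>vset n\<close> and the other does not, so the unordered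
    pair reveals which end is which.\<close>
  have uniq: "v = v' \<and> j = j'" if "{v, Some j} = {v', Some j'}" "v \<in> vset n" "v' \<in> vset n" "n \<le> j" "n \<le> j'" for v v' j j'
    using that by (auto simp: doubleton_eq_iff)
  have B_edge: "B {v, Some j} = {\<phi> (rooted x0 x v) (x j)<..}" if "v \<in> vset n" "j \<in> {n..<k}" for v j
  proof (intro equalityI subsetI)
    fix y assume "y \<in> B {v, Some j}"
    then show "y \<in> {\<phi> (rooted x0 x v) (x j)<..}" using that unfolding B_def by blast
  next
    fix y assume y: "y \<in> {\<phi> (rooted x0 x v) (x j)<..}"
    show "y \<in> B {v, Some j}"
      unfolding B_def
    proof (intro CollectI ballI impI)
      fix v' j' assume "v' \<in> vset n" "j' \<in> {n..<k}" "{v, Some j} = {v', Some j'}"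
      then have "v = v' \<and> j = j'" using that by (intro uniq) auto
      then show "\<phi> (rooted x0 x v') (x j') < y" using y by simp
    qed
  qed
  let ?E = "(\<lambda>(j, v). {v, Some j}) ` ({n..<k} \<times> vset n)"
  have B_other: "B e = UNIV" if "e \<notin> ?E" for e
    using that unfolding B_def by auto
  have B_sets: "B e \<in> sets uniform01" for e
    using B_other[of e] B_edge by (cases "e \<in> ?E") auto
  let ?A = "\<lambda>m. {u \<in> space (?M (vpairs m)). component \<phi> (rooted x0 x) (vset m) u None = vset n}"
  have A: "?A n \<in> sets (?M ?I)" "?A k \<in> sets (?M (?I \<union> ?J))"
    unfolding IJ by (rule component_event_sets[OF \<phi> vpairsI]; assumption)+
  have split: "indicator (?A k) (merge ?I ?J (u, u')) = (indicator (?A n) u * indicator (Pi\<^sub>E ?J B) u' :: ennreal)"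
    if u: "u \<in> space (?M ?I)" "u' \<in> space (?M ?J)" for u u'
  proof -
    let ?u = "merge ?I ?J (u, u')"
    have "?u \<in> space (?M (vpairs k))"
      using measurable_space[OF measurable_merge[of ?I ?J "\<lambda>_. uniform01"], of "(u, u')"] u
      unfolding IJ by (simp add: space_pair_measure)
    then have "?u \<in> ?A k \<longleftrightarrow> component \<phi> (rooted x0 x) (vset n) ?u None = vset n \<and>
        (\<forall>v\<in>vset n. \<forall>w\<in>vset k - vset n. \<not> ?u {v, w} \<le> \<phi> (rooted x0 x v) (rooted x0 x w))"
      using component_restrict_iff[OF vset_mono[OF n], of None \<phi> "rooted x0 x" ?u] by simp
    also have "component \<phi> (rooted x0 x) (vset n) ?u None = component \<phi> (rooted x0 x) (vset n) u None"
      by (rule component_cong) (auto simp: vpairsI merge_def)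
    also have "(\<forall>v\<in>vset n. \<forall>w\<in>vset k - vset n. \<not> ?u {v, w} \<le> \<phi> (rooted x0 x v) (rooted x0 x w))
      \<longleftrightarrow> (\<forall>v\<in>vset n. \<forall>j\<in>{n..<k}. \<phi> (rooted x0 x v) (x j) < ?u {v, Some j})"
    proof -
      have "vset k - vset n = Some ` {n..<k}" by (auto simp: vset_def image_iff)
      then show ?thesis by (simp add: not_le)
    qed
    also have "\<dots> \<longleftrightarrow> (\<forall>v\<in>vset n. \<forall>j\<in>{n..<k}. \<phi> (rooted x0 x v) (x j) < u' {v, Some j})"
    proof -
      have "?u {v, Some j} = u' {v, Some j}" if "v \<in> vset n" "j \<in> {n..<k}" for v j
        using J[OF that] by (simp add: merge_def)
      then show ?thesis by simp
    qed
    also have "\<dots> \<longleftrightarrow> (\<forall>e\<in>?J. u' e \<in> B e)"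
      using J unfolding B_def by blast
    also have "\<dots> \<longleftrightarrow> u' \<in> Pi\<^sub>E ?J B"
      using u(2) by (auto simp: space_PiM PiE_iff)
    finally show ?thesis using u(1) by (simp add: indicator_def)
  qed
  have PiB: "Pi\<^sub>E ?J B \<in> sets (?M ?J)"
    by (rule sets_PiM_I_finite) (use B_sets in auto)
  have "reach \<phi> x0 k n x = (\<integral>\<^sup>+u. indicator (?A k) u \<partial>?M (?I \<union> ?J))"
    unfolding reach_def nn_integral_indicator[OF A(2)] by (simp only: IJ)
  also have "\<dots> = (\<integral>\<^sup>+u. (\<integral>\<^sup>+u'. indicator (?A k) (merge ?I ?J (u, u')) \<partial>?M ?J) \<partial>?M ?I)"
    by (rule K.product_nn_integral_fold[OF _ _ _ borel_measurable_indicator[OF A(2)]]) auto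
  also have "\<dots> = (\<integral>\<^sup>+u. (\<integral>\<^sup>+u'. indicator (?A n) u * indicator (Pi\<^sub>E ?J B) u' \<partial>?M ?J) \<partial>?M ?I)"
    by (intro nn_integral_cong split)
  also have "\<dots> = (\<integral>\<^sup>+u. indicator (?A n) u * emeasure (?M ?J) (Pi\<^sub>E ?J B) \<partial>?M ?I)"
    by (simp only: nn_integral_cmult_indicator[OF PiB])
  also have "\<dots> = reach \<phi> x0 n n x * emeasure (?M ?J) (Pi\<^sub>E ?J B)"
    unfolding reach_def nn_integral_multc[OF borel_measurable_indicator[OF A(1)]]
      nn_integral_indicator[OF A(1)] ..
  also have "emeasure (?M ?J) (Pi\<^sub>E ?J B) = (\<Prod>e\<in>?J. emeasure uniform01 (B e))"
    by (rule K.emeasure_PiM) (use B_sets in auto)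
  also have "\<dots> = (\<Prod>e\<in>?E. emeasure uniform01 (B e))"
  proof (rule prod.mono_neutral_right)
    show "?E \<subseteq> ?J" using J by auto
    show "\<forall>e\<in>?J - ?E. emeasure uniform01 (B e) = 1"
      using B_other prob_space.emeasure_space_1[OF prob_space_uniform01] by simp
  qed simp
  also have "\<dots> = (\<Prod>(j, v)\<in>{n..<k} \<times> vset n. emeasure uniform01 (B {v, Some j}))"
  proof -
    have "inj_on (\<lambda>(j, v). {v, Some j}) ({n..<k} \<times> vset n)"
    proof (rule inj_onI)
      fix p q assume pq: "p \<in> {n..<k} \<times> vset n" "q \<in> {n..<k} \<times> vset n"
        "(case p of (j, v) \<Rightarrow> {v, Some j}) = (case q of (j, v) \<Rightarrow> {v, Some j})"
      obtain j v j' v' where "p = (j, v)" "q = (j', v')" by fastforce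
      with pq uniq[of v j v' j'] show "p = q" by simp
    qed
    then show ?thesis
      by (subst prod.reindex, assumption) (auto intro!: prod.cong)
  qed
  also have "\<dots> = (\<Prod>(j, v)\<in>{n..<k} \<times> vset n. ennreal (1 - \<phi> (rooted x0 x v) (x j)))"
  proof (rule prod.cong[OF refl])
    fix p assume "p \<in> {n..<k} \<times> vset n"
    then obtain j v where "p = (j, v)" "j \<in> {n..<k}" "v \<in> vset n" by blast
    then show "(case p of (j, v) \<Rightarrow> emeasure uniform01 (B {v, Some j})) =
        (case p of (j, v) \<Rightarrow> ennreal (1 - \<phi> (rooted x0 x v) (x j)))"
      by (simp only: prod.case B_edge emeasure_uniform01_greaterThan[OF bounds])
  qed
  also have "\<dots> = (\<Prod>j\<in>{n..<k}. \<Prod>v\<in>vset n. ennreal (1 - \<phi> (rooted x0 x v) (x j)))"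
    by (simp add: prod.cartesian_product)
  finally show ?thesis .
qed

lemma reach_measurable:
  assumes \<phi>: "(\<lambda>(x, y). \<phi> x y) \<in> borel_measurable (N \<Otimes>\<^sub>M N)" "space N = UNIV"
  shows "reach \<phi> x0 k n \<in> borel_measurable (Pi\<^sub>M {..<k} (\<lambda>_. N))"
proof -
  let ?P = "Pi\<^sub>M (vpairs k) (\<lambda>_. uniform01)" and ?X = "Pi\<^sub>M {..<k} (\<lambda>_. N)"
  interpret K: prob_space ?P by (intro prob_space_PiM prob_space_uniform01)
  have "{z \<in> space (?X \<Otimes>\<^sub>M ?P). component \<phi> (rooted x0 (fst z)) (vset k) (snd z) None = vset n} \<in> sets (?X \<Otimes>\<^sub>M ?P)"
  proof (rule component_eq_measurable[where ?V0.0="vset k" and N=N])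
    show "(\<lambda>z. rooted x0 (fst z) v) \<in> ?X \<Otimes>\<^sub>M ?P \<rightarrow>\<^sub>M N" if "v \<in> vset k" for v
    proof (cases v)
      case None then show ?thesis by (simp add: \<phi>)
    next
      case (Some i)
      then have "i \<in> {..<k}" using that by simp
      from measurable_compose[OF measurable_fst measurable_component_singleton[OF this]] Some
      show ?thesis by simp
    qed
    show "(\<lambda>z. snd z {v, w}) \<in> borel_measurable (?X \<Otimes>\<^sub>M ?P)" if "v \<in> vset k" "w \<in> vset k" "v \<noteq> w" for v w
      using measurable_compose[OF measurable_snd measurable_component_singleton[OF vpairsI[OF that], of "\<lambda>_. uniform01"]]
      by (simp add: measurable_cong_sets[OF refl sets_uniform01])
  qed (use \<phi> in auto)
  then have "{z \<in> space (?X \<Otimes>\<^sub>M ?P). snd z \<in> {u \<in> space ?P. component \<phi> (rooted x0 (fst z)) (vset k) u None = vset n}}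
      \<in> sets (?X \<Otimes>\<^sub>M ?P)"
    by (rule back_subst[of "\<lambda>S. S \<in> sets (?X \<Otimes>\<^sub>M ?P)"]) (auto simp: space_pair_measure)
  then show ?thesis
    unfolding reach_def by (intro K.measurable_emeasure) auto
qed

section \<open>The cluster in a window of finite volume\<close>

lemma reach_cong:
  assumes "\<And>i. i < k \<Longrightarrow> x i = y i"
  shows "reach \<phi> x0 k n x = reach \<phi> x0 k n y"
proof -
  have "component \<phi> (rooted x0 x) (vset k) u None = component \<phi> (rooted x0 y) (vset k) u None" for u
    by (rule component_cong) (auto simp: vset_def assms)
  then show ?thesis by (simp add: reach_def)
qed

lemma avoidance_measurable:
  assumes \<phi>: "(\<lambda>(x, y). \<phi> x y) \<in> borel_measurable (N \<Otimes>\<^sub>M N)" "space N = UNIV" and \<nu>: "sets \<nu> = sets N"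
  shows "(\<lambda>y. \<Prod>v\<in>vset n. ennreal (1 - \<phi> (rooted x0 x v) y)) \<in> borel_measurable \<nu>"
proof -
  have "(\<lambda>y. (\<lambda>(x, y). \<phi> x y) (z, y)) \<in> borel_measurable N" for z
    by (rule measurable_compose[OF measurable_Pair1' \<phi>(1)]) (simp add: \<phi>(2))
  then have "\<phi> z \<in> borel_measurable \<nu>" for z
    by (simp add: measurable_cong_sets[OF \<nu> refl])
  then show ?thesis by measurable
qed

text \<open>Given the positions of the cluster points, each of the other \<open>k - n\<close> points
  enters \<open>reach_factor\<close> through its own factor, all of the same form; integrating them
  out gives a power. These powers are the terms of the exponential series in
  \<open>no_ghost_sums\<close>.\<close>

lemma nn_integral_reach:
  assumes \<phi>: "(\<lambda>(x, y). \<phi> x y) \<in> borel_measurable (N \<Otimes>\<^sub>M N)" "space N = UNIV"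
    and bounds: "\<And>x y. 0 \<le> \<phi> x y" "\<And>x y. \<phi> x y \<le> 1" and n: "n \<le> k"
    and \<nu>: "sigma_finite_measure \<nu>" "sets \<nu> = sets N"
  shows "(\<integral>\<^sup>+x. reach \<phi> x0 k n x \<partial>Pi\<^sub>M {..<k} (\<lambda>_. \<nu>)) =
    (\<integral>\<^sup>+x. reach \<phi> x0 n n x * (\<integral>\<^sup>+y. (\<Prod>v\<in>vset n. ennreal (1 - \<phi> (rooted x0 x v) y)) \<partial>\<nu>) ^ (k - n)
      \<partial>Pi\<^sub>M {..<n} (\<lambda>_. \<nu>))"
proof -
  interpret sigma_finite_measure \<nu> by fact
  interpret product_sigma_finite "\<lambda>_. \<nu>" ..
  let ?I = "{..<n}" and ?J = "{n..<k}"
  have IJ: "?I \<union> ?J = {..<k}" "?I \<inter> ?J = {}" using n by auto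
  have sets_P: "sets (Pi\<^sub>M {..<k} (\<lambda>_. \<nu>)) = sets (Pi\<^sub>M {..<k} (\<lambda>_. N))"
    by (rule sets_PiM_cong) (simp_all add: \<nu>)
  have m: "reach \<phi> x0 k n \<in> borel_measurable (Pi\<^sub>M (?I \<union> ?J) (\<lambda>_. \<nu>))"
    using reach_measurable[OF \<phi>] unfolding IJ(1) measurable_cong_sets[OF sets_P refl] .
  let ?h = "\<lambda>x y. \<Prod>v\<in>vset n. ennreal (1 - \<phi> (rooted x0 x v) y)"
  have h: "?h x \<in> borel_measurable \<nu>" for x
    by (rule avoidance_measurable[OF \<phi> \<nu>(2)])
  have "(\<integral>\<^sup>+x. reach \<phi> x0 k n x \<partial>Pi\<^sub>M {..<k} (\<lambda>_. \<nu>)) =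
    (\<integral>\<^sup>+x. (\<integral>\<^sup>+y. reach \<phi> x0 k n (merge ?I ?J (x, y)) \<partial>Pi\<^sub>M ?J (\<lambda>_. \<nu>)) \<partial>Pi\<^sub>M ?I (\<lambda>_. \<nu>))"
    using product_nn_integral_fold[OF IJ(2) _ _ m] unfolding IJ(1) by simp
  also have "\<dots> = (\<integral>\<^sup>+x. (\<integral>\<^sup>+y. reach \<phi> x0 n n x * (\<Prod>j\<in>?J. ?h x (y j)) \<partial>Pi\<^sub>M ?J (\<lambda>_. \<nu>)) \<partial>Pi\<^sub>M ?I (\<lambda>_. \<nu>))"
  proof (intro nn_integral_cong)
    fix x y :: "nat \<Rightarrow> 'a"
    let ?z = "merge ?I ?J (x, y)"
    have "reach \<phi> x0 n n ?z = reach \<phi> x0 n n x"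
      by (rule reach_cong) (simp add: merge_def)
    moreover have "rooted x0 ?z v = rooted x0 x v" if "v \<in> vset n" for v
      using that by (auto simp: vset_def merge_def)
    moreover have "?z j = y j" if "j \<in> ?J" for j
      using that by (simp add: merge_def)
    ultimately show "reach \<phi> x0 k n ?z = reach \<phi> x0 n n x * (\<Prod>j\<in>?J. ?h x (y j))"
      unfolding reach_factor[OF \<phi> bounds n] by (intro arg_cong2[where f="(*)"] prod.cong refl) simp_all
  qed
  also have "\<dots> = (\<integral>\<^sup>+x. reach \<phi> x0 n n x * (\<integral>\<^sup>+y. (\<Prod>j\<in>?J. ?h x (y j)) \<partial>Pi\<^sub>M ?J (\<lambda>_. \<nu>)) \<partial>Pi\<^sub>M ?I (\<lambda>_. \<nu>))"
  proof (intro nn_integral_cong nn_integral_cmult)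
    fix x
    show "(\<lambda>y. \<Prod>j\<in>?J. ?h x (y j)) \<in> borel_measurable (Pi\<^sub>M ?J (\<lambda>_. \<nu>))"
      by (rule borel_measurable_prod_ennreal, rule measurable_compose[OF _ h], rule measurable_component_singleton)
  qed
  also have "\<dots> = (\<integral>\<^sup>+x. reach \<phi> x0 n n x * (\<integral>\<^sup>+y. ?h x y \<partial>\<nu>) ^ (k - n) \<partial>Pi\<^sub>M ?I (\<lambda>_. \<nu>))"
    by (intro nn_integral_cong, subst product_nn_integral_prod) (simp_all add: h)
  finally show ?thesis .
qed

lemma emeasure_label_space:
  assumes "finite F" "0 \<le> \<gamma>" "\<gamma> \<le> 1"
  shows "emeasure label_space {l \<in> space label_space. \<forall>w\<in>F. \<gamma> < l w} = ennreal (1 - \<gamma>) ^ card F"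
proof -
  interpret K: product_prob_space "\<lambda>_::nat option. uniform01" UNIV by (rule product_prob_space_uniform01)
  have "emeasure label_space {l \<in> space label_space. \<forall>w\<in>F. l w \<in> {\<gamma><..}} = (\<Prod>w\<in>F. emeasure uniform01 {\<gamma><..})"
    unfolding label_space_def by (rule K.emeasure_PiM_Collect) (use assms in auto)
  then show ?thesis using assms by (simp add: emeasure_uniform01_greaterThan)
qed

lemma pair_space_prob: "prob_space pair_space"
  unfolding pair_space_def by (intro prob_space_PiM prob_space_uniform01)

lemma label_space_prob: "prob_space label_space"
  unfolding label_space_def by (intro prob_space_PiM prob_space_uniform01)

lemma pair_space_component_measurable:
  assumes "v \<noteq> w"
  shows "(\<lambda>u. u {v, w}) \<in> borel_measurable pair_space"
proof -
  have "{v, w} \<in> {{v, w} | v w. v \<noteq> w}" using assms by blast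
  from measurable_component_singleton[OF this, of "\<lambda>_. uniform01"] show ?thesis
    unfolding pair_space_def measurable_cong_sets[OF refl sets_uniform01] .
qed

lemma label_space_component_measurable: "(\<lambda>l. l w) \<in> borel_measurable label_space"
  unfolding label_space_def
  using measurable_component_singleton[of w UNIV "\<lambda>_. uniform01"]
  by (simp add: measurable_cong_sets[OF refl sets_uniform01])

text \<open>The map \<open>f\<close> is there to make diagonals null. The sites consist of a
  location and a mark whose law may have atoms, so distinctness is tested on a coordinate with null
  level sets; the application takes \<open>fst\<close>.\<close>

locale poisson_window =
  fixes \<phi> :: "'x \<Rightarrow> 'x \<Rightarrow> real" and \<Omega> :: "'w measure" and \<kappa> :: "'w \<Rightarrow> enat" and X :: "nat \<Rightarrow> 'w \<Rightarrow> 'x"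
    and \<mu> :: "'x measure" and x0 :: 'x and \<Lambda> :: "'x set" and f :: "'x \<Rightarrow> 'b::{second_countable_topology, metric_space}"
  assumes \<phi>: "(\<lambda>(x, y). \<phi> x y) \<in> borel_measurable (\<mu> \<Otimes>\<^sub>M \<mu>)" "space \<mu> = UNIV"
    and bounds: "\<And>x y. 0 \<le> \<phi> x y" "\<And>x y. \<phi> x y \<le> 1"
    and P: "poisson_process \<Omega> \<kappa> X \<mu>" and \<Lambda>: "\<Lambda> \<in> sets \<mu>" "emeasure \<mu> \<Lambda> < \<infinity>"
    and f: "f \<in> borel_measurable \<mu>" and null: "\<And>c. emeasure \<mu> {x \<in> space \<mu>. f x = c} = 0"
begin

sublocale prob_space \<Omega> by (rule poisson_process_prob_space[OF P])

sublocale pair: prob_space pair_space by (rule pair_space_prob)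

sublocale label: prob_space label_space by (rule label_space_prob)

sublocale pl: pair_prob_space pair_space label_space ..

sublocale mrcm: pair_prob_space \<Omega> "pair_space \<Otimes>\<^sub>M label_space" ..

definition wcluster :: "'w \<Rightarrow> (nat option set \<Rightarrow> real) \<Rightarrow> nat option set" where
  "wcluster \<omega> u = component \<phi> (site x0 X \<omega>) (insert None (Some ` points \<kappa> X \<Lambda> \<omega>)) u None"

definition no_ghost :: "real \<Rightarrow> ('w \<times> (nat option set \<Rightarrow> real) \<times> (nat option \<Rightarrow> real)) set" where
  "no_ghost \<gamma> = {p \<in> space (mrcm_space \<Omega>). \<forall>w\<in>wcluster (fst p) (fst (snd p)). \<gamma> < snd (snd p) w}"

lemma wcluster_subset: "wcluster \<omega> u \<subseteq> insert None (Some ` points \<kappa> X \<Lambda> \<omega>)"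
  unfolding wcluster_def by (rule component_subset) simp

lemma root_in_wcluster: "None \<in> wcluster \<omega> u"
  unfolding wcluster_def by (rule root_in_component)

lemma mrcm_measurable:
  shows "fst \<in> mrcm_space \<Omega> \<rightarrow>\<^sub>M \<Omega>" "(\<lambda>p. fst (snd p)) \<in> mrcm_space \<Omega> \<rightarrow>\<^sub>M pair_space"
    "(\<lambda>p. snd (snd p)) \<in> mrcm_space \<Omega> \<rightarrow>\<^sub>M label_space"
  unfolding mrcm_space_def by measurable

lemma label_event_sets: "{p \<in> space (mrcm_space \<Omega>). \<gamma> < snd (snd p) w} \<in> sets (mrcm_space \<Omega>)"
  using measurable_compose[OF mrcm_measurable(3) label_space_component_measurable, of w] by measurable

lemma points_event_sets: "{\<omega> \<in> space \<Omega>. i \<in> points \<kappa> X \<Lambda> \<omega>} \<in> sets \<Omega>"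
proof -
  note [measurable] = poisson_process_measurable[OF P] \<Lambda>(1)
  show ?thesis unfolding points_def by simp
qed

lemma site_measurable: "(\<lambda>\<omega>. site x0 X \<omega> v) \<in> \<Omega> \<rightarrow>\<^sub>M \<mu>"
  using poisson_process_measurable(2)[OF P] by (cases v) (simp_all add: site_def \<phi>(2))

lemma vertices_event_sets:
  "{p \<in> space (mrcm_space \<Omega>). v \<in> insert None (Some ` points \<kappa> X \<Lambda> (fst p))} \<in> sets (mrcm_space \<Omega>)"
proof (cases v)
  case (Some i)
  have "{p \<in> space (mrcm_space \<Omega>). v \<in> insert None (Some ` points \<kappa> X \<Lambda> (fst p))} =
    fst -` {\<omega> \<in> space \<Omega>. i \<in> points \<kappa> X \<Lambda> \<omega>} \<inter> space (mrcm_space \<Omega>)"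
    using Some measurable_space[OF mrcm_measurable(1)] by auto
  then show ?thesis using measurable_sets[OF mrcm_measurable(1) points_event_sets] by simp
qed simp

lemma wcluster_event_sets: "{p \<in> space (mrcm_space \<Omega>). w \<in> wcluster (fst p) (fst (snd p))} \<in> sets (mrcm_space \<Omega>)"
  unfolding wcluster_def
  by (rule component_measurable[where ?V0.0=UNIV, OF \<phi>(1)];
    rule subset_UNIV vertices_event_sets measurable_compose[OF mrcm_measurable(1) site_measurable]
      measurable_compose[OF mrcm_measurable(2) pair_space_component_measurable]; assumption?)

lemma wcluster_eq_event_sets: "{p \<in> space (mrcm_space \<Omega>). wcluster (fst p) (fst (snd p)) = W} \<in> sets (mrcm_space \<Omega>)"
  unfolding wcluster_def
  by (rule component_eq_measurable[where ?V0.0=UNIV, OF \<phi>(1)];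
    rule subset_UNIV vertices_event_sets measurable_compose[OF mrcm_measurable(1) site_measurable]
      measurable_compose[OF mrcm_measurable(2) pair_space_component_measurable]; assumption?)

lemma no_ghost_sets: "no_ghost \<gamma> \<in> sets (mrcm_space \<Omega>)"
proof -
  have "no_ghost \<gamma> = {p \<in> space (mrcm_space \<Omega>). \<forall>w. w \<in> wcluster (fst p) (fst (snd p)) \<longrightarrow> \<gamma> < snd (snd p) w}"
    unfolding no_ghost_def by auto
  also have "\<dots> \<in> sets (mrcm_space \<Omega>)"
    by (intro sets.sets_Collect_countable_All sets.sets_Collect_imp wcluster_event_sets label_event_sets)
  finally show ?thesis .
qed

definition sized :: "nat \<Rightarrow> nat \<Rightarrow> ('w \<times> (nat option set \<Rightarrow> real) \<times> (nat option \<Rightarrow> real)) set" where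
  "sized k n = {p \<in> space (mrcm_space \<Omega>). point_count \<kappa> X \<Lambda> (fst p) = of_nat k \<and>
     card (wcluster (fst p) (fst (snd p))) = Suc n}"

lemma finite_wcluster:
  assumes "point_count \<kappa> X \<Lambda> \<omega> = of_nat k"
  shows "finite (wcluster \<omega> u)" "card (wcluster \<omega> u) \<le> Suc k"
proof -
  have fin: "finite (insert None (Some ` points \<kappa> X \<Lambda> \<omega>))"
    and card: "card (insert None (Some ` points \<kappa> X \<Lambda> \<omega>)) = Suc k"
    using assms by (auto simp: point_count_eq_of_nat_iff card_image)
  show "finite (wcluster \<omega> u)" by (rule finite_subset[OF wcluster_subset fin])
  show "card (wcluster \<omega> u) \<le> Suc k" using card_mono[OF fin wcluster_subset] card by simp
qed

text \<open>Fixing the enumeration makes the demanded cluster a deterministic set of codes. Given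
  the points, the conditions on edges and on labels then form a rectangle, although in
  \<open>no_ghost\<close> the labels to be inspected depend on the edges.\<close>

definition exploration :: "real \<Rightarrow> nat \<Rightarrow> nat \<Rightarrow> (nat \<Rightarrow> nat) \<Rightarrow> ('w \<times> (nat option set \<Rightarrow> real) \<times> (nat option \<Rightarrow> real)) set" where
  "exploration \<gamma> k n \<sigma> = {p \<in> space (mrcm_space \<Omega>). enumerates \<kappa> X \<Lambda> k (fst p) \<sigma> \<and>
     wcluster (fst p) (fst (snd p)) = insert None (Some ` \<sigma> ` {..<n}) \<and>
     (\<forall>w\<in>insert None (Some ` \<sigma> ` {..<n}). \<gamma> < snd (snd p) w)}"

lemma exploration_sets: "exploration \<gamma> k n \<sigma> \<in> sets (mrcm_space \<Omega>)"
proof -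
  have "{p \<in> space (mrcm_space \<Omega>). enumerates \<kappa> X \<Lambda> k (fst p) \<sigma>} =
    fst -` {\<omega> \<in> space \<Omega>. enumerates \<kappa> X \<Lambda> k \<omega> \<sigma>} \<inter> space (mrcm_space \<Omega>)"
    using measurable_space[OF mrcm_measurable(1)] by auto
  then have 1: "{p \<in> space (mrcm_space \<Omega>). enumerates \<kappa> X \<Lambda> k (fst p) \<sigma>} \<in> sets (mrcm_space \<Omega>)"
    using measurable_sets[OF mrcm_measurable(1) enumerates_measurable[OF P \<Lambda>(1)]] by simp
  show ?thesis
    unfolding exploration_def
    by (intro sets.sets_Collect_conj 1 wcluster_eq_event_sets sets.sets_Collect_finite_All label_event_sets) simp
qed

text \<open>Fubini over the points: each section is a rectangle in edges and labels. Its edge side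
  has probability \<open>reach\<close> by relabelling, and its label side involves
  \<open>n + 1\<close> independent labels, since the root counts too.\<close>

lemma emeasure_exploration:
  assumes \<gamma>: "0 \<le> \<gamma>" "\<gamma> \<le> 1" and \<sigma>: "\<sigma> \<in> injections k" and n: "n \<le> k"
  shows "emeasure (mrcm_space \<Omega>) (exploration \<gamma> k n \<sigma>) = ennreal (1 - \<gamma>) ^ Suc n *
    (\<integral>\<^sup>+\<omega>. indicator {\<omega>. enumerates \<kappa> X \<Lambda> k \<omega> \<sigma>} \<omega> * reach \<phi> x0 k n (\<lambda>i\<in>{..<k}. X (\<sigma> i) \<omega>) \<partial>\<Omega>)"
proof -
  have inj: "inj_on \<sigma> {..<k}" using \<sigma> by (simp add: injections_def)
  let ?F = "insert None (Some ` \<sigma> ` {..<n})"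
  have F: "finite ?F" "card ?F = Suc n"
    using inj_on_subset[OF inj, of "{..<n}"] n by (auto simp: card_image)
  let ?B = "{l \<in> space label_space. \<forall>w\<in>?F. \<gamma> < l w}"
  have "emeasure (mrcm_space \<Omega>) (exploration \<gamma> k n \<sigma>) =
    (\<integral>\<^sup>+\<omega>. emeasure (pair_space \<Otimes>\<^sub>M label_space) (Pair \<omega> -` exploration \<gamma> k n \<sigma>) \<partial>\<Omega>)"
    unfolding mrcm_space_def
    by (rule pl.P.emeasure_pair_measure_alt) (use exploration_sets in \<open>simp add: mrcm_space_def\<close>)
  also have "\<dots> = (\<integral>\<^sup>+\<omega>. ennreal (1 - \<gamma>) ^ Suc n *
    (indicator {\<omega>. enumerates \<kappa> X \<Lambda> k \<omega> \<sigma>} \<omega> * reach \<phi> x0 k n (\<lambda>i\<in>{..<k}. X (\<sigma> i) \<omega>)) \<partial>\<Omega>)"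
  proof (rule nn_integral_cong)
    fix \<omega> assume \<omega>: "\<omega> \<in> space \<Omega>"
    show "emeasure (pair_space \<Otimes>\<^sub>M label_space) (Pair \<omega> -` exploration \<gamma> k n \<sigma>) = ennreal (1 - \<gamma>) ^ Suc n *
      (indicator {\<omega>. enumerates \<kappa> X \<Lambda> k \<omega> \<sigma>} \<omega> * reach \<phi> x0 k n (\<lambda>i\<in>{..<k}. X (\<sigma> i) \<omega>))"
    proof (cases "enumerates \<kappa> X \<Lambda> k \<omega> \<sigma>")
      case False
      then have "Pair \<omega> -` exploration \<gamma> k n \<sigma> = {}" by (auto simp: exploration_def)
      with False show ?thesis by simp
    next
      case True
      have pts: "points \<kappa> X \<Lambda> \<omega> = \<sigma> ` {..<k}"
        using enumerates_bij_betw[OF \<sigma> True] by (simp add: bij_betw_def)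
      let ?A = "{u \<in> space pair_space. component \<phi> (site x0 X \<omega>) (insert None (Some ` \<sigma> ` {..<k})) u None = ?F}"
      have "Pair \<omega> -` exploration \<gamma> k n \<sigma> = ?A \<times> ?B"
      proof (rule set_eqI)
        fix q :: "(nat option set \<Rightarrow> real) \<times> (nat option \<Rightarrow> real)"
        obtain u l where q: "q = (u, l)" by (cases q)
        have "q \<in> Pair \<omega> -` exploration \<gamma> k n \<sigma> \<longleftrightarrow> u \<in> space pair_space \<and> l \<in> space label_space \<and>
            component \<phi> (site x0 X \<omega>) (insert None (Some ` \<sigma> ` {..<k})) u None = ?F \<and> (\<forall>w\<in>?F. \<gamma> < l w)"
          unfolding q exploration_def wcluster_def mrcm_space_def space_pair_measure vimage_def mem_Collect_eq
            fst_conv snd_conv pts mem_Times_iff using True \<omega> by simp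
        then show "q \<in> Pair \<omega> -` exploration \<gamma> k n \<sigma> \<longleftrightarrow> q \<in> ?A \<times> ?B"
          unfolding q by blast
      qed
      moreover have A: "?A \<in> sets pair_space"
        unfolding pair_space_def by (rule component_event_sets[OF \<phi>]) blast
      moreover have B: "?B \<in> sets label_space"
        using label_space_component_measurable by (intro sets.sets_Collect_finite_All F) simp
      ultimately have "emeasure (pair_space \<Otimes>\<^sub>M label_space) (Pair \<omega> -` exploration \<gamma> k n \<sigma>) =
        emeasure pair_space ?A * emeasure label_space ?B"
        by (simp add: label.emeasure_pair_measure_Times)
      also have "emeasure pair_space ?A = reach \<phi> x0 k n (\<lambda>i\<in>{..<k}. X (\<sigma> i) \<omega>)"
        by (rule reach_relabel[OF \<phi> inj n]) (simp_all add: site_def)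
      also have "emeasure label_space ?B = ennreal (1 - \<gamma>) ^ Suc n"
        using emeasure_label_space[OF F(1) \<gamma>] F(2) by simp
      finally have eq: "emeasure (pair_space \<Otimes>\<^sub>M label_space) (Pair \<omega> -` exploration \<gamma> k n \<sigma>) =
        reach \<phi> x0 k n (\<lambda>i\<in>{..<k}. X (\<sigma> i) \<omega>) * ennreal (1 - \<gamma>) ^ Suc n" .
      have "indicator {\<omega>. enumerates \<kappa> X \<Lambda> k \<omega> \<sigma>} \<omega> = (1 :: ennreal)" using True by simp
      then show ?thesis unfolding eq by (simp only: mult_1 mult.commute)
    qed
  qed
  also have "\<dots> = ennreal (1 - \<gamma>) ^ Suc n *
    (\<integral>\<^sup>+\<omega>. indicator {\<omega>. enumerates \<kappa> X \<Lambda> k \<omega> \<sigma>} \<omega> * reach \<phi> x0 k n (\<lambda>i\<in>{..<k}. X (\<sigma> i) \<omega>) \<partial>\<Omega>)"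
  proof (rule nn_integral_cmult)
    have "(\<lambda>\<omega>. \<lambda>i\<in>{..<k}. X (\<sigma> i) \<omega>) \<in> \<Omega> \<rightarrow>\<^sub>M Pi\<^sub>M {..<k} (\<lambda>_. \<mu>)"
      using poisson_process_measurable(2)[OF P] by (intro measurable_restrict)
    from measurable_compose[OF this reach_measurable[OF \<phi>]]
    have r: "(\<lambda>\<omega>. reach \<phi> x0 k n (\<lambda>i\<in>{..<k}. X (\<sigma> i) \<omega>)) \<in> borel_measurable \<Omega>" .
    have "indicator {\<omega>. enumerates \<kappa> X \<Lambda> k \<omega> \<sigma>} \<in> borel_measurable \<Omega>"
      using borel_measurable_indicator[OF enumerates_measurable[OF P \<Lambda>(1), of k \<sigma>]]
      by (rule measurable_cong[THEN iffD1, rotated]) (simp add: indicator_def)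
    then show "(\<lambda>\<omega>. indicator {\<omega>. enumerates \<kappa> X \<Lambda> k \<omega> \<sigma>} \<omega> * reach \<phi> x0 k n (\<lambda>i\<in>{..<k}. X (\<sigma> i) \<omega>)) \<in> borel_measurable \<Omega>"
      using r by (rule borel_measurable_times_ennreal)
  qed
  finally show ?thesis .
qed

text \<open>A cluster with \<open>n\<close> of the \<open>k\<close> points is listed first by \<open>n! (k - n)!\<close> enumerations of these points.\<close>

lemma injections_of_cluster:
  assumes n: "n \<le> k" and p: "p \<in> space (mrcm_space \<Omega>)"
  shows "emeasure (count_space (injections k)) {\<sigma> \<in> injections k. p \<in> exploration \<gamma> k n \<sigma>} =
    of_nat (fact n * fact (k - n)) * indicator (sized k n \<inter> no_ghost \<gamma>) p"
proof -
  let ?\<omega> = "fst p" and ?C = "wcluster (fst p) (fst (snd p))"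
  let ?S = "points \<kappa> X \<Lambda> ?\<omega>" and ?T = "{i. Some i \<in> ?C}"
  let ?E = "{\<sigma> \<in> injections k. p \<in> exploration \<gamma> k n \<sigma>}"
  have C: "?C = insert None (Some ` ?T)"
  proof (rule set_eqI)
    fix v show "v \<in> ?C \<longleftrightarrow> v \<in> insert None (Some ` ?T)"
      using root_in_wcluster by (cases v) auto
  qed
  have T: "insert None (Some ` A) = insert None (Some ` ?T) \<longleftrightarrow> A = ?T" for A by auto
  show ?thesis
  proof (cases "p \<in> sized k n \<inter> no_ghost \<gamma>")
    case True
    then have N: "point_count \<kappa> X \<Lambda> ?\<omega> = of_nat k" and card: "card ?C = Suc n"
      and ng: "\<forall>w\<in>?C. \<gamma> < snd (snd p) w"
      by (auto simp: sized_def no_ghost_def)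
    have S: "finite ?S" "card ?S = k" using N by (auto simp: point_count_eq_of_nat_iff)
    have TS: "?T \<subseteq> ?S" using wcluster_subset by blast
    have "finite ?T" by (rule finite_subset[OF TS S(1)])
    then have "card (insert None (Some ` ?T)) = Suc (card ?T)" by (simp add: card_image)
    then have cT: "card ?T = n" using card C by simp
    have "?E = {\<sigma> \<in> injections k. \<sigma> ` {..<k} \<subseteq> ?S \<and> \<sigma> ` {..<n} = ?T}"
    proof (rule Collect_cong, rule conj_cong[OF refl])
      fix \<sigma>
      have "p \<in> exploration \<gamma> k n \<sigma> \<longleftrightarrow> \<sigma> ` {..<k} \<subseteq> ?S \<and> ?C = insert None (Some ` \<sigma> ` {..<n})"
      proof
        assume "p \<in> exploration \<gamma> k n \<sigma>"
        then show "\<sigma> ` {..<k} \<subseteq> ?S \<and> ?C = insert None (Some ` \<sigma> ` {..<n})"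
          unfolding exploration_def enumerates_def mem_Collect_eq by (elim conjE) (rule conjI)
      next
        assume A: "\<sigma> ` {..<k} \<subseteq> ?S \<and> ?C = insert None (Some ` \<sigma> ` {..<n})"
        then have "\<forall>w\<in>insert None (Some ` \<sigma> ` {..<n}). \<gamma> < snd (snd p) w" using ng by metis
        with A p N show "p \<in> exploration \<gamma> k n \<sigma>"
          unfolding exploration_def enumerates_def mem_Collect_eq by (elim conjE) (intro conjI)
      qed
      then show "p \<in> exploration \<gamma> k n \<sigma> \<longleftrightarrow> \<sigma> ` {..<k} \<subseteq> ?S \<and> \<sigma> ` {..<n} = ?T"
        unfolding T[of "\<sigma> ` {..<n}", symmetric] C[symmetric] by (simp only: eq_commute)
    qed
    moreover have "finite {\<sigma> \<in> injections k. \<sigma> ` {..<k} \<subseteq> ?S \<and> \<sigma> ` {..<n} = ?T}"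
      by (rule finite_subset[OF _ finite_injections_into[OF S(1), of k]]) blast
    ultimately have "emeasure (count_space (injections k)) ?E =
        of_nat (card {\<sigma> \<in> injections k. \<sigma> ` {..<k} \<subseteq> ?S \<and> \<sigma> ` {..<n} = ?T})"
      by (simp only:) (rule emeasure_count_space_finite; blast)
    then show ?thesis
      using True unfolding card_injections_with_initial_image[OF S TS cT] by simp
  next
    case False
    have "?E = {}"
    proof (rule ccontr)
      assume "?E \<noteq> {}"
      then obtain \<sigma> where \<sigma>: "\<sigma> \<in> injections k" "p \<in> exploration \<gamma> k n \<sigma>" by blast
      then have "inj_on \<sigma> {..<n}"
        using inj_on_subset[of \<sigma> "{..<k}" "{..<n}"] n by (auto simp: injections_def)
      then have "card (insert None (Some ` \<sigma> ` {..<n})) = Suc n" by (simp add: card_image)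
      then have "p \<in> sized k n \<inter> no_ghost \<gamma>"
        using \<sigma>(2) unfolding exploration_def sized_def no_ghost_def enumerates_def by simp
      with False show False by simp
    qed
    then show ?thesis using False by (simp only:) simp
  qed
qed

lemma sized_sets: "sized k n \<in> sets (mrcm_space \<Omega>)"
proof -
  note [measurable] = poisson_process_count_measurable[OF P \<Lambda>(1)] mrcm_measurable(1)
  have 1: "{p \<in> space (mrcm_space \<Omega>). point_count \<kappa> X \<Lambda> (fst p) = of_nat k} \<in> sets (mrcm_space \<Omega>)"
    by measurable
  \<comment> \<open>Only a finite set has cardinality \<open>Suc n\<close>, and there are countably
    many finite sets of codes; so the event is a countable union over the possible clusters.\<close>
  have "sized k n = (\<Union>W\<in>{W. finite W \<and> card W = Suc n}. {p \<in> space (mrcm_space \<Omega>). wcluster (fst p) (fst (snd p)) = W}) \<inter>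
     {p \<in> space (mrcm_space \<Omega>). point_count \<kappa> X \<Lambda> (fst p) = of_nat k}"
    unfolding sized_def using card_ge_0_finite[of "wcluster _ _"] by fastforce
  also have "\<dots> \<in> sets (mrcm_space \<Omega>)"
  proof (intro sets.Int 1 sets.countable_UN')
    show "countable {W :: nat option set. finite W \<and> card W = Suc n}"
      by (rule countable_subset[OF _ countable_Collect_finite]) auto
  qed (use wcluster_eq_event_sets in auto)
  finally show ?thesis .
qed

text \<open>Double counting: the sum over enumerations of the \<open>exploration\<close> events
  counts each configuration \<open>fact n * fact (k - n)\<close> times. Evaluated term by term, the
  same sum is an integral over positions by \<open>janossy_formula\<close>. The factorials are
  divided out only in \<open>no_ghost_sums\<close>.\<close>

lemma emeasure_sized:
  assumes \<gamma>: "0 \<le> \<gamma>" "\<gamma> \<le> 1" and n: "n \<le> k"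
  shows "of_nat (fact n * fact (k - n)) * emeasure (mrcm_space \<Omega>) (sized k n \<inter> no_ghost \<gamma>) =
    ennreal (1 - \<gamma>) ^ Suc n * (ennreal (exp (- measure \<mu> \<Lambda>)) *
      (\<integral>\<^sup>+x. reach \<phi> x0 k n x \<partial>Pi\<^sub>M {..<k} (\<lambda>_. density \<mu> (indicator \<Lambda>))))"
proof -
  have H: "sized k n \<inter> no_ghost \<gamma> \<in> sets (mrcm_space \<Omega>)"
    by (intro sets.Int sized_sets no_ghost_sets)
  have "of_nat (fact n * fact (k - n)) * emeasure (mrcm_space \<Omega>) (sized k n \<inter> no_ghost \<gamma>) =
    (\<integral>\<^sup>+p. of_nat (fact n * fact (k - n)) * indicator (sized k n \<inter> no_ghost \<gamma>) p \<partial>mrcm_space \<Omega>)"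
    by (rule nn_integral_cmult_indicator[symmetric, OF H])
  also have "\<dots> = (\<integral>\<^sup>+p. (\<integral>\<^sup>+\<sigma>. indicator (exploration \<gamma> k n \<sigma>) p \<partial>count_space (injections k)) \<partial>mrcm_space \<Omega>)"
  proof (rule nn_integral_cong)
    fix p assume p: "p \<in> space (mrcm_space \<Omega>)"
    have "(\<integral>\<^sup>+\<sigma>. indicator (exploration \<gamma> k n \<sigma>) p \<partial>count_space (injections k)) =
      (\<integral>\<^sup>+\<sigma>. indicator {\<sigma> \<in> injections k. p \<in> exploration \<gamma> k n \<sigma>} \<sigma> \<partial>count_space (injections k))"
      by (rule nn_integral_cong) (simp add: indicator_def)
    also have "\<dots> = emeasure (count_space (injections k)) {\<sigma> \<in> injections k. p \<in> exploration \<gamma> k n \<sigma>}"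
      by (rule nn_integral_indicator) auto
    finally show "of_nat (fact n * fact (k - n)) * indicator (sized k n \<inter> no_ghost \<gamma>) p =
      (\<integral>\<^sup>+\<sigma>. indicator (exploration \<gamma> k n \<sigma>) p \<partial>count_space (injections k))"
      unfolding injections_of_cluster[OF n p] ..
  qed
  also have "\<dots> = (\<integral>\<^sup>+\<sigma>. (\<integral>\<^sup>+p. indicator (exploration \<gamma> k n \<sigma>) p \<partial>mrcm_space \<Omega>) \<partial>count_space (injections k))"
    by (rule nn_integral_count_space_nn_integral[OF countable_injections borel_measurable_indicator[OF exploration_sets]])
  also have "\<dots> = (\<integral>\<^sup>+\<sigma>. ennreal (1 - \<gamma>) ^ Suc n *
    (\<integral>\<^sup>+\<omega>. indicator {\<omega>. enumerates \<kappa> X \<Lambda> k \<omega> \<sigma>} \<omega> * reach \<phi> x0 k n (\<lambda>i\<in>{..<k}. X (\<sigma> i) \<omega>) \<partial>\<Omega>)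
      \<partial>count_space (injections k))"
    unfolding nn_integral_indicator[OF exploration_sets]
    by (rule nn_integral_cong) (use emeasure_exploration[OF \<gamma> _ n] in simp)
  also have "\<dots> = ennreal (1 - \<gamma>) ^ Suc n * (\<integral>\<^sup>+\<sigma>.
    (\<integral>\<^sup>+\<omega>. indicator {\<omega>. enumerates \<kappa> X \<Lambda> k \<omega> \<sigma>} \<omega> * reach \<phi> x0 k n (\<lambda>i\<in>{..<k}. X (\<sigma> i) \<omega>) \<partial>\<Omega>)
      \<partial>count_space (injections k))"
    by (rule nn_integral_cmult) simp
  also have "\<dots> = ennreal (1 - \<gamma>) ^ Suc n * (ennreal (exp (- measure \<mu> \<Lambda>)) *
      (\<integral>\<^sup>+x. reach \<phi> x0 k n x \<partial>Pi\<^sub>M {..<k} (\<lambda>_. density \<mu> (indicator \<Lambda>))))"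
    unfolding janossy_formula[OF P \<Lambda> f null reach_measurable[OF \<phi>]] ..
  finally show ?thesis .
qed

text \<open>Almost surely the window holds finitely many points, hence exactly one of the events
  \<open>sized\<close> occurs. Writing the number of points as \<open>n + j\<close>, with
  \<open>j\<close> points outside the cluster, replaces the constraint n \<le> k by two free
  indices.\<close>

lemma emeasure_no_ghost_eq_suminf:
  "emeasure (mrcm_space \<Omega>) (no_ghost \<gamma>) =
    (\<Sum>n. \<Sum>j. emeasure (mrcm_space \<Omega>) (sized (n + j) n \<inter> no_ghost \<gamma>))"
proof -
  have "AE \<omega> in distr (mrcm_space \<Omega>) \<Omega> fst. \<exists>k. point_count \<kappa> X \<Lambda> \<omega> = of_nat k"
    using poisson_process_AE_finite[OF P \<Lambda>] unfolding mrcm_space_def pl.distr_pair_fst .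
  then have AE: "AE p in mrcm_space \<Omega>. \<exists>k. point_count \<kappa> X \<Lambda> (fst p) = of_nat k"
    by (rule AE_distrD[OF mrcm_measurable(1)])
  have H: "sized k n \<inter> no_ghost \<gamma> \<in> sets (mrcm_space \<Omega>)" for k n
    by (intro sets.Int sized_sets no_ghost_sets)
  have ind: "indicator (no_ghost \<gamma>) p = (\<Sum>n. \<Sum>j. indicator (sized (n + j) n \<inter> no_ghost \<gamma>) p :: ennreal)"
    if "\<exists>k. point_count \<kappa> X \<Lambda> (fst p) = of_nat k" for p
  proof (cases "p \<in> no_ghost \<gamma>")
    case False then show ?thesis by simp
  next
    case True
    let ?C = "wcluster (fst p) (fst (snd p))"
    from that obtain k where k: "point_count \<kappa> X \<Lambda> (fst p) = of_nat k" ..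
    define n where "n = card ?C - 1"
    have "card ?C > 0"
      using finite_wcluster(1)[OF k] root_in_wcluster by (metis card_gt_0_iff empty_iff)
    then have n: "card ?C = Suc n" "n \<le> k"
      using finite_wcluster(2)[OF k, of "fst (snd p)"] by (auto simp: n_def)
    have mem: "p \<in> sized (m + j) m \<inter> no_ghost \<gamma> \<longleftrightarrow> m = n \<and> j = k - n" for m j
    proof -
      have "p \<in> sized (m + j) m \<longleftrightarrow> m + j = k \<and> m = n"
        using True k n unfolding sized_def no_ghost_def by (auto simp del: of_nat_add)
      then show ?thesis using True n by auto
    qed
    have "(\<Sum>j. indicator (sized (m + j) m \<inter> no_ghost \<gamma>) p :: ennreal) = (if m = n then 1 else 0)" for m
    proof -
      have "(\<lambda>j. if j = k - n then (if m = n then 1 else 0) else 0 :: ennreal) sums (if m = n then 1 else 0)"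
        by (rule sums_single)
      moreover have "(\<lambda>j. if j = k - n then (if m = n then 1 else 0) else 0 :: ennreal) =
          (\<lambda>j. indicator (sized (m + j) m \<inter> no_ghost \<gamma>) p)"
        unfolding indicator_def mem by auto
      ultimately have "(\<lambda>j. indicator (sized (m + j) m \<inter> no_ghost \<gamma>) p :: ennreal) sums (if m = n then 1 else 0)"
        by (simp only:)
      then show ?thesis by (rule sums_unique[symmetric])
    qed
    moreover have "(\<Sum>m. if m = n then 1 else 0 :: ennreal) = 1"
      using sums_single[of n "\<lambda>_. 1"] by (rule sums_unique[symmetric])
    ultimately show ?thesis using True by (simp only: indicator_simps)
  qed
  have "emeasure (mrcm_space \<Omega>) (no_ghost \<gamma>) = (\<integral>\<^sup>+p. indicator (no_ghost \<gamma>) p \<partial>mrcm_space \<Omega>)"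
    by (rule nn_integral_indicator[symmetric, OF no_ghost_sets])
  also have "\<dots> = (\<integral>\<^sup>+p. (\<Sum>n. \<Sum>j. indicator (sized (n + j) n \<inter> no_ghost \<gamma>) p) \<partial>mrcm_space \<Omega>)"
    by (rule nn_integral_cong_AE, rule AE_mp[OF AE], rule AE_I2) (use ind in blast)
  also have "\<dots> = (\<Sum>n. \<integral>\<^sup>+p. (\<Sum>j. indicator (sized (n + j) n \<inter> no_ghost \<gamma>) p) \<partial>mrcm_space \<Omega>)"
  proof (rule nn_integral_suminf)
    note [measurable] = H
    show "(\<lambda>p. \<Sum>j. indicator (sized (n + j) n \<inter> no_ghost \<gamma>) p :: ennreal) \<in> borel_measurable (mrcm_space \<Omega>)" for n
      by measurable
  qed
  also have "\<dots> = (\<Sum>n. \<Sum>j. \<integral>\<^sup>+p. indicator (sized (n + j) n \<inter> no_ghost \<gamma>) p \<partial>mrcm_space \<Omega>)"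
    by (intro suminf_cong nn_integral_suminf borel_measurable_indicator H)
  also have "\<dots> = (\<Sum>n. \<Sum>j. emeasure (mrcm_space \<Omega>) (sized (n + j) n \<inter> no_ghost \<gamma>))"
    by (simp only: nn_integral_indicator[OF H])
  finally show ?thesis .
qed

end

section \<open>Making the dependence on the intensity explicit\<close>

lemma PiM_scale_measure:
  assumes "finite_measure \<nu>" "finite I" "c < \<infinity>"
  shows "Pi\<^sub>M I (\<lambda>_. scale_measure c \<nu>) = scale_measure (c ^ card I) (Pi\<^sub>M I (\<lambda>_. \<nu>))"
proof -
  interpret \<nu>: finite_measure \<nu> by fact
  have "finite_measure (scale_measure c \<nu>)"
    using assms(3) \<nu>.emeasure_finite[of "space \<nu>"]
    by (intro finite_measureI) (simp add: space_scale_measure ennreal_mult_eq_top_iff)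
  then interpret c\<nu>: finite_measure "scale_measure c \<nu>" .
  interpret c\<nu>: product_sigma_finite "\<lambda>_. scale_measure c \<nu>" ..
  interpret \<nu>: product_sigma_finite "\<lambda>_. \<nu>" ..
  show ?thesis
  proof (rule c\<nu>.PiM_eqI[symmetric])
    show "sets (scale_measure (c ^ card I) (Pi\<^sub>M I (\<lambda>_. \<nu>))) = sets (Pi\<^sub>M I (\<lambda>_. scale_measure c \<nu>))"
      unfolding sets_scale_measure by (rule sets_PiM_cong) simp_all
    fix A assume "\<And>i. i \<in> I \<Longrightarrow> A i \<in> sets (scale_measure c \<nu>)"
    then have "emeasure (Pi\<^sub>M I (\<lambda>_. \<nu>)) (Pi\<^sub>E I A) = (\<Prod>i\<in>I. emeasure \<nu> (A i))"
      using assms(2) by (intro \<nu>.emeasure_PiM) auto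
    then show "emeasure (scale_measure (c ^ card I) (Pi\<^sub>M I (\<lambda>_. \<nu>))) (Pi\<^sub>E I A) = (\<Prod>i\<in>I. emeasure (scale_measure c \<nu>) (A i))"
      by (simp add: prod.distrib)
  qed fact
qed

lemma density_scale_measure:
  assumes "\<Lambda> \<in> sets \<nu>"
  shows "density (scale_measure c \<nu>) (indicator \<Lambda>) = scale_measure c (density \<nu> (indicator \<Lambda>))"
proof (rule measure_eqI)
  fix A assume "A \<in> sets (density (scale_measure c \<nu>) (indicator \<Lambda>))"
  then have A: "A \<in> sets \<nu>" by simp
  have "emeasure (density (scale_measure c \<nu>) (indicator \<Lambda>)) A = emeasure (scale_measure c \<nu>) (\<Lambda> \<inter> A)"
    by (rule emeasure_restricted) (use A assms in simp_all)
  then show "emeasure (density (scale_measure c \<nu>) (indicator \<Lambda>)) A = emeasure (scale_measure c (density \<nu> (indicator \<Lambda>))) A"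
    by (simp add: emeasure_restricted[OF assms A])
qed simp

text \<open>The volume not attached to the root or to any of the \<open>n\<close> cluster points,
  averaged over the edges. If \<open>\<nu>\<close> is the volume restricted to the window, its
  complement in the total volume is the \<open>G\<^sub>n\<close> of the exponent.\<close>

definition avoid :: "('x \<Rightarrow> 'x \<Rightarrow> real) \<Rightarrow> 'x \<Rightarrow> 'x measure \<Rightarrow> nat \<Rightarrow> (nat \<Rightarrow> 'x) \<Rightarrow> real" where
  "avoid \<phi> x0 \<nu> n x = enn2real (\<integral>\<^sup>+y. (\<Prod>v\<in>vset n. ennreal (1 - \<phi> (rooted x0 x v) y)) \<partial>\<nu>)"

lemma ennreal_avoid:
  assumes "finite_measure \<nu>" "\<And>x y. 0 \<le> \<phi> x y" "\<And>x y. \<phi> x y \<le> 1"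
  shows "ennreal (avoid \<phi> x0 \<nu> n x) = (\<integral>\<^sup>+y. (\<Prod>v\<in>vset n. ennreal (1 - \<phi> (rooted x0 x v) y)) \<partial>\<nu>)"
    and "avoid \<phi> x0 \<nu> n x \<le> measure \<nu> (space \<nu>)"
proof -
  interpret finite_measure \<nu> by fact
  have "(\<integral>\<^sup>+y. (\<Prod>v\<in>vset n. ennreal (1 - \<phi> (rooted x0 x v) y)) \<partial>\<nu>) \<le> (\<integral>\<^sup>+y. 1 \<partial>\<nu>)"
    by (intro nn_integral_mono prod_le_1) (auto simp: assms)
  then have le: "(\<integral>\<^sup>+y. (\<Prod>v\<in>vset n. ennreal (1 - \<phi> (rooted x0 x v) y)) \<partial>\<nu>) \<le> ennreal (measure \<nu> (space \<nu>))"
    by (simp add: emeasure_eq_measure)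
  then have "(\<integral>\<^sup>+y. (\<Prod>v\<in>vset n. ennreal (1 - \<phi> (rooted x0 x v) y)) \<partial>\<nu>) < \<top>"
    by (rule le_less_trans) simp
  then show eq: "ennreal (avoid \<phi> x0 \<nu> n x) = (\<integral>\<^sup>+y. (\<Prod>v\<in>vset n. ennreal (1 - \<phi> (rooted x0 x v) y)) \<partial>\<nu>)"
    unfolding avoid_def by (rule ennreal_enn2real)
  show "avoid \<phi> x0 \<nu> n x \<le> measure \<nu> (space \<nu>)"
    using le unfolding eq[symmetric] by (simp add: ennreal_le_iff)
qed

lemma avoid_measurable:
  assumes \<phi>: "(\<lambda>(x, y). \<phi> x y) \<in> borel_measurable (N \<Otimes>\<^sub>M N)" "space N = UNIV"
    and \<nu>: "finite_measure \<nu>" "sets \<nu> = sets N"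
  shows "avoid \<phi> x0 \<nu> n \<in> borel_measurable (Pi\<^sub>M {..<n} (\<lambda>_. \<nu>))"
proof -
  interpret finite_measure \<nu> by fact
  let ?P = "Pi\<^sub>M {..<n} (\<lambda>_. \<nu>)"
  have "(\<lambda>z. \<phi> (rooted x0 (fst z) v) (snd z)) \<in> borel_measurable (?P \<Otimes>\<^sub>M \<nu>)" if v: "v \<in> vset n" for v
  proof -
    have "(\<lambda>z. rooted x0 (fst z) v) \<in> ?P \<Otimes>\<^sub>M \<nu> \<rightarrow>\<^sub>M N"
    proof (cases v)
      case None then show ?thesis by (simp add: \<phi>)
    next
      case (Some i)
      then have i: "i \<in> {..<n}" using v by simp
      have "(\<lambda>z. fst z i) \<in> ?P \<Otimes>\<^sub>M \<nu> \<rightarrow>\<^sub>M N"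
        using measurable_compose[OF measurable_fst[of ?P \<nu>] measurable_component_singleton[OF i]]
        by (simp add: measurable_cong_sets[OF refl \<nu>(2)])
      then show ?thesis by (simp add: Some)
    qed
    moreover have "snd \<in> ?P \<Otimes>\<^sub>M \<nu> \<rightarrow>\<^sub>M N"
      using measurable_snd[of ?P \<nu>] by (simp add: measurable_cong_sets[OF refl \<nu>(2)])
    ultimately show ?thesis
      using measurable_compose[OF measurable_Pair \<phi>(1)] by simp
  qed
  then have "(\<lambda>z. \<Prod>v\<in>vset n. ennreal (1 - \<phi> (rooted x0 (fst z) v) (snd z))) \<in> borel_measurable (?P \<Otimes>\<^sub>M \<nu>)"
    by (intro borel_measurable_prod_ennreal measurable_compose[OF _ measurable_ennreal] borel_measurable_diff) auto
  from borel_measurable_nn_integral_fst[OF this] show ?thesis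
    unfolding avoid_def by simp
qed

lemma reach_le_1: "reach \<phi> x0 k n x \<le> 1"
  unfolding reach_def by (intro prob_space.emeasure_le_1 prob_space_PiM prob_space_uniform01)

text \<open>This is \<open>\<rho>\<^sub>n\<close>. The factor \<open>1 / fact n\<close> passes from
  ordered tuples to sets of cluster points. Formed from the unscaled volume in the window, it does
  not contain the intensity.\<close>

definition cluster_measure :: "('x \<Rightarrow> 'x \<Rightarrow> real) \<Rightarrow> 'x \<Rightarrow> 'x measure \<Rightarrow> nat \<Rightarrow> (nat \<Rightarrow> 'x) measure" where
  "cluster_measure \<phi> x0 \<nu> n =
     density (Pi\<^sub>M {..<n} (\<lambda>_. \<nu>)) (\<lambda>x. ennreal (1 / fact n) * reach \<phi> x0 n n x)"

lemma reach_measurable':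
  assumes \<phi>: "(\<lambda>(x, y). \<phi> x y) \<in> borel_measurable (N \<Otimes>\<^sub>M N)" "space N = UNIV" and \<nu>: "sets \<nu> = sets N"
  shows "reach \<phi> x0 k n \<in> borel_measurable (Pi\<^sub>M {..<k} (\<lambda>_. \<nu>))"
proof -
  have "sets (Pi\<^sub>M {..<k} (\<lambda>_. \<nu>)) = sets (Pi\<^sub>M {..<k} (\<lambda>_. N))"
    by (rule sets_PiM_cong) (simp_all add: \<nu>)
  then show ?thesis
    using reach_measurable[OF \<phi>] measurable_cong_sets[OF _ refl] by blast
qed

lemma finite_cluster_measure:
  assumes \<phi>: "(\<lambda>(x, y). \<phi> x y) \<in> borel_measurable (N \<Otimes>\<^sub>M N)" "space N = UNIV"
    and \<nu>: "finite_measure \<nu>" "sets \<nu> = sets N"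
  shows "finite_measure (cluster_measure \<phi> x0 \<nu> n)"
proof -
  interpret finite_measure \<nu> by fact
  interpret product_sigma_finite "\<lambda>_. \<nu>" ..
  let ?P = "Pi\<^sub>M {..<n} (\<lambda>_. \<nu>)"
  have "emeasure (cluster_measure \<phi> x0 \<nu> n) (space ?P) = (\<integral>\<^sup>+x. ennreal (1 / fact n) * reach \<phi> x0 n n x * indicator (space ?P) x \<partial>?P)"
    unfolding cluster_measure_def
    by (intro emeasure_density borel_measurable_times_ennreal reach_measurable'[OF \<phi> \<nu>(2)]) auto
  also have "\<dots> \<le> (\<integral>\<^sup>+x. 1 \<partial>?P)"
  proof (rule nn_integral_mono)
    fix x
    have "ennreal (1 / fact n) * reach \<phi> x0 n n x * indicator (space ?P) x \<le> 1 * 1 * 1"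
      by (intro mult_mono reach_le_1) (auto simp: indicator_def fact_ge_1)
    then show "ennreal (1 / fact n) * reach \<phi> x0 n n x * indicator (space ?P) x \<le> 1" by simp
  qed
  also have "\<dots> = emeasure \<nu> (space \<nu>) ^ n"
    by (simp add: space_PiM emeasure_PiM)
  also have "\<dots> < \<infinity>"
    using emeasure_finite[of "space \<nu>"] by (simp add: power_eq_top_ennreal less_top[symmetric])
  finally show ?thesis
    by (intro finite_measureI) (simp add: cluster_measure_def)
qed

text \<open>For fixed \<open>n\<close>, sum over the number \<open>j\<close> of points outside the
  cluster. Each such point contributes the factor \<open>t\<close> times the avoided volume, the
  factorials turn these powers into an exponential series, and its product with the void factor of
  the window is the exponential of \<open>- t\<close> times the attached volume.\<close>

lemma no_ghost_sums:
  fixes f :: "'x \<Rightarrow> 'b::{second_countable_topology, metric_space}"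
  assumes win: "poisson_window \<phi> \<Omega> \<kappa> X (scale_measure (ennreal t) \<nu>) \<Lambda> f"
    and t: "0 \<le> t" and \<gamma>: "0 \<le> \<gamma>" "\<gamma> \<le> 1" and L: "\<Lambda> \<in> sets \<nu>" "emeasure \<nu> \<Lambda> < \<infinity>"
  defines "\<nu>\<Lambda> \<equiv> density \<nu> (indicator \<Lambda>)"
  shows "(\<lambda>n. (1 - \<gamma>) ^ Suc n * (t ^ n *
      (\<integral>x. exp (- t * (measure \<nu> \<Lambda> - avoid \<phi> x0 \<nu>\<Lambda> n x)) \<partial>cluster_measure \<phi> x0 \<nu>\<Lambda> n)))
    sums measure (mrcm_space \<Omega>) (poisson_window.no_ghost \<phi> \<Omega> \<kappa> X x0 \<Lambda> \<gamma>)"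
proof -
  interpret poisson_window \<phi> \<Omega> \<kappa> X "scale_measure (ennreal t) \<nu>" x0 \<Lambda> f by fact
  let ?\<mu> = "scale_measure (ennreal t) \<nu>" and ?V = "measure \<nu> \<Lambda>"
  have V: "emeasure \<nu> \<Lambda> = ennreal ?V"
    using L(2) by (intro emeasure_eq_ennreal_measure) auto
  have \<mu>\<Lambda>: "density ?\<mu> (indicator \<Lambda>) = scale_measure (ennreal t) \<nu>\<Lambda>"
    unfolding \<nu>\<Lambda>_def by (rule density_scale_measure[OF L(1)])
  have sets_\<nu>\<Lambda>: "sets \<nu>\<Lambda> = sets ?\<mu>" by (simp add: \<nu>\<Lambda>_def)
  have \<nu>\<Lambda>_space: "emeasure \<nu>\<Lambda> (space \<nu>\<Lambda>) = ennreal ?V"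
    using emeasure_restricted[OF L(1) sets.top] sets.sets_into_space[OF L(1)]
    by (simp add: \<nu>\<Lambda>_def Int_absorb2 V)
  have fin: "finite_measure \<nu>\<Lambda>" by (intro finite_measureI) (simp add: \<nu>\<Lambda>_space)
  interpret \<nu>\<Lambda>: finite_measure \<nu>\<Lambda> by fact
  have fin\<mu>: "finite_measure (scale_measure (ennreal t) \<nu>\<Lambda>)"
    by (intro finite_measureI) (simp add: space_scale_measure \<nu>\<Lambda>_space ennreal_mult_eq_top_iff)
  interpret \<mu>\<Lambda>: finite_measure "scale_measure (ennreal t) \<nu>\<Lambda>" by (rule fin\<mu>)
  have measure_V: "measure \<nu>\<Lambda> (space \<nu>\<Lambda>) = ?V"
    using \<nu>\<Lambda>_space by (simp add: measure_def)
  have measure_\<mu>: "measure ?\<mu> \<Lambda> = t * ?V"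
  proof -
    have "emeasure ?\<mu> \<Lambda> = ennreal (t * ?V)"
      using t by (simp add: V ennreal_mult)
    then show ?thesis
      using t by (simp only: measure_def[of ?\<mu>] enn2real_ennreal mult_nonneg_nonneg measure_nonneg)
  qed
  let ?w = "avoid \<phi> x0 \<nu>\<Lambda>" and ?R = "cluster_measure \<phi> x0 \<nu>\<Lambda>" and ?r = "\<lambda>n. reach \<phi> x0 n n"
  let ?P = "\<lambda>n. Pi\<^sub>M {..<n} (\<lambda>_. \<nu>\<Lambda>)"
  have w: "ennreal (?w n x) = (\<integral>\<^sup>+y. (\<Prod>v\<in>vset n. ennreal (1 - \<phi> (rooted x0 x v) y)) \<partial>\<nu>\<Lambda>)"
    "?w n x \<le> ?V" "0 \<le> ?w n x" for n x
    using ennreal_avoid[OF fin bounds, where ?x0.0=x0 and n=n and x=x] unfolding measure_V by (simp_all add: avoid_def)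
  have w_meas: "?w n \<in> borel_measurable (?P n)" for n
    by (rule avoid_measurable[OF \<phi> fin sets_\<nu>\<Lambda>])
  have r_meas: "?r n \<in> borel_measurable (?P n)" for n
    by (rule reach_measurable'[OF \<phi> sets_\<nu>\<Lambda>])
  note [measurable] = w_meas r_meas
  \<comment> \<open>The scaling by \<open>t\<close> acts in two places: \<open>t ^ n\<close> comes
    from the \<open>n\<close> cluster coordinates, the other powers from the inner integral over a
    point outside.\<close>
  have reach_int: "(\<integral>\<^sup>+x. reach \<phi> x0 (n + j) n x \<partial>Pi\<^sub>M {..<n + j} (\<lambda>_. density ?\<mu> (indicator \<Lambda>))) =
      ennreal (t ^ n) * (\<integral>\<^sup>+x. ?r n x * ennreal ((t * ?w n x) ^ j) \<partial>?P n)" for n j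
  proof -
    have "(\<integral>\<^sup>+x. reach \<phi> x0 (n + j) n x \<partial>Pi\<^sub>M {..<n + j} (\<lambda>_. density ?\<mu> (indicator \<Lambda>))) =
      (\<integral>\<^sup>+x. ?r n x * (\<integral>\<^sup>+y. (\<Prod>v\<in>vset n. ennreal (1 - \<phi> (rooted x0 x v) y)) \<partial>scale_measure (ennreal t) \<nu>\<Lambda>) ^ (n + j - n)
        \<partial>Pi\<^sub>M {..<n} (\<lambda>_. scale_measure (ennreal t) \<nu>\<Lambda>))"
      unfolding \<mu>\<Lambda> by (rule nn_integral_reach[OF \<phi> bounds])
        (use \<mu>\<Lambda>.sigma_finite_measure_axioms sets_\<nu>\<Lambda> in auto)
    also have "\<dots> = (\<integral>\<^sup>+x. ?r n x * ennreal ((t * ?w n x) ^ j) \<partial>scale_measure (ennreal (t ^ n)) (?P n))"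
    proof -
      have "(\<integral>\<^sup>+y. (\<Prod>v\<in>vset n. ennreal (1 - \<phi> (rooted x0 x v) y)) \<partial>scale_measure (ennreal t) \<nu>\<Lambda>) ^ j =
          ennreal ((t * ?w n x) ^ j)" for x
        unfolding nn_integral_scale_measure[OF avoidance_measurable[OF \<phi> sets_\<nu>\<Lambda>]] w(1)[symmetric]
          ennreal_mult[OF t w(3), symmetric]
        by (rule ennreal_power) (use t w(3) in simp)
      moreover have "Pi\<^sub>M {..<n} (\<lambda>_. scale_measure (ennreal t) \<nu>\<Lambda>) = scale_measure (ennreal (t ^ n)) (?P n)"
        using PiM_scale_measure[OF fin, of "{..<n}" "ennreal t"] by (simp add: ennreal_power[OF t])
      ultimately show ?thesis by (simp only: diff_add_inverse)
    qed
    also have "\<dots> = ennreal (t ^ n) * (\<integral>\<^sup>+x. ?r n x * ennreal ((t * ?w n x) ^ j) \<partial>?P n)"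
      by (rule nn_integral_scale_measure) measurable
    finally show ?thesis .
  qed
  define c where "c n = (1 - \<gamma>) ^ Suc n * t ^ n" for n
  have c: "c n \<ge> 0" for n using \<gamma> t by (simp add: c_def)
  have sized_eq: "emeasure (mrcm_space \<Omega>) (sized (n + j) n \<inter> no_ghost \<gamma>) =
      (\<integral>\<^sup>+x. ennreal (c n * exp (- (t * ?V)) / fact n * ((t * ?w n x) ^ j / fact j)) * ?r n x \<partial>?P n)" for n j
  proof -
    let ?m = "emeasure (mrcm_space \<Omega>) (sized (n + j) n \<inter> no_ghost \<gamma>)"
    have "ennreal (fact n * fact j) * ?m = of_nat (fact n * fact (n + j - n)) * ?m"
      by (simp only: ennreal_of_nat_eq_real_of_nat of_nat_mult of_nat_fact diff_add_inverse)
    also have "\<dots> = ennreal (1 - \<gamma>) ^ Suc n * (ennreal (exp (- (t * ?V))) *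
        (ennreal (t ^ n) * (\<integral>\<^sup>+x. ?r n x * ennreal ((t * ?w n x) ^ j) \<partial>?P n)))"
      unfolding reach_int[symmetric] measure_\<mu>[symmetric] by (rule emeasure_sized[OF \<gamma>]) simp
    also have "\<dots> = ennreal (c n * exp (- (t * ?V))) * (\<integral>\<^sup>+x. ?r n x * ennreal ((t * ?w n x) ^ j) \<partial>?P n)"
    proof -
      have "ennreal (c n * exp (- (t * ?V))) = ennreal (1 - \<gamma>) ^ Suc n * ennreal (t ^ n) * ennreal (exp (- (t * ?V)))"
      proof -
        have p: "0 \<le> (1 - \<gamma>) ^ Suc n" "0 \<le> t ^ n" using \<gamma> t by simp_all
        have "ennreal (c n * exp (- (t * ?V))) = ennreal (c n) * ennreal (exp (- (t * ?V)))"
          by (rule ennreal_mult) (simp_all add: c)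
        also have "ennreal (c n) = ennreal ((1 - \<gamma>) ^ Suc n) * ennreal (t ^ n)"
          unfolding c_def by (rule ennreal_mult[OF p])
        also have "ennreal ((1 - \<gamma>) ^ Suc n) = ennreal (1 - \<gamma>) ^ Suc n"
          using \<gamma> by (intro ennreal_power[symmetric]) simp
        finally show ?thesis .
      qed
      then show ?thesis by (simp only: ac_simps)
    qed
    \<comment> \<open>Multiplication by the reciprocal performs the division by
      \<open>fact n\<close> and \<open>fact j\<close>. The first goes into the normalization of
      \<open>cluster_measure\<close>, the second into the coefficients of the exponential
      series.\<close>
    finally have "ennreal (1 / (fact n * fact j)) * (ennreal (fact n * fact j) * ?m) =
      ennreal (1 / (fact n * fact j)) * (ennreal (c n * exp (- (t * ?V))) * (\<integral>\<^sup>+x. ?r n x * ennreal ((t * ?w n x) ^ j) \<partial>?P n))"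
      by (simp only:)
    moreover have "ennreal (1 / (fact n * fact j)) * (ennreal (fact n * fact j) * ?m) = ?m"
      unfolding mult.assoc[symmetric] by (subst ennreal_mult[symmetric]) simp_all
    moreover have "ennreal (1 / (fact n * fact j)) * (ennreal (c n * exp (- (t * ?V))) * (\<integral>\<^sup>+x. ?r n x * ennreal ((t * ?w n x) ^ j) \<partial>?P n))
      = (\<integral>\<^sup>+x. ennreal (c n * exp (- (t * ?V)) / (fact n * fact j)) * (?r n x * ennreal ((t * ?w n x) ^ j)) \<partial>?P n)"
    proof -
      have "ennreal (1 / (fact n * fact j)) * ennreal (c n * exp (- (t * ?V))) = ennreal (c n * exp (- (t * ?V)) / (fact n * fact j))"
        using c[of n] by (subst ennreal_mult[symmetric]) simp_all
      moreover have "(\<lambda>x. ?r n x * ennreal ((t * ?w n x) ^ j)) \<in> borel_measurable (?P n)" by measurable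
      ultimately show ?thesis
        unfolding mult.assoc[symmetric] by (simp only: nn_integral_cmult mult.assoc)
    qed
    moreover have "ennreal (c n * exp (- (t * ?V)) / (fact n * fact j)) * (?r n x * ennreal ((t * ?w n x) ^ j))
      = ennreal (c n * exp (- (t * ?V)) / fact n * ((t * ?w n x) ^ j / fact j)) * ?r n x" for x
    proof -
      have "ennreal (c n * exp (- (t * ?V)) / fact n * ((t * ?w n x) ^ j / fact j)) =
        ennreal (c n * exp (- (t * ?V)) / (fact n * fact j)) * ennreal ((t * ?w n x) ^ j)"
        using c[of n] t w(3)[of n x] by (subst ennreal_mult[symmetric]) simp_all
      then show ?thesis by (simp only: ac_simps)
    qed
    ultimately show ?thesis by (simp only:)
  qed
  have sum_j: "(\<Sum>j. emeasure (mrcm_space \<Omega>) (sized (n + j) n \<inter> no_ghost \<gamma>)) =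
      ennreal (c n * (\<integral>x. exp (- t * (?V - ?w n x)) \<partial>?R n))" for n
  proof -
    have "(\<Sum>j. emeasure (mrcm_space \<Omega>) (sized (n + j) n \<inter> no_ghost \<gamma>)) =
      (\<integral>\<^sup>+x. (\<Sum>j. ennreal (c n * exp (- (t * ?V)) / fact n * ((t * ?w n x) ^ j / fact j)) * ?r n x) \<partial>?P n)"
      unfolding sized_eq by (rule nn_integral_suminf[symmetric]) measurable
    also have "\<dots> = (\<integral>\<^sup>+x. ennreal (1 / fact n) * ?r n x * ennreal (c n * exp (- t * (?V - ?w n x))) \<partial>?P n)"
    proof (rule nn_integral_cong)
      fix x
      \<comment> \<open>Here the points outside the cluster disappear: the series sums to
        \<open>exp (t * ?w n x)\<close> and meets the void factor \<open>exp (- (t * ?V))\<close>,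
        so that only the volume attached to the cluster is left.\<close>
      have "(\<lambda>j. c n * exp (- (t * ?V)) / fact n * ((t * ?w n x) ^ j /\<^sub>R fact j)) sums
          (c n * exp (- (t * ?V)) / fact n * exp (t * ?w n x))"
        by (intro sums_mult exp_converges)
      then have "(\<lambda>j. c n * exp (- (t * ?V)) / fact n * ((t * ?w n x) ^ j / fact j)) sums
          (1 / fact n * (c n * exp (- t * (?V - ?w n x))))"
        by (simp add: divide_inverse mult_ac right_diff_distrib exp_diff exp_minus)
      then have "(\<Sum>j. ennreal (c n * exp (- (t * ?V)) / fact n * ((t * ?w n x) ^ j / fact j))) =
          ennreal (1 / fact n * (c n * exp (- t * (?V - ?w n x))))"
        using c t w(3) by (intro suminf_ennreal_eq) auto
      also have "\<dots> = ennreal (1 / fact n) * ennreal (c n * exp (- t * (?V - ?w n x)))"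
        using c by (intro ennreal_mult) auto
      finally have eq: "(\<Sum>j. ennreal (c n * exp (- (t * ?V)) / fact n * ((t * ?w n x) ^ j / fact j))) =
          ennreal (1 / fact n) * ennreal (c n * exp (- t * (?V - ?w n x)))" .
      show "(\<Sum>j. ennreal (c n * exp (- (t * ?V)) / fact n * ((t * ?w n x) ^ j / fact j)) * ?r n x) =
          ennreal (1 / fact n) * ?r n x * ennreal (c n * exp (- t * (?V - ?w n x)))"
        unfolding ennreal_suminf_multc eq by (simp only: ac_simps)
    qed
    also have "\<dots> = (\<integral>\<^sup>+x. ennreal (c n * exp (- t * (?V - ?w n x))) \<partial>?R n)"
      unfolding cluster_measure_def by (rule nn_integral_density[symmetric]) measurable
    also have "\<dots> = ennreal (\<integral>x. c n * exp (- t * (?V - ?w n x)) \<partial>?R n)"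
    proof (rule nn_integral_eq_integral)
      interpret R: finite_measure "?R n" by (rule finite_cluster_measure[OF \<phi> fin sets_\<nu>\<Lambda>])
      have m: "(\<lambda>x. c n * exp (- t * (?V - ?w n x))) \<in> borel_measurable (?R n)"
        unfolding cluster_measure_def by measurable
      have "norm (c n * exp (- t * (?V - ?w n x))) \<le> c n" for x
        using c[of n] t w(2)[of n x] by (simp add: abs_mult mult_left_le)
      then show "integrable (?R n) (\<lambda>x. c n * exp (- t * (?V - ?w n x)))"
        by (intro R.integrable_const_bound[OF _ m, of "c n"]) simp
    qed (use c in simp)
    finally show ?thesis by simp
  qed
  have nonneg: "0 \<le> c n * (\<integral>x. exp (- t * (?V - ?w n x)) \<partial>?R n)" for n
    using c by (intro mult_nonneg_nonneg integral_nonneg_AE) auto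
  have "(\<Sum>n. ennreal (c n * (\<integral>x. exp (- t * (?V - ?w n x)) \<partial>?R n))) = emeasure (mrcm_space \<Omega>) (no_ghost \<gamma>)"
    unfolding emeasure_no_ghost_eq_suminf sum_j ..
  also have "\<dots> = ennreal (measure (mrcm_space \<Omega>) (no_ghost \<gamma>))"
    using mrcm.emeasure_eq_measure unfolding mrcm_space_def by simp
  finally have eq: "(\<Sum>n. ennreal (c n * (\<integral>x. exp (- t * (?V - ?w n x)) \<partial>?R n))) = ennreal (measure (mrcm_space \<Omega>) (no_ghost \<gamma>))" .
  have "(\<lambda>n. c n * (\<integral>x. exp (- t * (?V - ?w n x)) \<partial>?R n)) sums measure (mrcm_space \<Omega>) (no_ghost \<gamma>)"
  proof -
    have "(\<lambda>n. ennreal (c n * (\<integral>x. exp (- t * (?V - ?w n x)) \<partial>?R n))) sums ennreal (measure (mrcm_space \<Omega>) (no_ghost \<gamma>))"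
      unfolding eq[symmetric] by (rule summable_sums) simp
    then show ?thesis by (rule sums_ennreal[OF nonneg measure_nonneg, THEN iffD1])
  qed
  then show ?thesis by (simp add: c_def mult.assoc)
qed

section \<open>Exhaustion by windows\<close>

text \<open>All windows are coupled on one probability space. A path from the root is finite and
  lies in some window, so the window clusters increase to the full cluster, which may be infinite.
  The events \<open>no_ghost\<close> then decrease to the complement of the event in
  \<open>magnetization\<close>, and continuity from above gives the limit.\<close>

lemma magnetization_eq_limit:
  fixes X :: "nat \<Rightarrow> 'w \<Rightarrow> (real ^ 'd) \<times> 'e"
  assumes win: "\<And>m. poisson_window \<phi> \<Omega> \<kappa> X \<mu> (W m) f" and W: "incseq W" "(\<Union>m. W m) = UNIV"
  shows "(\<lambda>m. 1 - measure (mrcm_space \<Omega>) (poisson_window.no_ghost \<phi> \<Omega> \<kappa> X (0, a) (W m) \<gamma>))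
    \<longlonglongrightarrow> magnetization \<phi> \<Omega> \<kappa> X \<gamma> a"
proof -
  let ?G = "\<lambda>m. poisson_window.no_ghost \<phi> \<Omega> \<kappa> X (0, a) (W m) \<gamma>"
  let ?C = "\<lambda>m. poisson_window.wcluster \<phi> \<kappa> X (0, a) (W m)"
  let ?M = "mrcm_space \<Omega>"
  interpret w0: poisson_window \<phi> \<Omega> \<kappa> X \<mu> "(0, a)" "W 0" f by (rule win)
  interpret M: prob_space ?M
    unfolding mrcm_space_def by (rule w0.mrcm.prob_space_axioms)
  have sets: "?G m \<in> M.events" for m
    by (rule poisson_window.no_ghost_sets[OF win])
  have C: "?C m \<omega> u = component \<phi> (site (0, a) X \<omega>) (insert None (Some ` points \<kappa> X (W m) \<omega>)) u None" for m \<omega> u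
    by (rule poisson_window.wcluster_def[OF win])
  have mono: "points \<kappa> X (W m) \<omega> \<subseteq> points \<kappa> X (W l) \<omega>" if "m \<le> l" for m l \<omega>
    using incseqD[OF W(1) that] by (auto simp: points_def)
  have V_mono: "insert None (Some ` points \<kappa> X (W m) \<omega>) \<subseteq> insert None (Some ` points \<kappa> X (W l) \<omega>)"
    if "m \<le> l" for m l \<omega>
    using mono[OF that] by blast
  have inc: "incseq (\<lambda>m. insert None (Some ` points \<kappa> X (W m) \<omega>))" for \<omega>
    by (rule incseq_SucI, rule V_mono) simp
  have vert: "vertices \<kappa> \<omega> = (\<Union>m. insert None (Some ` points \<kappa> X (W m) \<omega>))" for \<omega>
  proof -
    have "{i. enat i < \<kappa> \<omega>} = (\<Union>m. points \<kappa> X (W m) \<omega>)"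
      using W(2) by (auto simp: points_def)
    then show ?thesis by (auto simp: vertices_def)
  qed
  have cl: "cluster \<phi> \<kappa> X (0, a) \<omega> u = (\<Union>m. ?C m \<omega> u)" for \<omega> u
    unfolding cluster_eq_component vert component_UN_incseq[OF inc] C ..
  have G: "?G m = {p \<in> space ?M. \<forall>w\<in>?C m (fst p) (fst (snd p)). \<gamma> < snd (snd p) w}" for m
    by (rule poisson_window.no_ghost_def[OF win])
  have dec: "decseq ?G"
  proof (rule decseq_SucI)
    fix m
    have "?C m \<omega> u \<subseteq> ?C (Suc m) \<omega> u" for \<omega> u
      unfolding C by (rule component_mono, rule V_mono) simp
    then show "?G (Suc m) \<subseteq> ?G m" unfolding G by blast
  qed
  have "(\<lambda>m. M.prob (?G m)) \<longlonglongrightarrow> M.prob (\<Inter>m. ?G m)"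
    by (rule M.finite_Lim_measure_decseq[OF _ dec]) (use sets in auto)
  then have "(\<lambda>m. 1 - M.prob (?G m)) \<longlonglongrightarrow> 1 - M.prob (\<Inter>m. ?G m)"
    by (intro tendsto_intros)
  also have "1 - M.prob (\<Inter>m. ?G m) = M.prob (space ?M - (\<Inter>m. ?G m))"
    by (rule M.prob_compl[symmetric]) (use sets in auto)
  also have "space ?M - (\<Inter>m. ?G m) =
      {(\<omega>, u, l) \<in> space ?M. \<exists>w\<in>cluster \<phi> \<kappa> X (0, a) \<omega> u. l w \<le> \<gamma>}"
    unfolding G cl not_le[symmetric] by auto
  finally show ?thesis unfolding magnetization_def .
qed

theorem lemma3p4:
  fixes P :: "'e :: polish_space measure"
    and \<phi> :: "(real ^ 'd) \<times> 'e \<Rightarrow> (real ^ 'd) \<times> 'e \<Rightarrow> real"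
    and \<Omega> :: "real \<Rightarrow> 'w measure"
    and \<kappa> :: "real \<Rightarrow> 'w \<Rightarrow> enat"
    and X :: "real \<Rightarrow> nat \<Rightarrow> 'w \<Rightarrow> (real ^ 'd) \<times> 'e"
  assumes "prob_space P" and "sets P = sets borel"
    and "adjacency_function P \<phi>"
    and "\<And>t. t \<ge> 0 \<Longrightarrow>
           poisson_process (\<Omega> t) (\<kappa> t) (X t) (scale_measure (ennreal t) (site_measure P))"
  shows "(\<forall>t\<ge>0. \<forall>a. real_analytic_on
             (\<lambda>\<gamma>. magnetization \<phi> (\<Omega> t) (\<kappa> t) (X t) \<gamma> a) {0<..<1}) \<and>
         (\<forall>\<gamma>\<in>{0<..<1}. \<forall>a. real_analytic_on
             (\<lambda>t. magnetization \<phi> (\<Omega> t) (\<kappa> t) (X t) \<gamma> a) {0<..})"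
proof -
  interpret P: prob_space P by fact
  let ?\<nu> = "site_measure P :: ((real ^ 'd) \<times> 'e) measure"
  define W where "W m = ball (0 :: real ^ 'd) (real m) \<times> (UNIV :: 'e set)" for m
  have space_P: "space P = UNIV"
    using sets_eq_imp_space_eq[OF assms(2)] by simp
  have space_\<nu>: "space ?\<nu> = UNIV"
    by (simp add: site_measure_def space_pair_measure space_P)
  have P_UNIV: "emeasure P UNIV = 1" using P.emeasure_space_1 by (simp add: space_P)
  have W_sets: "W m \<in> sets ?\<nu>" for m
    unfolding W_def site_measure_def using sets.top[of P] by (intro pair_measureI) (auto simp: space_P)
  have W_fin: "emeasure ?\<nu> (W m) < \<infinity>" for m
    unfolding W_def site_measure_def using sets.top[of P] emeasure_lborel_ball_finite[of 0 "real m"]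
    by (subst P.emeasure_pair_measure_Times) (auto simp: space_P P_UNIV)
  \<comment> \<open>Lebesgue measure has no atoms, so fixing the location gives a null set however
    concentrated the marks are.\<close>
  have null: "emeasure ?\<nu> {x \<in> space ?\<nu>. fst x = c} = 0" for c
  proof -
    have "{x \<in> space ?\<nu>. fst x = c} = {c} \<times> UNIV" by (auto simp: space_\<nu>)
    then show ?thesis
      unfolding site_measure_def using sets.top[of P]
      by (simp add: P.emeasure_pair_measure_Times space_P)
  qed
  have W_inc: "incseq W"
    by (rule incseq_SucI) (auto simp: W_def)
  have W_UN: "(\<Union>m. W m) = UNIV"
  proof -
    have "\<exists>m. x \<in> W m" for x
      using reals_Archimedean2[of "norm (fst x)"] by (cases x) (auto simp: W_def)
    then show ?thesis by auto
  qed
  have bounds: "0 \<le> \<phi> x y" "\<phi> x y \<le> 1" for x y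
    using assms(3) unfolding adjacency_function_def by (elim conjE; blast)+
  have \<phi>: "(\<lambda>(x, y). \<phi> x y) \<in> borel_measurable (?\<nu> \<Otimes>\<^sub>M ?\<nu>)"
    using assms(3) by (simp add: adjacency_function_def)
  have win: "poisson_window \<phi> (\<Omega> t) (\<kappa> t) (X t) (scale_measure (ennreal t) ?\<nu>) (W m) fst" if t: "t \<ge> 0" for t m
  proof
    let ?\<mu> = "scale_measure (ennreal t) ?\<nu>"
    have eq: "sets (?\<mu> \<Otimes>\<^sub>M ?\<mu>) = sets (?\<nu> \<Otimes>\<^sub>M ?\<nu>)"
      by (rule sets_pair_measure_cong) simp_all
    show "(\<lambda>(x, y). \<phi> x y) \<in> borel_measurable (?\<mu> \<Otimes>\<^sub>M ?\<mu>)"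
      unfolding measurable_cong_sets[OF eq refl] by (rule \<phi>)
    show "space ?\<mu> = UNIV" by (simp add: space_scale_measure space_\<nu>)
    show "poisson_process (\<Omega> t) (\<kappa> t) (X t) ?\<mu>" by (rule assms(4)[OF t])
    show "W m \<in> sets ?\<mu>" by (simp add: W_sets)
    show "emeasure ?\<mu> (W m) < \<infinity>"
      using W_fin[of m] by (simp add: ennreal_mult_less_top)
    show "fst \<in> borel_measurable ?\<mu>"
      by (simp add: measurable_cong_sets[OF sets_scale_measure refl] site_measure_def)
    show "emeasure ?\<mu> {x \<in> space ?\<mu>. fst x = c} = 0" for c
      using null[of c] by (simp add: space_scale_measure)
  qed (fact bounds)+
  have fin: "finite_measure (density ?\<nu> (indicator (W m)))" for m
    using emeasure_restricted[OF W_sets sets.top, of m] W_fin[of m]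
    by (intro finite_measureI) (simp add: space_\<nu>)
  have analytic: "(\<forall>t\<ge>0. real_analytic_on (\<lambda>\<gamma>. magnetization \<phi> (\<Omega> t) (\<kappa> t) (X t) \<gamma> a) {0<..<1}) \<and>
      (\<forall>\<gamma>\<in>{0<..<1}. real_analytic_on (\<lambda>t. magnetization \<phi> (\<Omega> t) (\<kappa> t) (X t) \<gamma> a) {0<..})" for a
  proof -
    let ?\<nu>W = "\<lambda>m. density ?\<nu> (indicator (W m))"
    \<comment> \<open>\<open>\<rho>\<close> and \<open>G\<close> are formed from the unscaled
      \<open>site_measure P\<close>, hence they are the same for all \<open>t\<close>. This is what
      joins the models at different intensities into one holomorphic family.\<close>
    define \<rho> where "\<rho> m = cluster_measure \<phi> (0, a) (?\<nu>W m)" for m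
    define G where "G m n x = measure ?\<nu> (W m) - avoid \<phi> (0, a) (?\<nu>W m) n x" for m n x
    \<comment> \<open>Nonnegativity of \<open>M\<close> is required for every \<open>t\<close>, but
      for negative \<open>t\<close> nothing is known about \<open>\<Omega> t\<close>, not even that
      it is a probability space; the value 0 is a harmless default.\<close>
    define M where "M m t \<gamma> = (if 0 \<le> t then
      1 - measure (mrcm_space (\<Omega> t)) (poisson_window.no_ghost \<phi> (\<Omega> t) (\<kappa> t) (X t) (0, a) (W m) \<gamma>) else 0)" for m t \<gamma>
    have sets_W: "sets (?\<nu>W m) = sets ?\<nu>" for m by simp
    have 1: "finite_measure (\<rho> m n)" for m n
      unfolding \<rho>_def by (rule finite_cluster_measure[OF \<phi> space_\<nu> fin sets_W])
    have 2: "G m n \<in> borel_measurable (\<rho> m n)" for m n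
      using avoid_measurable[OF \<phi> space_\<nu> fin sets_W, of "(0, a)" m n]
      unfolding G_def \<rho>_def cluster_measure_def by simp
    have \<nu>W: "measure (?\<nu>W m) (space (?\<nu>W m)) = measure ?\<nu> (W m)" for m
      using emeasure_restricted[OF W_sets sets.top, of m] by (simp add: measure_def space_\<nu>)
    have 3: "0 \<le> G m n x" "G m n x \<le> measure ?\<nu> (W m)" for m n x
      using ennreal_avoid(2)[OF fin[of m] bounds, where ?x0.0="(0, a)" and n=n and x=x]
      unfolding G_def \<nu>W by (simp_all add: avoid_def)
    have 4: "(\<lambda>n. (1 - \<gamma>) ^ Suc n * (t ^ n * (\<integral>x. exp (- t * G m n x) \<partial>\<rho> m n))) sums (1 - M m t \<gamma>)"
      if "0 \<le> t" "0 \<le> \<gamma>" "\<gamma> < 1" for m t \<gamma>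
      using no_ghost_sums[OF win[OF that(1)] that(1,2) less_imp_le[OF that(3)] W_sets W_fin, of "(0, a)" m] that(1)
      unfolding G_def \<rho>_def M_def by simp
    have 5: "0 \<le> M m t \<gamma>" for m t \<gamma>
    proof (cases "0 \<le> t")
      case True
      interpret w: poisson_window \<phi> "\<Omega> t" "\<kappa> t" "X t" "scale_measure (ennreal t) ?\<nu>" "(0, a)" "W m" fst
        by (rule win[OF True])
      show ?thesis
        using w.mrcm.prob_le_1 True unfolding M_def mrcm_space_def by simp
    qed (simp add: M_def)
    have 6: "(\<lambda>m. M m t \<gamma>) \<longlonglongrightarrow> magnetization \<phi> (\<Omega> t) (\<kappa> t) (X t) \<gamma> a" if "0 \<le> t" for t \<gamma>
      using magnetization_eq_limit[OF win[OF that] W_inc W_UN, of a \<gamma>] that by (simp add: M_def)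
    show ?thesis
      using real_analytic_on_exp_moment_limit[where \<rho>=\<rho> and G=G and M=M and V="\<lambda>m. measure ?\<nu> (W m)"
        and F="\<lambda>t \<gamma>. magnetization \<phi> (\<Omega> t) (\<kappa> t) (X t) \<gamma> a", OF 1 2 3 4 5 6]
      by blast
  qed
  then show ?thesis by blast
qed

end
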